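(* Let $D(G)$ denote the set of equivalence classes of capped Dade $kG$-modules under the compatibility relation (which is an equivalence relation on the set of capped Dade $kG$-modules). Then the operation $[M]+[N]:=[M\otimes_k N]$ defines an abelian group structure on $D(G)$. Moreover, the group $D(G)$ defined this way is isomorphic to Lassueur's Dade group, defined using relative endotrivial modules.
   Context: $G$ is a finite group, $p$ a prime, $S$ a Sylow $p$-subgroup of $G$, $k$ an algebraically closed field of characteristic $p$. All $kG$-modules are finitely generated; $M\otimes N=M\otimes_k N$ has the diagonal action, $M^*=\mathrm{Hom}_k(M,k)$, and $\mathrm{End}(M)\cong M^*\otimes M$. A component of a module is an indecomposable direct summand. A $kG$-module is a $p$-permutation module if it is a direct summand of a permutation $kG$-module; it is an endo-$p$-permutation module if $\mathrm{End}(M)$ is a $p$-permutation module. A $kG$-module $M$ is a Dade $kG$-module if $\mathrm{End}(M)\cong k^n\oplus W$ for some integer $n\ge 0$ and some $p$-permutation module $W$ all of whose components have vertices that are non-Sylow $p$-subgroups of $G$. A Dade module is capped if it has a component with vertex $S$. Two Dade modules $M,N$ are compatible if $M\oplus N$ is a Dade module. Lassueur's Dade group: For a $kG$-module $V$, a module $M$ is $V$-projective if $M$ is a direct summand of $V\otimes N$ for some $kG$-module $N$. Let $\mathcal F_G$ be the set of non-Sylow $p$-subgroups of $G$ and $V(\mathcal F_G):=\bigoplus_{[Q]\in\mathcal F_G/G}k[G/Q]$, the sum running over $G$-conjugacy classes. An endo-$p$-permutation module $M$ is strongly capped if it is $V(\mathcal F_G)$-endotrivial, i.e. $\mathrm{End}(M)\cong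 k\oplus W$ with $W$ a $V(\mathcal F_G)$-projective module. Such an $M$ has a unique indecomposable summand $M_0$ with vertex $S$, called its cap. Two strongly capped modules are equivalent if their caps are isomorphic. Lassueur's Dade group is the set of equivalence classes of strongly capped endo-$p$-permutation $kG$-modules with addition $[M]+[N]:=[M\otimes N]$. *)

theory Defs
  imports
    "HOL-Algebra.Group"
    "HOL-Algebra.Coset"
    "HOL-Algebra.Left_Coset"
    "HOL-Algebra.Group_Action"
    "HOL-Computational_Algebra.Computational_Algebra"
    "Jordan_Normal_Form.Matrix"
begin

section \<open>Finitely generated modules over group algebras\<close>

text \<open>
  A finitely generated \<open>kG\<close>-module is a finite-dimensional vector space with a linear action
  of \<open>G\<close>.  Choosing a basis, we take the underlying space to be the column space \<open>k ^ deg M\<close>,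
  on which \<open>g\<close> acts as multiplication by the matrix \<open>act M g\<close>.  Every finitely generated module
  is isomorphic to one of these, so isomorphism-invariant notions are unaffected, and the modules
  over a given \<open>G\<close> and \<open>k\<close> form a set.  The values of \<open>act M\<close> outside the group are irrelevant;
  in particular restriction to a subgroup \<open>H\<close> just means reading the same data over
  \<open>G\<lparr>carrier := H\<rparr>\<close>.
\<close>

record ('g, 'k) rep =
  deg :: nat
  act :: "'g \<Rightarrow> 'k mat"

definition kG_module :: "('g, 'b) monoid_scheme \<Rightarrow> ('g, 'k::field) rep \<Rightarrow> bool" where
  "kG_module G M \<longleftrightarrow>
     (\<forall>g\<in>carrier G. act M g \<in> carrier_mat (deg M) (deg M)) \<and>
     act M \<one>\<^bsub>G\<^esub> = 1\<^sub>m (deg M) \<and>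
     (\<forall>g\<in>carrier G. \<forall>h\<in>carrier G. act M (g \<otimes>\<^bsub>G\<^esub> h) = act M g * act M h)"

definition iso_mod ::
  "('g, 'b) monoid_scheme \<Rightarrow> ('g, 'k::field) rep \<Rightarrow> ('g, 'k) rep \<Rightarrow> bool" where
  "iso_mod G M N \<longleftrightarrow> deg M = deg N \<and>
     (\<exists>P\<in>carrier_mat (deg M) (deg M). invertible_mat P \<and>
        (\<forall>g\<in>carrier G. P * act M g = act N g * P))"

definition dsum :: "('g, 'k::field) rep \<Rightarrow> ('g, 'k) rep \<Rightarrow> ('g, 'k) rep" where
  "dsum M N = \<lparr>deg = deg M + deg N,
     act = (\<lambda>g. four_block_mat (act M g) (0\<^sub>m (deg M) (deg N)) (0\<^sub>m (deg N) (deg M)) (act N g))\<rparr>"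

text \<open>The module \<open>k ^ n\<close> with trivial action.\<close>

definition triv_mod :: "nat \<Rightarrow> ('g, 'k::field) rep" where
  "triv_mod n = \<lparr>deg = n, act = (\<lambda>g. 1\<^sub>m n)\<rparr>"

definition dsum_list :: "('g, 'k::field) rep list \<Rightarrow> ('g, 'k) rep" where
  "dsum_list Ms = foldr dsum Ms (triv_mod 0)"

text \<open>
  \<open>M \<otimes>\<^sub>k N\<close> with the diagonal action, in the basis \<open>e\<^sub>i \<otimes> f\<^sub>j\<close> numbered by \<open>i * deg N + j\<close>
  (Kronecker product of matrices).
\<close>

definition tensor_mod :: "('g, 'k::field) rep \<Rightarrow> ('g, 'k) rep \<Rightarrow> ('g, 'k) rep" where
  "tensor_mod M N = (let m = deg M; n = deg N in \<lparr>deg = m * n,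
     act = (\<lambda>g. mat (m * n) (m * n) (\<lambda>(r, c).
       act M g $$ (r div n, c div n) * act N g $$ (r mod n, c mod n)))\<rparr>)"

text \<open>
  \<open>End\<^sub>k(M)\<close> with the conjugation action, in the basis of matrix units, the matrix unit
  with entry \<open>1\<close> at \<open>(i, j)\<close> being numbered by \<open>i * deg M + j\<close>; see \<open>act_End_mod\<close> below.
\<close>

definition End_mod :: "('g, 'b) monoid_scheme \<Rightarrow> ('g, 'k::field) rep \<Rightarrow> ('g, 'k) rep" where
  "End_mod G M = (let n = deg M in \<lparr>deg = n * n,
     act = (\<lambda>g. mat (n * n) (n * n) (\<lambda>(r, c).
       act M g $$ (r div n, c div n) * act M (inv\<^bsub>G\<^esub> g) $$ (c mod n, r mod n)))\<rparr>)"

definition flatten_mat :: "nat \<Rightarrow> 'k mat \<Rightarrow> 'k vec" where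
  "flatten_mat n F = vec (n * n) (\<lambda>r. F $$ (r div n, r mod n))"

lemma sum_div_mod:
  fixes f :: "nat \<Rightarrow> nat \<Rightarrow> 'a::comm_monoid_add"
  shows "(\<Sum>c<m * n. f (c div n) (c mod n)) = (\<Sum>i<m. \<Sum>j<n. f i j)"
proof -
  have L: "i * n + j < m * n" if "i < m" "j < n" for i j
    using mult_le_mono1[of "Suc i" m n] that by auto
  then have L': "j + i * n < m * n" "j + n * i < n * m" if "i < m" "j < n" for i j
    using that by (simp_all add: add.commute mult.commute)
  have lt: "a mod n < n" if "a < m * n" for a
    using that by (cases "n = 0") auto
  have "(\<Sum>c<m * n. f (c div n) (c mod n)) = (\<Sum>(i, j)\<in>{..<m} \<times> {..<n}. f i j)"
    by (rule sum.reindex_bij_witness[where i = "\<lambda>(i, j). i * n + j" and j = "\<lambda>c. (c div n, c mod n)"])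
      (auto simp: less_mult_imp_div_less lt mult_ac intro!: L L')
  then show ?thesis by (simp add: sum.cartesian_product)
qed

text \<open>In these coordinates \<open>g\<close> sends \<open>F\<close> to \<open>g F g\<^sup>-\<^sup>1\<close>.\<close>

lemma act_End_mod:
  assumes "group G" "kG_module G M" "g \<in> carrier G" "F \<in> carrier_mat (deg M) (deg M)"
  shows "act (End_mod G M) g *\<^sub>v flatten_mat (deg M) F =
         flatten_mat (deg M) (act M g * F * act M (inv\<^bsub>G\<^esub> g))"
proof -
  define n where "n = deg M"
  define A where "A = act M g"
  define B where "B = act M (inv\<^bsub>G\<^esub> g)"
  have c: "A \<in> carrier_mat n n" "B \<in> carrier_mat n n" "F \<in> carrier_mat n n"
    using assms by (auto simp: kG_module_def A_def B_def n_def)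
  have "(\<Sum>c<n * n. A $$ (r div n, c div n) * B $$ (c mod n, r mod n) * F $$ (c div n, c mod n))
      = (A * F * B) $$ (r div n, r mod n)" if r: "r < n * n" for r
  proof -
    have n: "r div n < n" "r mod n < n"
      using r by (auto simp: less_mult_imp_div_less intro!: mod_less_divisor gr0I)
    have "(\<Sum>c<n * n. A $$ (r div n, c div n) * B $$ (c mod n, r mod n) * F $$ (c div n, c mod n))
      = (\<Sum>i<n. \<Sum>j<n. A $$ (r div n, i) * B $$ (j, r mod n) * F $$ (i, j))"
      by (rule sum_div_mod)
    also have "\<dots> = (A * (F * B)) $$ (r div n, r mod n)"
      using c n by (auto simp: scalar_prod_def sum_distrib_left lessThan_atLeast0 ac_simps intro!: sum.cong)
    also have "A * (F * B) = A * F * B"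
      using c by simp
    finally show ?thesis .
  qed
  then have "mat (n * n) (n * n) (\<lambda>(r, c). A $$ (r div n, c div n) * B $$ (c mod n, r mod n))
      *\<^sub>v flatten_mat n F = flatten_mat n (A * F * B)"
    by (intro eq_vecI) (auto simp: flatten_mat_def scalar_prod_def lessThan_atLeast0)
  then show ?thesis
    by (simp add: End_mod_def Let_def n_def A_def B_def)
qed


section \<open>Summands, components, vertices\<close>

definition summand ::
  "('g, 'b) monoid_scheme \<Rightarrow> ('g, 'k::field) rep \<Rightarrow> ('g, 'k) rep \<Rightarrow> bool" where
  "summand G N M \<longleftrightarrow> kG_module G N \<and> (\<exists>L. kG_module G L \<and> iso_mod G M (dsum N L))"

definition indecomposable :: "('g, 'b) monoid_scheme \<Rightarrow> ('g, 'k::field) rep \<Rightarrow> bool" where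
  "indecomposable G M \<longleftrightarrow> kG_module G M \<and> deg M \<noteq> 0 \<and>
     (\<forall>A B. kG_module G A \<and> kG_module G B \<and> iso_mod G M (dsum A B) \<longrightarrow> deg A = 0 \<or> deg B = 0)"

definition component ::
  "('g, 'b) monoid_scheme \<Rightarrow> ('g, 'k::field) rep \<Rightarrow> ('g, 'k) rep \<Rightarrow> bool" where
  "component G N M \<longleftrightarrow> indecomposable G N \<and> summand G N M"

text \<open>An arbitrary enumeration of a finite set, used to number bases.\<close>

definition enum_list :: "'a set \<Rightarrow> 'a list" where
  "enum_list X = (SOME xs. distinct xs \<and> set xs = X)"

text \<open>
  The induced module \<open>kG \<otimes>\<^sub>k\<^sub>H N\<close>: with \<open>t\<^sub>0, t\<^sub>1, \<dots>\<close> representatives of the left cosets of \<open>H\<close>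
  and \<open>d = deg N\<close>, the basis element \<open>t\<^sub>i \<otimes> e\<^sub>a\<close> is numbered by \<open>i * d + a\<close>.  As
  \<open>g t\<^sub>j = t\<^sub>i (t\<^sub>i\<^sup>-\<^sup>1 g t\<^sub>j)\<close>, the \<open>(i, j)\<close> block of \<open>g\<close> is the action of \<open>t\<^sub>i\<^sup>-\<^sup>1 g t\<^sub>j\<close> on \<open>N\<close> if this
  element lies in \<open>H\<close>, and zero otherwise.
\<close>

definition coset_reps :: "('g, 'b) monoid_scheme \<Rightarrow> 'g set \<Rightarrow> 'g list" where
  "coset_reps G H = map (\<lambda>C. SOME x. x \<in> C) (enum_list (lcosets\<^bsub>G\<^esub> H))"

definition ind_mod ::
  "('g, 'b) monoid_scheme \<Rightarrow> 'g set \<Rightarrow> ('g, 'k::field) rep \<Rightarrow> ('g, 'k) rep" where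
  "ind_mod G H N = (let ts = coset_reps G H; d = deg N; n = length ts * d in \<lparr>deg = n,
     act = (\<lambda>g. mat n n (\<lambda>(r, c).
       let x = inv\<^bsub>G\<^esub> (ts ! (r div d)) \<otimes>\<^bsub>G\<^esub> g \<otimes>\<^bsub>G\<^esub> ts ! (c div d)
       in if x \<in> H then act N x $$ (r mod d, c mod d) else 0))\<rparr>)"

definition rel_projective ::
  "('g, 'b) monoid_scheme \<Rightarrow> 'g set \<Rightarrow> ('g, 'k::field) rep \<Rightarrow> bool" where
  "rel_projective G H M \<longleftrightarrow> (\<exists>N. kG_module (G\<lparr>carrier := H\<rparr>) N \<and> summand G M (ind_mod G H N))"

definition vertex ::
  "('g, 'b) monoid_scheme \<Rightarrow> 'g set \<Rightarrow> ('g, 'k::field) rep \<Rightarrow> bool" where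
  "vertex G Q M \<longleftrightarrow> indecomposable G M \<and> subgroup Q G \<and> rel_projective G Q M \<and>
     (\<forall>R. subgroup R G \<and> R \<subset> Q \<longrightarrow> \<not> rel_projective G R M)"


section \<open>Permutation modules\<close>

text \<open>\<open>k[X]\<close> for a finite set \<open>X\<close> on which \<open>G\<close> acts by \<open>\<phi>\<close>.\<close>

definition perm_mod :: "'x set \<Rightarrow> ('g \<Rightarrow> 'x \<Rightarrow> 'x) \<Rightarrow> ('g, 'k::field) rep" where
  "perm_mod X \<phi> = (let xs = enum_list X; n = length xs in \<lparr>deg = n,
     act = (\<lambda>g. mat n n (\<lambda>(i, j). if xs ! i = \<phi> g (xs ! j) then 1 else 0))\<rparr>)"

definition coset_mod :: "('g, 'b) monoid_scheme \<Rightarrow> 'g set \<Rightarrow> ('g, 'k::field) rep" where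
  "coset_mod G Q = perm_mod (lcosets\<^bsub>G\<^esub> Q) (\<lambda>g C. g <#\<^bsub>G\<^esub> C)"

text \<open>Any finite \<open>G\<close>-set is isomorphic to one on an initial segment of the natural numbers.\<close>

definition permutation_module :: "('g, 'b) monoid_scheme \<Rightarrow> ('g, 'k::field) rep \<Rightarrow> bool" where
  "permutation_module G M \<longleftrightarrow> kG_module G M \<and>
     (\<exists>(n::nat) \<phi>. group_action G {..<n} \<phi> \<and> iso_mod G M (perm_mod {..<n} \<phi>))"

definition p_permutation :: "('g, 'b) monoid_scheme \<Rightarrow> ('g, 'k::field) rep \<Rightarrow> bool" where
  "p_permutation G M \<longleftrightarrow> (\<exists>P. permutation_module G P \<and> summand G M P)"

definition endo_p_permutation :: "('g, 'b) monoid_scheme \<Rightarrow> ('g, 'k::field) rep \<Rightarrow> bool" where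
  "endo_p_permutation G M \<longleftrightarrow> kG_module G M \<and> p_permutation G (End_mod G M)"


section \<open>Sylow and non-Sylow \<open>p\<close>-subgroups\<close>

definition p_subgroup :: "('g, 'b) monoid_scheme \<Rightarrow> nat \<Rightarrow> 'g set \<Rightarrow> bool" where
  "p_subgroup G p Q \<longleftrightarrow> subgroup Q G \<and> (\<exists>n. card Q = p ^ n)"

definition sylow_subgroup :: "('g, 'b) monoid_scheme \<Rightarrow> nat \<Rightarrow> 'g set \<Rightarrow> bool" where
  "sylow_subgroup G p Q \<longleftrightarrow> subgroup Q G \<and> card Q = p ^ multiplicity p (Coset.order G)"

definition non_sylow :: "('g, 'b) monoid_scheme \<Rightarrow> nat \<Rightarrow> 'g set set" where
  "non_sylow G p = {Q. p_subgroup G p Q \<and> \<not> sylow_subgroup G p Q}"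

definition conj_class :: "('g, 'b) monoid_scheme \<Rightarrow> 'g set \<Rightarrow> 'g set set" where
  "conj_class G Q = {g <#\<^bsub>G\<^esub> Q #>\<^bsub>G\<^esub> inv\<^bsub>G\<^esub> g | g. g \<in> carrier G}"


section \<open>The Dade group\<close>

definition Dade_module :: "('g, 'b) monoid_scheme \<Rightarrow> nat \<Rightarrow> ('g, 'k::field) rep \<Rightarrow> bool" where
  "Dade_module G p M \<longleftrightarrow> kG_module G M \<and>
     (\<exists>n W. p_permutation G W \<and>
        (\<forall>N. component G N W \<longrightarrow> (\<exists>Q\<in>non_sylow G p. vertex G Q N)) \<and>
        iso_mod G (End_mod G M) (dsum (triv_mod n) W))"

definition capped_Dade ::
  "('g, 'b) monoid_scheme \<Rightarrow> nat \<Rightarrow> 'g set \<Rightarrow> ('g, 'k::field) rep set" where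
  "capped_Dade G p S = {M. Dade_module G p M \<and> (\<exists>N. component G N M \<and> vertex G S N)}"

definition compatible ::
  "('g, 'b) monoid_scheme \<Rightarrow> nat \<Rightarrow> ('g, 'k::field) rep \<Rightarrow> ('g, 'k) rep \<Rightarrow> bool" where
  "compatible G p M N \<longleftrightarrow>
     Dade_module G p M \<and> Dade_module G p N \<and> Dade_module G p (dsum M N)"

definition compat_rel ::
  "('g, 'b) monoid_scheme \<Rightarrow> nat \<Rightarrow> 'g set \<Rightarrow> (('g, 'k::field) rep \<times> ('g, 'k) rep) set" where
  "compat_rel G p S =
     {(M, N). M \<in> capped_Dade G p S \<and> N \<in> capped_Dade G p S \<and> compatible G p M N}"

text \<open>
  The operation on classes of modules induced by the tensor product.  It sends the classes of
  \<open>M\<close> and \<open>N\<close> to the class of \<open>tensor_mod M N\<close> provided the latter only depends on the classes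
  of \<open>M\<close> and \<open>N\<close>.
\<close>

definition tensor_class ::
  "(('g, 'k::field) rep \<times> ('g, 'k) rep) set \<Rightarrow>
   ('g, 'k) rep set \<Rightarrow> ('g, 'k) rep set \<Rightarrow> ('g, 'k) rep set" where
  "tensor_class r X Y = (\<Union>M\<in>X. \<Union>N\<in>Y. r `` {tensor_mod M N})"

definition Dade_group ::
  "('g, 'b) monoid_scheme \<Rightarrow> nat \<Rightarrow> 'g set \<Rightarrow> ('g, 'k::field) rep set monoid" where
  "Dade_group G p S =
     \<lparr>carrier = capped_Dade G p S // compat_rel G p S,
      monoid.mult = tensor_class (compat_rel G p S),
      one = compat_rel G p S `` {triv_mod 1}\<rparr>"


section \<open>Lassueur's Dade group\<close>

definition V_projective ::
  "('g, 'b) monoid_scheme \<Rightarrow> ('g, 'k::field) rep \<Rightarrow> ('g, 'k) rep \<Rightarrow> bool" where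
  "V_projective G V M \<longleftrightarrow> (\<exists>N. kG_module G N \<and> summand G M (tensor_mod V N))"

text \<open>\<open>V(\<F>\<^sub>G)\<close>: one summand \<open>k[G/Q]\<close> for each conjugacy class of non-Sylow \<open>p\<close>-subgroups.\<close>

definition V_non_sylow :: "('g, 'b) monoid_scheme \<Rightarrow> nat \<Rightarrow> ('g, 'k::field) rep" where
  "V_non_sylow G p =
     dsum_list (map (\<lambda>C. coset_mod G (SOME Q. Q \<in> C))
       (enum_list (conj_class G ` non_sylow G p)))"

definition strongly_capped ::
  "('g, 'b) monoid_scheme \<Rightarrow> nat \<Rightarrow> ('g, 'k::field) rep set" where
  "strongly_capped G p = {M. endo_p_permutation G M \<and>
     (\<exists>W. V_projective G (V_non_sylow G p) W \<and> iso_mod G (End_mod G M) (dsum (triv_mod 1) W))}"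

text \<open>The cap, which is well defined up to isomorphism for strongly capped \<open>M\<close>.\<close>

definition cap ::
  "('g, 'b) monoid_scheme \<Rightarrow> 'g set \<Rightarrow> ('g, 'k::field) rep \<Rightarrow> ('g, 'k) rep" where
  "cap G S M = (SOME C. component G C M \<and> vertex G S C)"

definition cap_rel ::
  "('g, 'b) monoid_scheme \<Rightarrow> nat \<Rightarrow> 'g set \<Rightarrow> (('g, 'k::field) rep \<times> ('g, 'k) rep) set" where
  "cap_rel G p S = {(M, N). M \<in> strongly_capped G p \<and> N \<in> strongly_capped G p \<and>
     iso_mod G (cap G S M) (cap G S N)}"

definition Lassueur_Dade_group ::
  "('g, 'b) monoid_scheme \<Rightarrow> nat \<Rightarrow> 'g set \<Rightarrow> ('g, 'k::field) rep set monoid" where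
  "Lassueur_Dade_group G p S =
     \<lparr>carrier = strongly_capped G p // cap_rel G p S,
      monoid.mult = tensor_class (cap_rel G p S),
      one = cap_rel G p S `` {triv_mod 1}\<rparr>"

end

theory Submission
  imports Defs "Jordan_Normal_Form.Char_Poly"
begin

text \<open>
  Everything is expressed through retracts, i.e. pairs of homomorphisms \<open>i\<close>, \<open>q\<close> with \<open>q i = 1\<close>.
  Call a module \<open>\<F>\<close>-projective if it is a retract of some \<open>V(\<F>\<^sub>G) \<otimes> N\<close>.  As \<open>p\<close> divides
  \<open>[G : Q]\<close> for every non-Sylow \<open>Q\<close>, a composite \<open>k \<rightarrow> W \<rightarrow> k\<close> with \<open>W\<close> \<open>\<F>\<close>-projective vanishes.
  Hence every retract of \<open>k\<^sup>n \<oplus> W\<close> is again \<open>k\<^sup>m \<oplus> W'\<close>, and the \<open>p\<close>-permutation modules of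
  this form are closed under sums, tensor products and retracts.  A module \<open>M\<close> is Dade iff
  \<open>M \<otimes> M\<^sup>*\<close> is of this form, it is capped iff it is not \<open>\<F>\<close>-projective, and capped Dade modules
  are compatible iff \<open>M \<otimes> N\<^sup>*\<close> and \<open>N \<otimes> M\<^sup>*\<close> are of this form.  Transitivity follows because
  \<open>L \<otimes> N\<^sup>*\<close> is a retract of \<open>L \<otimes> M\<^sup>* \<otimes> M \<otimes> N\<^sup>*\<close>, and the group laws because a capped
  Dade module is compatible with each of its retracts that is not \<open>\<F>\<close>-projective; in particular
  \<open>M\<^sup>* \<otimes> M\<close> is compatible with \<open>k\<close>.  By the trace form on \<open>Hom\<^sub>k(C, C')\<close>, compatible
  indecomposable modules are isomorphic, and \<open>k\<close> has multiplicity one in \<open>End(C)\<close> for a cap \<open>C\<close>.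
  So each class contains a strongly capped module, and equality of caps is compatibility.
\<close>

section \<open>Matrices\<close>

text \<open>No Krull-Schmidt theorem is used. Retracts compose, and they pass through sums, tensor
  products and duals by explicit formulas. Uniqueness enters through two facts: an endomorphism of
  an indecomposable module is nilpotent or invertible, and k^l is not a retract of k^m for l > m.
  The composite k \<rightarrow> W \<rightarrow> k vanishes because W is a retract of a sum of
  modules k[G/Q] \<otimes> N, whose blocks are permuted transitively: on each of these the composite
  is [G:Q] times the contribution of a single block. A copy of k split off from
  \<open>M \<otimes> N\<^sup>*\<close> amounts to homomorphisms f : N \<rightarrow> M and g : M
  \<rightarrow> N with tr(g f) = 1. Nilpotent matrices have trace 0, so g f is invertible if N is
  indecomposable, and N becomes a retract of M. Algebraic closure enters where k is shown to have
  multiplicity one in End(C): it supplies eigenvalues.\<close>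

lemma index_mult_mat_sum:
  assumes "i < dim_row A" "j < dim_col B" "dim_col A = dim_row B"
  shows "(A * B) $$ (i, j) = (\<Sum>k<dim_row B. A $$ (i, k) * B $$ (k, j))"
  using assms by (auto simp: scalar_prod_def lessThan_atLeast0 intro!: sum.cong)

lemma mult_assoc_dim:
  fixes A B C :: "'a::semiring_0 mat"
  assumes "dim_col A = dim_row B" "dim_col B = dim_row C"
  shows "A * B * C = A * (B * C)"
  by (rule assoc_mult_mat[of A "dim_row A" "dim_col A" B "dim_col B" C "dim_col C"])
    (use assms in \<open>auto intro: carrier_matI\<close>)

lemma one_mult_dim: "dim_row A = n \<Longrightarrow> 1\<^sub>m n * (A :: 'a::semiring_1 mat) = A"
  by (metis carrier_matI left_mult_one_mat)

lemma mult_one_dim: "dim_col A = n \<Longrightarrow> (A :: 'a::semiring_1 mat) * 1\<^sub>m n = A"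
  by (metis carrier_matI right_mult_one_mat)

lemma mult_add_dim:
  fixes A B C :: "'a::semiring_0 mat"
  assumes "dim_col A = dim_row B" "dim_row B = dim_row C" "dim_col B = dim_col C"
  shows "A * (B + C) = A * B + A * C"
  by (rule mult_add_distrib_mat[of A "dim_row A" "dim_col A" B "dim_col B" C])
    (use assms in \<open>auto intro: carrier_matI\<close>)

lemma add_mult_dim:
  fixes A B C :: "'a::semiring_0 mat"
  assumes "dim_col A = dim_row C" "dim_row A = dim_row B" "dim_col A = dim_col B"
  shows "(A + B) * C = A * C + B * C"
  by (rule add_mult_distrib_mat[of A "dim_row A" "dim_col A" B C "dim_col C"])
    (use assms in \<open>auto intro: carrier_matI\<close>)

lemma transpose_mult_dim:
  fixes A B :: "'a::comm_semiring_0 mat"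
  assumes "dim_col A = dim_row B"
  shows "transpose_mat (A * B) = transpose_mat B * transpose_mat A"
  by (rule transpose_mult[of A "dim_row A" "dim_col A" B "dim_col B"])
    (use assms in \<open>auto intro: carrier_matI\<close>)

lemma left_inverse_mult_dim:
  fixes A B C :: "'a::semiring_1 mat"
  assumes "A * B = 1\<^sub>m n" "dim_col A = dim_row B" "dim_col B = dim_row C" "dim_row C = n"
  shows "A * (B * C) = C"
  using mult_assoc_dim[of A B C] assms by (simp add: one_mult_dim)

lemma bex2I: "x \<in> A \<Longrightarrow> y \<in> B \<Longrightarrow> P x y \<Longrightarrow> \<exists>x\<in>A. \<exists>y\<in>B. P x y"
  by blast

text \<open>Projecting along a kernel vector \<open>v\<close> onto the hyperplane where one of its
  nonzero coordinates vanishes does not change \<open>s\<close>, and this projection factors through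
  dimension \<open>r - 1\<close>. It serves to show that factorizations of least inner dimension
  have an invertible middle term.\<close>

lemma singular_mat_factor:
  fixes s :: "'a::field mat"
  assumes s: "s \<in> carrier_mat r r" and sing: "\<not> (\<exists>t\<in>carrier_mat r r. s * t = 1\<^sub>m r)"
  shows "r > 0 \<and> (\<exists>u\<in>carrier_mat r (r - 1). \<exists>w\<in>carrier_mat (r - 1) r. s * (u * w) = s)"
proof -
  have "det s = 0"
    using sing det_non_zero_imp_unit[OF s] s by (fastforce simp: Units_def ring_mat_def)
  then obtain v where v: "v \<in> carrier_vec r" "v \<noteq> 0\<^sub>v r" "s *\<^sub>v v = 0\<^sub>v r"
    using det_0_iff_vec_prod_zero_field[OF s] by blast
  then obtain k where k: "k < r" "v $ k \<noteq> 0"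
    by (metis carrier_vecD eq_vecI index_zero_vec(1) index_zero_vec(2))
  define sk where "sk j = (if j < k then j else Suc j)" for j
  have sk: "sk j < r" "sk j \<noteq> k" if "j < r - 1" for j
    using that k by (auto simp: sk_def)
  have ex_sk: "\<exists>!j. j < r - 1 \<and> i = sk j" if "i < r" "i \<noteq> k" for i
    using that k by (intro ex1I[of _ "if i < k then i else i - 1"]) (auto simp: sk_def split: if_splits)
  \<comment> \<open>\<open>c\<close> subtracts from a vector the multiple of \<open>v\<close> that
    kills coordinate \<open>k\<close>, so row \<open>k\<close> of \<open>c\<close> is zero;
    \<open>w\<close> drops this row and \<open>u\<close> puts it back.\<close>
  define c where "c = mat r r (\<lambda>(i, j). (if i = j then 1 else 0) - (if j = k then v $ i / v $ k else 0))"
  define u :: "'a mat" where "u = mat r (r - 1) (\<lambda>(i, j). if i = sk j then 1 else 0)"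
  define w where "w = mat (r - 1) r (\<lambda>(i, j). c $$ (sk i, j))"
  have "u * w = c"
  proof (rule eq_matI)
    fix i j assume ij: "i < dim_row c" "j < dim_col c"
    then have l: "i < r" "j < r" by (auto simp: c_def)
    have "(u * w) $$ (i, j) = (\<Sum>l<r - 1. (if i = sk l then 1 else 0) * c $$ (sk l, j))"
      using l by (subst index_mult_mat_sum) (auto simp: u_def w_def intro!: sum.cong)
    also have "\<dots> = (\<Sum>l<r - 1. if i = sk l then c $$ (i, j) else 0)"
      by (intro sum.cong) auto
    also have "\<dots> = c $$ (i, j)"
    proof (cases "i = k")
      case True
      then have "(\<Sum>l<r - 1. if i = sk l then c $$ (i, j) else 0) = 0"
        using sk by (intro sum.neutral) auto
      then show ?thesis using True l k by (auto simp: c_def)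
    next
      case False
      then obtain m where m: "m < r - 1" "i = sk m" "\<And>l. l < r - 1 \<Longrightarrow> i = sk l \<Longrightarrow> l = m"
        using ex_sk[OF l(1) False] by blast
      have "(\<Sum>l<r - 1. if i = sk l then c $$ (i, j) else 0) = (\<Sum>l<r - 1. if l = m then c $$ (i, j) else 0)"
        using m by (intro sum.cong) auto
      then show ?thesis using m by simp
    qed
    finally show "(u * w) $$ (i, j) = c $$ (i, j)" .
  qed (auto simp: u_def w_def c_def)
  moreover have "s * c = s"
  proof (rule eq_matI)
    fix i j assume ij: "i < dim_row s" "j < dim_col s"
    then have l: "i < r" "j < r" using s by auto
    have "(\<Sum>l<r. s $$ (i, l) * v $ l) = (s *\<^sub>v v) $ i"
      using l s v(1) by (simp add: scalar_prod_def lessThan_atLeast0 row_def del: v(3))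
    then have 0: "(\<Sum>l<r. s $$ (i, l) * v $ l) = 0" using v l by simp
    have "(s * c) $$ (i, j) = (\<Sum>l<r. s $$ (i, l) * c $$ (l, j))"
      using l s by (subst index_mult_mat_sum) (auto simp: c_def)
    also have "\<dots> = (\<Sum>l<r. (if l = j then s $$ (i, l) else 0) - (if j = k then s $$ (i, l) * v $ l / v $ k else 0))"
      using l by (intro sum.cong) (auto simp: c_def algebra_simps)
    also have "\<dots> = s $$ (i, j) - (if j = k then (\<Sum>l<r. s $$ (i, l) * v $ l) / v $ k else 0)"
      using l by (auto simp: sum_subtractf sum_divide_distrib)
    finally show "(s * c) $$ (i, j) = s $$ (i, j)" using 0 by simp
  qed (use s in \<open>auto simp: c_def\<close>)
  ultimately have "s * (u * w) = s" by simp
  then have "\<exists>u\<in>carrier_mat r (r - 1). \<exists>w\<in>carrier_mat (r - 1) r. s * (u * w) = s"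
    by (rule bex2I[rotated 2]) (auto simp: u_def w_def)
  then show ?thesis using k(1) by linarith
qed

text \<open>If \<open>m < n\<close>, zero columns in \<open>A\<close> and zero rows in
  \<open>B\<close> give square matrices with \<open>A' * B' = 1\<close>, hence
  \<open>B' * A' = 1\<close>, although column \<open>m\<close> of \<open>A'\<close> is zero.\<close>

lemma right_inverse_dim_le:
  fixes A B :: "'a::field mat"
  assumes A: "A \<in> carrier_mat n m" and B: "B \<in> carrier_mat m n" and AB: "A * B = 1\<^sub>m n"
  shows "n \<le> m"
proof (rule ccontr)
  assume "\<not> n \<le> m" then have lt: "m < n" by simp
  define A' where "A' = mat n n (\<lambda>(i, j). if j < m then A $$ (i, j) else 0)"
  define B' where "B' = mat n n (\<lambda>(i, j). if i < m then B $$ (i, j) else 0)"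
  have c: "A' \<in> carrier_mat n n" "B' \<in> carrier_mat n n" by (auto simp: A'_def B'_def)
  have "A' * B' = A * B"
  proof (rule eq_matI)
    fix i j assume "i < dim_row (A * B)" "j < dim_col (A * B)"
    then have l: "i < n" "j < n" using A B by auto
    have "(A' * B') $$ (i, j) = (\<Sum>k<n. A' $$ (i, k) * B' $$ (k, j))"
      using l by (subst index_mult_mat_sum) (auto simp: A'_def B'_def)
    also have "\<dots> = (\<Sum>k<m. A $$ (i, k) * B $$ (k, j))"
      using l lt by (intro sum.mono_neutral_cong_right) (auto simp: A'_def B'_def)
    also have "\<dots> = (A * B) $$ (i, j)"
      using l A B by (subst index_mult_mat_sum) auto
    finally show "(A' * B') $$ (i, j) = (A * B) $$ (i, j)" .
  qed (use A B in \<open>auto simp: A'_def B'_def\<close>)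
  then have "B' * A' = 1\<^sub>m n"
    using AB mat_mult_left_right_inverse[OF c] by simp
  then have "(B' * A') $$ (m, m) = 1" using lt by simp
  moreover have "(B' * A') $$ (m, m) = (\<Sum>k<n. B' $$ (m, k) * A' $$ (k, m))"
    using lt by (subst index_mult_mat_sum) (auto simp: A'_def B'_def)
  moreover have "\<dots> = 0" using lt by (intro sum.neutral) (auto simp: A'_def)
  ultimately show False by simp
qed

text \<open>In a factorization \<open>e = a * b\<close> of least inner dimension,
  \<open>s = b * a\<close> is invertible, as a singular \<open>s\<close> would allow a shorter one.
  Idempotence then gives \<open>s * s * s = s * s\<close>, so \<open>s\<close> is the
  identity.\<close>

lemma idempotent_mat_split:
  fixes e :: "'a::field mat"
  assumes e: "e \<in> carrier_mat n n" and ee: "e * e = e"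
  obtains r a b where "a \<in> carrier_mat n r" "b \<in> carrier_mat r n" "e = a * b" "b * a = 1\<^sub>m r"
proof -
  define P where "P r \<longleftrightarrow> (\<exists>a\<in>carrier_mat n r. \<exists>b\<in>carrier_mat r n. e = a * b)" for r
  have "P n" unfolding P_def by (rule bex2I[where x = e and y = "1\<^sub>m n"]) (use e in auto)
  define r where "r = (LEAST r. P r)"
  have "P r" unfolding r_def using \<open>P n\<close> by (rule LeastI)
  then obtain a b where a: "a \<in> carrier_mat n r" and b: "b \<in> carrier_mat r n" and eab: "e = a * b"
    by (auto simp: P_def)
  have d: "dim_row a = n" "dim_col a = r" "dim_row b = r" "dim_col b = n" using a b by auto
  define s where "s = b * a"
  have s: "s \<in> carrier_mat r r" using a b by (simp add: s_def)
  have asb: "a * (s * b) = a * b"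
    using ee d unfolding eab s_def by (simp add: mult_assoc_dim)
  have "\<exists>t\<in>carrier_mat r r. s * t = 1\<^sub>m r"
  proof (rule ccontr)
    assume "\<not> ?thesis"
    from singular_mat_factor[OF s this] obtain u w where r: "r > 0"
      and u: "u \<in> carrier_mat r (r - 1)" and w: "w \<in> carrier_mat (r - 1) r" and suw: "s * (u * w) = s"
      by auto
    \<comment> \<open>Since \<open>a * s * b = a * b = e\<close>, the factor \<open>u * w\<close>
      may be inserted after \<open>s\<close>, which lowers the inner dimension.\<close>
    have "e = a * s * u * (w * b)"
    proof -
      have dd: "dim_row s = r" "dim_col s = r" "dim_row u = r" "dim_col u = r - 1"
        "dim_row w = r - 1" "dim_col w = r"
        using s u w by auto
      have "a * s * u * (w * b) = a * (s * (u * w) * b)" using d dd by (simp add: mult_assoc_dim)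
      then show ?thesis unfolding suw using asb by (simp add: eab)
    qed
    then have "P (r - 1)" unfolding P_def
      by (rule bex2I[rotated 2]) (use a s u w b in auto)
    then show False using not_less_Least[of "r - 1" P] r by (simp add: r_def)
  qed
  then obtain t where t: "t \<in> carrier_mat r r" "s * t = 1\<^sub>m r" by blast
  then have ts: "t * s = 1\<^sub>m r" using mat_mult_left_right_inverse[OF s] by simp
  have ds: "dim_row s = r" "dim_col s = r" "dim_row t = r" "dim_col t = r" using s t by auto
  have "b * (a * (s * b)) * a = b * (a * b) * a" by (simp add: asb)
  then have "s * (s * s) = s * s"
    using d unfolding s_def by (simp add: mult_assoc_dim)
  then have "t * (s * (s * s)) = t * (s * s)" by simp
  then have "s * s = s"
    using ds ts by (simp add: left_inverse_mult_dim[OF ts])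
  then have "t * (s * s) = t * s" by simp
  then have "s = 1\<^sub>m r"
    using ds ts by (simp add: left_inverse_mult_dim[OF ts])
  then show ?thesis using that[OF a b eab] unfolding s_def by simp
qed

section \<open>Trace, and its vanishing on nilpotent matrices\<close>

definition mat_tr :: "'a::semiring_0 mat \<Rightarrow> 'a" where
  "mat_tr A = (\<Sum>i<dim_row A. A $$ (i, i))"

lemma mat_tr_mult_sum:
  assumes "A \<in> carrier_mat m n" "B \<in> carrier_mat n m"
  shows "mat_tr (A * B) = (\<Sum>i<m. \<Sum>j<n. A $$ (i, j) * B $$ (j, i))"
  using assms by (auto simp: mat_tr_def index_mult_mat_sum simp del: index_mult_mat(1) intro!: sum.cong)

lemma mat_tr_comm:
  fixes A B :: "'a::comm_semiring_0 mat"
  assumes "A \<in> carrier_mat m n" "B \<in> carrier_mat n m"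
  shows "mat_tr (A * B) = mat_tr (B * A)"
  unfolding mat_tr_mult_sum[OF assms] mat_tr_mult_sum[OF assms(2,1)]
  by (subst sum.swap) (simp add: mult.commute)

lemma pow_mat_comm:
  assumes "A \<in> carrier_mat n n"
  shows "A * A ^\<^sub>m k = A ^\<^sub>m k * (A :: 'a::semiring_1 mat)"
proof (induction k)
  case (Suc k)
  have "A * A ^\<^sub>m Suc k = (A * A ^\<^sub>m k) * A"
    using assms by (simp add: mult_assoc_dim pow_mat_dim_square)
  then show ?case using Suc by simp
qed (use assms in simp)

text \<open>A nilpotent \<open>N\<close> of positive size is singular, so
  \<open>N = N * (u * w)\<close> with inner dimension one less. Then \<open>w * N * u\<close> is a
  smaller nilpotent matrix with the same trace, which gives an induction without
  eigenvalues.\<close>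

lemma nilpotent_mat_tr:
  fixes N :: "'a::field mat"
  assumes "N \<in> carrier_mat n n" "N ^\<^sub>m m = 0\<^sub>m n n"
  shows "mat_tr N = 0"
  using assms
proof (induction n arbitrary: N)
  case 0
  then show ?case by (simp add: mat_tr_def)
next
  case (Suc n)
  let ?n = "Suc n"
  have N: "N \<in> carrier_mat ?n ?n" using Suc by simp
  have "\<not> (\<exists>t\<in>carrier_mat ?n ?n. N * t = 1\<^sub>m ?n)"
  proof
    assume "\<exists>t\<in>carrier_mat ?n ?n. N * t = 1\<^sub>m ?n"
    then obtain t where t: "t \<in> carrier_mat ?n ?n" "N * t = 1\<^sub>m ?n" by blast
    have "N ^\<^sub>m k * t ^\<^sub>m k = 1\<^sub>m ?n" for k
    proof (induction k)
      case (Suc k)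
      have "N ^\<^sub>m Suc k * t ^\<^sub>m Suc k = N ^\<^sub>m k * N * (t * t ^\<^sub>m k)"
        using pow_mat_comm[OF t(1)] by simp
      also have "\<dots> = N ^\<^sub>m k * (N * t * t ^\<^sub>m k)"
        using N t(1) by (simp add: mult_assoc_dim pow_mat_dim_square[of _ ?n])
      finally have "N ^\<^sub>m Suc k * t ^\<^sub>m Suc k = N ^\<^sub>m k * (N * t * t ^\<^sub>m k)" .
      then show ?case using Suc t by (simp add: pow_carrier_mat one_mult_dim)
    qed (use N t in simp)
    from this[of m] have "0\<^sub>m ?n ?n * t ^\<^sub>m m = 1\<^sub>m ?n" using Suc.prems by simp
    then have "(0\<^sub>m ?n ?n :: 'a mat) = 1\<^sub>m ?n" using t by (metis left_mult_zero_mat pow_carrier_mat)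
    then have "(0\<^sub>m ?n ?n :: 'a mat) $$ (0,0) = 1\<^sub>m ?n $$ (0,0)" by simp
    then show False by simp
  qed
  from singular_mat_factor[OF N this] obtain u w where
    u: "u \<in> carrier_mat ?n n" and w: "w \<in> carrier_mat n ?n" and Nuw: "N * (u * w) = N" by auto
  have d: "dim_row u = ?n" "dim_col u = n" "dim_row w = n" "dim_col w = ?n" "dim_row N = ?n" "dim_col N = ?n"
    using u w N by auto
  \<comment> \<open>Every positive power of \<open>N\<close> absorbs \<open>u * w\<close> on the
    right, so the product \<open>u * w\<close> between consecutive copies of \<open>N\<close>
    disappears.\<close>
  have pw: "(w * N * u) ^\<^sub>m Suc k = w * N ^\<^sub>m Suc k * u" for k
  proof (induction k)
    case 0
    then show ?case using d by simp
  next
    case (Suc k)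
    define Q where "Q = N ^\<^sub>m Suc k"
    have Q: "dim_row Q = ?n" "dim_col Q = ?n"
      using d unfolding Q_def by (auto simp: pow_mat_dim_square)
    have QN: "N * Q = Q * N"
      using N unfolding Q_def by (rule pow_mat_comm)
    have "Q = N ^\<^sub>m k * N" by (simp add: Q_def)
    moreover have "dim_row (N ^\<^sub>m k) = ?n" "dim_col (N ^\<^sub>m k) = ?n"
      using N by (auto simp: pow_mat_dim_square)
    ultimately have "Q * (u * w) = N ^\<^sub>m k * (N * (u * w))"
      using d by (simp add: mult_assoc_dim)
    then have Quw: "Q * (u * w) = Q" unfolding Nuw by (simp add: Q_def)
    have "(w * N * u) ^\<^sub>m Suc (Suc k) = (w * Q * u) * (w * N * u)"
      using Suc unfolding Q_def by simp
    also have "\<dots> = w * (Q * (u * w) * (N * u))"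
      using d Q by (simp add: mult_assoc_dim)
    also have "\<dots> = w * (Q * N) * u"
      using d Q unfolding Quw by (simp add: mult_assoc_dim)
    finally show ?case by (simp add: Q_def)
  qed
  have "N ^\<^sub>m Suc m = 0\<^sub>m ?n ?n" using Suc.prems N by simp
  then have "(w * N * u) ^\<^sub>m Suc m = 0\<^sub>m n n" using pw[of m] u w by simp
  moreover have c: "w * N * u \<in> carrier_mat n n" using u w N by simp
  ultimately have "mat_tr (w * N * u) = 0"
  proof -
    have "(w * N * u) ^\<^sub>m m = 0\<^sub>m n n"
    \<comment> \<open>\<open>pw\<close> concerns positive exponents only; for \<open>m = 0\<close>
      nilpotency would say that the identity matrix is zero.\<close>
    proof (cases m)
      case 0
      then have "(0\<^sub>m ?n ?n :: 'a mat) $$ (0,0) = 1\<^sub>m ?n $$ (0,0)" using Suc.prems N by simp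
      then show ?thesis by simp
    next
      case (Suc k)
      then show ?thesis using pw[of k] Suc.prems u w by simp
    qed
    then show ?thesis using Suc.IH[OF c] by blast
  qed
  moreover have "mat_tr (N * u * w) = mat_tr (w * (N * u))"
    using N u w by (intro mat_tr_comm) auto
  ultimately show ?case using Nuw d by (simp add: mult_assoc_dim)
qed

text \<open>The linear map induced by \<open>f\<close> on basis vectors, \<open>e_j\<close> going to
  \<open>e_(f j)\<close>. Permutation actions, inclusions of summands and the flip of tensor factors
  are of this kind, so their products reduce to composition of index maps.\<close>

definition sel_mat :: "nat \<Rightarrow> nat \<Rightarrow> (nat \<Rightarrow> nat) \<Rightarrow> 'a::semiring_1 mat" where
  "sel_mat m n f = mat m n (\<lambda>(i, j). if i = f j then 1 else 0)"

lemma sel_mat_dim [simp]: "dim_row (sel_mat m n f) = m" "dim_col (sel_mat m n f) = n"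
  by (auto simp: sel_mat_def)

lemma sel_mat_index [simp]:
  "i < m \<Longrightarrow> j < n \<Longrightarrow> sel_mat m n f $$ (i, j) = (if i = f j then 1 else 0)"
  by (auto simp: sel_mat_def)

lemma sum_delta_times:
  fixes g :: "nat \<Rightarrow> 'a::semiring_1"
  assumes "a < n"
  shows "(\<Sum>k<n. g k * (if k = a then 1 else 0)) = g a"
    "(\<Sum>k<n. (if a = k then 1 else 0) * g k) = g a"
    "(\<Sum>k<n. (if k = a then 1 else 0) * g k) = g a"
  using assms by (simp_all add: if_distrib[of "\<lambda>x. _ * x"] if_distrib[of "\<lambda>x. x * _"] cong: if_cong)

lemma mult_sel_index:
  assumes "i < dim_row A" "j < n" "f j < m" "dim_col A = m"
  shows "(A * sel_mat m n f) $$ (i, j) = A $$ (i, f j)"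
  using assms by (subst index_mult_mat_sum) (auto simp: sum_delta_times)

lemma sel_mult_index:
  assumes "i < m" "j < dim_col A" "dim_row A = n" "inj_on f {..<n}"
  shows "(sel_mat m n f * A) $$ (i, j) = (if \<exists>l<n. i = f l then A $$ (inv_into {..<n} f i, j) else 0)"
proof (cases "\<exists>l<n. i = f l")
  case True
  then obtain l where l: "l < n" "i = f l" by blast
  have "(sel_mat m n f * A) $$ (i, j) = (\<Sum>k<n. (if l = k then 1 else 0) * A $$ (k, j))"
    using assms l by (subst index_mult_mat_sum) (auto intro!: sum.cong dest: inj_onD)
  moreover have "inv_into {..<n} f i = l" using assms l by (simp add: inv_into_f_f)
  ultimately show ?thesis using True l by (simp add: sum_delta_times)
next
  case False
  then show ?thesis using assms
    by (subst index_mult_mat_sum) (auto intro!: sum.neutral)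
qed

lemma transpose_sel_mult_index:
  fixes A :: "'a::comm_semiring_1 mat"
  assumes "i < n" "j < dim_col A" "f i < m" "dim_row A = m"
  shows "(transpose_mat (sel_mat m n f) * A) $$ (i, j) = A $$ (f i, j)"
  using assms by (subst index_mult_mat_sum) (auto simp: sum_delta_times)

lemma mult_transpose_sel_index:
  fixes A :: "'a::comm_semiring_1 mat"
  assumes "j < m" "i < dim_row A" "dim_col A = n" "inj_on f {..<n}"
  shows "(A * transpose_mat (sel_mat m n f)) $$ (i, j) = (if \<exists>l<n. j = f l then A $$ (i, inv_into {..<n} f j) else 0)"
proof -
  have "A * transpose_mat (sel_mat m n f) = transpose_mat (sel_mat m n f * transpose_mat A)"
    using assms by (simp add: transpose_mult_dim)
  also have "\<dots> $$ (i, j) = (sel_mat m n f * transpose_mat A) $$ (j, i)"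
    using assms by simp
  also have "\<dots> = (if \<exists>l<n. j = f l then transpose_mat A $$ (inv_into {..<n} f j, i) else 0)"
    using assms by (subst sel_mult_index) auto
  also have "\<dots> = (if \<exists>l<n. j = f l then A $$ (i, inv_into {..<n} f j) else 0)"
    using assms by (auto simp: inv_into_f_f)
  finally show ?thesis .
qed

lemma sel_mult_sel:
  assumes "\<And>j. j < l \<Longrightarrow> g j < n"
  shows "sel_mat m n f * sel_mat n l g = sel_mat m l (\<lambda>j. f (g j))"
  using assms by (intro eq_matI) (auto simp: mult_sel_index simp del: index_mult_mat(1))

lemma sel_mat_id: "(\<And>j. j < n \<Longrightarrow> f j = j) \<Longrightarrow> sel_mat n n f = 1\<^sub>m n"
  by (intro eq_matI) auto

lemma transpose_sel_mult_self:
  assumes "inj_on f {..<n}" "\<And>j. j < n \<Longrightarrow> f j < m"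
  shows "transpose_mat (sel_mat m n f) * sel_mat m n f = (1\<^sub>m n :: 'a::comm_semiring_1 mat)"
  using assms by (intro eq_matI)
    (auto simp: transpose_sel_mult_index simp del: index_mult_mat(1) dest: inj_onD)


section \<open>Kronecker products\<close>

lemma div_mod_lt:
  assumes "r < m * (n :: nat)"
  shows "r div n < m" "r mod n < n"
  using assms by (auto simp: less_mult_imp_div_less intro!: mod_less_divisor gr0I)

lemma mult_add_lt: "i < m \<Longrightarrow> j < n \<Longrightarrow> i * n + j < m * (n :: nat)"
  using mult_le_mono1[of "Suc i" m n] by auto

lemma div_mod_eq_iff: "(a :: nat) = b \<longleftrightarrow> a div n = b div n \<and> a mod n = b mod n"
  by (metis div_mult_mod_eq)

definition kron :: "'a::times mat \<Rightarrow> 'a mat \<Rightarrow> 'a mat" where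
  "kron A B = mat (dim_row A * dim_row B) (dim_col A * dim_col B)
     (\<lambda>(r, c). A $$ (r div dim_row B, c div dim_col B) * B $$ (r mod dim_row B, c mod dim_col B))"

lemma kron_dim [simp]:
  "dim_row (kron A B) = dim_row A * dim_row B" "dim_col (kron A B) = dim_col A * dim_col B"
  by (auto simp: kron_def)

lemma kron_index:
  "i < dim_row A * dim_row B \<Longrightarrow> j < dim_col A * dim_col B \<Longrightarrow> kron A B $$ (i, j) =
     A $$ (i div dim_row B, j div dim_col B) * B $$ (i mod dim_row B, j mod dim_col B)"
  by (simp add: kron_def)

lemma kron_mult:
  fixes A B C D :: "'a::comm_semiring_1 mat"
  assumes "dim_col A = dim_row C" "dim_col B = dim_row D"
  shows "kron A B * kron C D = kron (A * C) (B * D)"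
proof (rule eq_matI)
  fix i j assume "i < dim_row (kron (A * C) (B * D))" "j < dim_col (kron (A * C) (B * D))"
  then have l: "i < dim_row A * dim_row B" "j < dim_col C * dim_col D" by auto
  let ?i = "i div dim_row B" and ?i' = "i mod dim_row B" and ?j = "j div dim_col D" and ?j' = "j mod dim_col D"
  have "(kron A B * kron C D) $$ (i, j) = (\<Sum>k<dim_row C * dim_row D.
     (A $$ (?i, k div dim_row D) * B $$ (?i', k mod dim_row D)) * (C $$ (k div dim_row D, ?j) * D $$ (k mod dim_row D, ?j')))"
    using l assms by (subst index_mult_mat_sum) (auto simp: kron_index intro!: sum.cong)
  also have "\<dots> = (\<Sum>k<dim_row C. \<Sum>k'<dim_row D. (A $$ (?i, k) * B $$ (?i', k')) * (C $$ (k, ?j) * D $$ (k', ?j')))"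
    by (rule sum_div_mod)
  also have "\<dots> = (\<Sum>k<dim_row C. A $$ (?i, k) * C $$ (k, ?j)) * (\<Sum>k'<dim_row D. B $$ (?i', k') * D $$ (k', ?j'))"
    by (simp add: sum_product mult_ac)
  also have "\<dots> = (A * C) $$ (?i, ?j) * (B * D) $$ (?i', ?j')"
    using l assms by (subst (1 2) index_mult_mat_sum) (auto simp: div_mod_lt)
  also have "\<dots> = kron (A * C) (B * D) $$ (i, j)"
    using l by (simp add: kron_index)
  finally show "(kron A B * kron C D) $$ (i, j) = kron (A * C) (B * D) $$ (i, j)" .
qed auto

lemma kron_one: "kron (1\<^sub>m m) (1\<^sub>m n) = (1\<^sub>m (m * n) :: 'a::semiring_1 mat)"
proof (rule eq_matI)
  fix i j assume l: "i < dim_row (1\<^sub>m (m * n) :: 'a mat)" "j < dim_col (1\<^sub>m (m * n) :: 'a mat)"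
  then show "kron (1\<^sub>m m) (1\<^sub>m n) $$ (i, j) = (1\<^sub>m (m * n) :: 'a mat) $$ (i, j)"
    using div_mod_eq_iff[of i j n] by (auto simp: kron_index div_mod_lt)
qed auto

lemma kron_add_left:
  fixes A B C :: "'a::comm_semiring_1 mat"
  assumes "dim_row A = dim_row B" "dim_col A = dim_col B"
  shows "kron (A + B) C = kron A C + kron B C"
  using assms by (intro eq_matI) (auto simp: kron_index div_mod_lt distrib_left distrib_right)

lemma kron_add_right:
  fixes A B C :: "'a::comm_semiring_1 mat"
  assumes "dim_row A = dim_row B" "dim_col A = dim_col B"
  shows "kron C (A + B) = kron C A + kron C B"
  using assms by (intro eq_matI) (auto simp: kron_index div_mod_lt distrib_left distrib_right)

lemma kron_transpose: "transpose_mat (kron A B) = kron (transpose_mat A) (transpose_mat B)"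
  by (intro eq_matI) (auto simp: kron_index div_mod_lt)

lemma kron_one_left: "kron (1\<^sub>m 1) A = (A :: 'a::comm_semiring_1 mat)"
  by (intro eq_matI) (auto simp: kron_index)

lemma kron_one_right: "kron A (1\<^sub>m 1) = (A :: 'a::comm_semiring_1 mat)"
  by (intro eq_matI) (auto simp: kron_index)

text \<open>The flip of tensor factors: the basis vector with number \<open>c = i * n + j\<close>
  goes to the one with number \<open>j * m + i\<close>.\<close>

definition swap_mat :: "nat \<Rightarrow> nat \<Rightarrow> 'a::semiring_1 mat" where
  "swap_mat m n = sel_mat (n * m) (m * n) (\<lambda>c. (c mod n) * m + c div n)"

lemma swap_index:
  assumes "c < m * (n :: nat)"
  shows "(c mod n) * m + c div n < n * m" "((c mod n) * m + c div n) div m = c mod n"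
    "((c mod n) * m + c div n) mod m = c div n"
  using div_mod_lt[OF assms] by (auto intro: mult_add_lt)

lemma swap_mat_dim [simp]: "dim_row (swap_mat m n) = n * m" "dim_col (swap_mat m n) = m * n"
  by (auto simp: swap_mat_def)

lemma swap_mat_swap: "swap_mat n m * swap_mat m n = 1\<^sub>m (m * n)"
proof -
  have "(c mod n * m + c div n) mod m * n + (c mod n * m + c div n) div m = c" if "c < m * n" for c
    unfolding swap_index[OF that] by simp
  then show ?thesis unfolding swap_mat_def
    using swap_index(1)[of _ m n]
    by (subst sel_mult_sel) (auto simp: mult.commute[of n m] simp del: mod_mult_self3 div_mult_self4 intro!: sel_mat_id)
qed

lemma swap_mat_kron:
  fixes A B :: "'a::comm_semiring_1 mat"
  shows "swap_mat (dim_row A) (dim_row B) * kron A B = kron B A * swap_mat (dim_col A) (dim_col B)"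
proof -
  let ?m = "dim_row A" and ?n = "dim_row B" and ?m' = "dim_col A" and ?n' = "dim_col B"
  have "swap_mat ?n ?m * (kron B A * swap_mat ?m' ?n') = kron A B"
  proof (rule eq_matI)
    fix i j assume "i < dim_row (kron A B)" "j < dim_col (kron A B)"
    then have l: "i < ?m * ?n" "j < ?m' * ?n'" by auto
    let ?s = "\<lambda>c. (c mod ?n) * ?m + c div ?n"
    \<comment> \<open>The inverse flip is the transposed flip, and multiplying on the left by a
      transposed selection matrix reads off rows.\<close>
    have tr: "swap_mat ?n ?m = transpose_mat (swap_mat ?m ?n :: 'a mat)"
    proof (rule eq_matI)
      fix a b assume "a < dim_row (transpose_mat (swap_mat ?m ?n :: 'a mat))" "b < dim_col (transpose_mat (swap_mat ?m ?n :: 'a mat))"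
      then have ab: "a < ?m * ?n" "b < ?n * ?m" by auto
      have "a = (b mod ?m) * ?n + b div ?m \<longleftrightarrow> b = (a mod ?n) * ?m + a div ?n"
        using swap_index[OF ab(1)] swap_index[OF ab(2)] by (metis div_mult_mod_eq)
      then show "swap_mat ?n ?m $$ (a, b) = transpose_mat (swap_mat ?m ?n :: 'a mat) $$ (a, b)"
        using ab by (simp add: swap_mat_def)
    qed auto
    have "(swap_mat ?n ?m * (kron B A * swap_mat ?m' ?n')) $$ (i, j) = (kron B A * swap_mat ?m' ?n') $$ (?s i, j)"
      unfolding tr unfolding swap_mat_def using l swap_index[OF l(1)]
      by (subst transpose_sel_mult_index) auto
    also have "\<dots> = kron B A $$ (?s i, (j mod ?n') * ?m' + j div ?n')"
      unfolding swap_mat_def using l swap_index[OF l(1)] swap_index[OF l(2)]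
      by (subst mult_sel_index) auto
    also have "\<dots> = kron A B $$ (i, j)"
      using l swap_index[OF l(1)] swap_index[OF l(2)] by (simp add: kron_index mult.commute)
    finally show "(swap_mat ?n ?m * (kron B A * swap_mat ?m' ?n')) $$ (i, j) = kron A B $$ (i, j)" .
  qed auto
  then have "swap_mat ?m ?n * kron A B = swap_mat ?m ?n * (swap_mat ?n ?m * (kron B A * swap_mat ?m' ?n'))"
    by simp
  also have "\<dots> = kron B A * swap_mat ?m' ?n'"
    by (subst left_inverse_mult_dim[OF swap_mat_swap]) auto
  finally show ?thesis .
qed

section \<open>Inclusions and projections of a direct sum\<close>

definition in1 :: "nat \<Rightarrow> nat \<Rightarrow> 'a::semiring_1 mat" where "in1 m n = sel_mat (m + n) m (\<lambda>j. j)"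
definition in2 :: "nat \<Rightarrow> nat \<Rightarrow> 'a::semiring_1 mat" where "in2 m n = sel_mat (m + n) n (\<lambda>j. m + j)"
definition pr1 :: "nat \<Rightarrow> nat \<Rightarrow> 'a::semiring_1 mat" where "pr1 m n = transpose_mat (in1 m n)"
definition pr2 :: "nat \<Rightarrow> nat \<Rightarrow> 'a::semiring_1 mat" where "pr2 m n = transpose_mat (in2 m n)"

lemma biprod_dim [simp]:
  "dim_row (in1 m n) = m + n" "dim_col (in1 m n) = m" "dim_row (in2 m n) = m + n" "dim_col (in2 m n) = n"
  "dim_row (pr1 m n) = m" "dim_col (pr1 m n) = m + n" "dim_row (pr2 m n) = n" "dim_col (pr2 m n) = m + n"
  by (auto simp: in1_def in2_def pr1_def pr2_def)

lemma biprod_mult [simp]: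
  "pr1 m n * in1 m n = (1\<^sub>m m :: 'a::comm_semiring_1 mat)"
  "pr2 m n * in2 m n = (1\<^sub>m n :: 'a::comm_semiring_1 mat)"
  "pr1 m n * in2 m n = (0\<^sub>m m n :: 'a::comm_semiring_1 mat)"
  "pr2 m n * in1 m n = (0\<^sub>m n m :: 'a::comm_semiring_1 mat)"
proof -
  show "pr1 m n * in1 m n = (1\<^sub>m m :: 'a mat)" "pr2 m n * in2 m n = (1\<^sub>m n :: 'a mat)"
    by (auto simp: in1_def in2_def pr1_def pr2_def inj_on_def intro!: transpose_sel_mult_self)
  show "pr1 m n * in2 m n = (0\<^sub>m m n :: 'a mat)" "pr2 m n * in1 m n = (0\<^sub>m n m :: 'a mat)"
    unfolding in1_def in2_def pr1_def pr2_def
    by (auto simp: transpose_sel_mult_index simp del: index_mult_mat(1) intro!: eq_matI)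
qed

lemma biprod_sum: "in1 m n * pr1 m n + in2 m n * pr2 m n = (1\<^sub>m (m + n) :: 'a::comm_semiring_1 mat)"
proof (rule eq_matI)
  fix i j assume "i < dim_row (1\<^sub>m (m + n) :: 'a mat)" "j < dim_col (1\<^sub>m (m + n) :: 'a mat)"
  then have l: "i < m + n" "j < m + n" by auto
  have 1: "(in1 m n * pr1 m n) $$ (i, j) = (if i = j \<and> i < m then 1 else (0 :: 'a))"
    unfolding pr1_def unfolding in1_def using l
    by (subst mult_transpose_sel_index) (auto simp: inj_on_def inv_into_f_f[of "\<lambda>j. j"])
  have "inv_into {..<n} ((+) m) j = j - m" if "\<not> j < m"
    using l that inv_into_f_f[of "(+) m" "{..<n}" "j - m"] by (auto simp: inj_on_def)
  moreover have "(\<exists>l<n. j = m + l) \<longleftrightarrow> \<not> j < m"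
    using l by (auto intro: exI[of _ "j - m"])
  ultimately have 2: "(in2 m n * pr2 m n) $$ (i, j) = (if i = j \<and> \<not> i < m then 1 else (0 :: 'a))"
    unfolding pr2_def unfolding in2_def using l
    by (subst mult_transpose_sel_index) (auto simp: inj_on_def)
  show "(in1 m n * pr1 m n + in2 m n * pr2 m n) $$ (i, j) = (1\<^sub>m (m + n) :: 'a mat) $$ (i, j)"
    using l 1 2 by simp
qed auto

lemma four_block_biprod:
  fixes A B :: "'a::comm_semiring_1 mat"
  assumes "A \<in> carrier_mat m m'" "B \<in> carrier_mat n n'"
  shows "four_block_mat A (0\<^sub>m m n') (0\<^sub>m n m') B * in1 m' n' = in1 m n * A"
    "four_block_mat A (0\<^sub>m m n') (0\<^sub>m n m') B * in2 m' n' = in2 m n * B"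
    "pr1 m n * four_block_mat A (0\<^sub>m m n') (0\<^sub>m n m') B = A * pr1 m' n'"
    "pr2 m n * four_block_mat A (0\<^sub>m m n') (0\<^sub>m n m') B = B * pr2 m' n'"
proof -
  have ii: "inv_into {..<m} (\<lambda>j. j) i = i" if "i < m" for i m :: nat
    using that inv_into_f_f[of "\<lambda>j. j" "{..<m}" i] by (auto simp: inj_on_def)
  have ii': "inv_into {..<n} ((+) m) j = j - m" if "\<not> j < m" "j < m + n" for j m n :: nat
    using that inv_into_f_f[of "(+) m" "{..<n}" "j - m"] by (auto simp: inj_on_def)
  have ex: "(\<exists>l<n. j = m + l) \<longleftrightarrow> \<not> j < m" if "j < m + n" for j m n :: nat
    using that by (auto intro: exI[of _ "j - m"])
  have 1: "four_block_mat A (0\<^sub>m m n') (0\<^sub>m n m') B * in1 m' n' = in1 m n * A"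
    if "A \<in> carrier_mat m m'" "B \<in> carrier_mat n n'" for A B :: "'a mat" and m n m' n'
    using that unfolding in1_def by (intro eq_matI)
      (auto simp: mult_sel_index sel_mult_index inj_on_def ii simp del: index_mult_mat(1))
  have 2: "four_block_mat A (0\<^sub>m m n') (0\<^sub>m n m') B * in2 m' n' = in2 m n * B"
    if "A \<in> carrier_mat m m'" "B \<in> carrier_mat n n'" for A B :: "'a mat" and m n m' n'
    using that unfolding in2_def by (intro eq_matI)
      (auto simp: mult_sel_index sel_mult_index inj_on_def ii' ex simp del: index_mult_mat(1))
  \<comment> \<open>Transposition turns the statement on projections into the one on inclusions for
    the transposed blocks.\<close>
  show "pr1 m n * four_block_mat A (0\<^sub>m m n') (0\<^sub>m n m') B = A * pr1 m' n'"
  proof -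
    have "transpose_mat (pr1 m n * four_block_mat A (0\<^sub>m m n') (0\<^sub>m n m') B) = transpose_mat (A * pr1 m' n')"
      using 1[of "transpose_mat A" m' m "transpose_mat B" n' n] assms
      by (simp add: transpose_mult_dim pr1_def transpose_four_block_mat[OF assms(1) zero_carrier_mat zero_carrier_mat assms(2)])
    then show ?thesis by (metis transpose_transpose)
  qed
  show "pr2 m n * four_block_mat A (0\<^sub>m m n') (0\<^sub>m n m') B = B * pr2 m' n'"
  proof -
    have "transpose_mat (pr2 m n * four_block_mat A (0\<^sub>m m n') (0\<^sub>m n m') B) = transpose_mat (B * pr2 m' n')"
      using 2[of "transpose_mat A" m' m "transpose_mat B" n' n] assms
      by (simp add: transpose_mult_dim pr2_def transpose_four_block_mat[OF assms(1) zero_carrier_mat zero_carrier_mat assms(2)])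
    then show ?thesis by (metis transpose_transpose)
  qed
  show "four_block_mat A (0\<^sub>m m n') (0\<^sub>m n m') B * in1 m' n' = in1 m n * A"
    "four_block_mat A (0\<^sub>m m n') (0\<^sub>m n m') B * in2 m' n' = in2 m n * B"
    using 1 2 assms by auto
qed

section \<open>Homomorphisms and retracts\<close>

definition mor ::
  "('g, 'b) monoid_scheme \<Rightarrow> ('g, 'k::field) rep \<Rightarrow> ('g, 'k) rep \<Rightarrow> 'k mat \<Rightarrow> bool" where
  "mor G M N F \<longleftrightarrow> F \<in> carrier_mat (deg N) (deg M) \<and> (\<forall>g\<in>carrier G. F * act M g = act N g * F)"

definition retract ::
  "('g, 'b) monoid_scheme \<Rightarrow> ('g, 'k::field) rep \<Rightarrow> ('g, 'k) rep \<Rightarrow> bool" where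
  "retract G M X \<longleftrightarrow> (\<exists>i q. mor G M X i \<and> mor G X M q \<and> q * i = 1\<^sub>m (deg M))"

definition dual_mod :: "('g, 'b) monoid_scheme \<Rightarrow> ('g, 'k::field) rep \<Rightarrow> ('g, 'k) rep" where
  "dual_mod G M = \<lparr>deg = deg M, act = (\<lambda>g. transpose_mat (act M (inv\<^bsub>G\<^esub> g)))\<rparr>"

text \<open>Records that agree as modules need not be equal, since \<open>act\<close> is arbitrary
  outside the group. This is equality as far as the group can see it.\<close>

definition rep_eq :: "('g, 'b) monoid_scheme \<Rightarrow> ('g, 'k::field) rep \<Rightarrow> ('g, 'k) rep \<Rightarrow> bool" where
  "rep_eq G M N \<longleftrightarrow> deg M = deg N \<and> (\<forall>g\<in>carrier G. act M g = act N g)"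

lemma add_zero_dim: "dim_row A = m \<Longrightarrow> dim_col A = n \<Longrightarrow> A + 0\<^sub>m m n = (A :: 'a::monoid_add mat)"
  by (intro eq_matI) auto

lemma zero_add_dim: "dim_row A = m \<Longrightarrow> dim_col A = n \<Longrightarrow> 0\<^sub>m m n + A = (A :: 'a::monoid_add mat)"
  by (intro eq_matI) auto

lemma biprod_cancel:
  fixes X :: "'a::comm_semiring_1 mat"
  shows "dim_row X = m \<Longrightarrow> pr1 m n * (in1 m n * X) = X"
    "dim_row X = n \<Longrightarrow> pr2 m n * (in2 m n * X) = X"
    "dim_row X = n \<Longrightarrow> pr1 m n * (in2 m n * X) = 0\<^sub>m m (dim_col X)"
    "dim_row X = m \<Longrightarrow> pr2 m n * (in1 m n * X) = 0\<^sub>m n (dim_col X)"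
  by (simp_all add: mult_assoc_dim[symmetric] one_mult_dim del: assoc_mult_mat)

lemma mult_zero_dim:
  fixes A :: "'a::semiring_0 mat"
  shows "dim_col A = m \<Longrightarrow> A * 0\<^sub>m m n = 0\<^sub>m (dim_row A) n"
    "dim_row A = n \<Longrightarrow> 0\<^sub>m m n * A = 0\<^sub>m m (dim_col A)"
  by (metis carrier_matI right_mult_zero_mat, metis carrier_matI left_mult_zero_mat)

lemmas mat_dim_simps = mult_assoc_dim mult_add_dim add_mult_dim one_mult_dim mult_one_dim
  add_zero_dim zero_add_dim mult_zero_dim biprod_cancel

lemma kG_dim:
  assumes "kG_module G M" "g \<in> carrier G"
  shows "dim_row (act M g) = deg M" "dim_col (act M g) = deg M"
  using assms by (auto simp: kG_module_def)

lemma morD: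
  assumes "mor G M N F"
  shows "F \<in> carrier_mat (deg N) (deg M)" "dim_row F = deg N" "dim_col F = deg M"
    "g \<in> carrier G \<Longrightarrow> F * act M g = act N g * F"
  using assms by (auto simp: mor_def)

lemma mor_comp:
  assumes "kG_module G M" "kG_module G N" "kG_module G L" "mor G M N F" "mor G N L H"
  shows "mor G M L (H * F)"
  unfolding mor_def
proof (intro conjI ballI)
  show "H * F \<in> carrier_mat (deg L) (deg M)" using assms by (auto simp: mor_def)
  fix g assume g: "g \<in> carrier G"
  note d = kG_dim[OF assms(1) g] kG_dim[OF assms(2) g] kG_dim[OF assms(3) g] morD(2,3)[OF assms(4)] morD(2,3)[OF assms(5)]
  have "H * F * act M g = H * act N g * F" using d morD(4)[OF assms(4) g] by (simp add: mult_assoc_dim)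
  then show "H * F * act M g = act L g * (H * F)" using d morD(4)[OF assms(5) g] by (simp add: mult_assoc_dim)
qed

lemma mor_one: "kG_module G M \<Longrightarrow> mor G M M (1\<^sub>m (deg M))"
  by (auto simp: mor_def kG_dim one_mult_dim mult_one_dim)

lemma mor_zero: "kG_module G M \<Longrightarrow> kG_module G N \<Longrightarrow> mor G M N (0\<^sub>m (deg N) (deg M))"
  by (auto simp: mor_def kG_dim mult_zero_dim)

lemma mor_add:
  assumes "kG_module G M" "kG_module G N" "mor G M N F" "mor G M N H"
  shows "mor G M N (F + H)"
  using assms(3,4) by (auto simp: mor_def kG_dim[OF assms(1)] kG_dim[OF assms(2)] add_mult_dim mult_add_dim)

lemma smult_mat_mult:
  fixes A B :: "'a::comm_semiring_0 mat"
  assumes "dim_col A = dim_row B"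
  shows "(c \<cdot>\<^sub>m A) * B = c \<cdot>\<^sub>m (A * B)" "A * (c \<cdot>\<^sub>m B) = c \<cdot>\<^sub>m (A * B)"
  by (rule mult_smult_assoc_mat[of _ "dim_row A" "dim_col A" _ "dim_col B"],
     (use assms in \<open>auto intro: carrier_matI\<close>)[2])
   (rule mult_smult_distrib[of _ "dim_row A" "dim_col A" _ "dim_col B"],
     (use assms in \<open>auto intro: carrier_matI\<close>)[2])

lemma mor_smult:
  assumes "kG_module G M" "kG_module G N" "mor G M N F"
  shows "mor G M N (c \<cdot>\<^sub>m F)"
  using assms(3) by (auto simp: mor_def kG_dim[OF assms(1)] kG_dim[OF assms(2)] smult_mat_mult)

lemma mor_cong:
  assumes "rep_eq G M M'" "rep_eq G N N'"
  shows "mor G M N F \<longleftrightarrow> mor G M' N' F"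
  using assms by (auto simp: mor_def rep_eq_def)

lemma rep_eq_refl: "rep_eq G M M"
  by (simp add: rep_eq_def)

lemma rep_eq_sym: "rep_eq G M N \<Longrightarrow> rep_eq G N M"
  by (simp add: rep_eq_def)

lemma retract_cong:
  assumes "rep_eq G M M'" "rep_eq G N N'"
  shows "retract G M N \<longleftrightarrow> retract G M' N'"
  using assms(1) mor_cong[OF assms] mor_cong[OF assms(2,1)] by (simp add: retract_def rep_eq_def)

lemma rep_eq_kG_module:
  assumes "group G" "rep_eq G M N" "kG_module G M"
  shows "kG_module G N"
proof -
  interpret group G by fact
  show ?thesis using assms(2,3) by (auto simp: kG_module_def rep_eq_def simp flip: assms)
      (metis m_closed one_closed)+
qed

lemma retract_refl: "kG_module G M \<Longrightarrow> retract G M M"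
  unfolding retract_def by (metis mor_one index_one_mat(2) one_mult_dim)

lemma rep_eq_retract: "kG_module G M \<Longrightarrow> rep_eq G M N \<Longrightarrow> retract G M N"
  using retract_cong[OF rep_eq_refl] retract_refl by blast

lemma retract_trans:
  assumes "kG_module G M" "kG_module G N" "kG_module G L" "retract G M N" "retract G N L"
  shows "retract G M L"
proof -
  obtain i q j r where *: "mor G M N i" "mor G N M q" "q * i = 1\<^sub>m (deg M)"
    "mor G N L j" "mor G L N r" "r * j = 1\<^sub>m (deg N)"
    using assms(4,5) by (auto simp: retract_def)
  have "(q * r) * (j * i) = 1\<^sub>m (deg M)"
    using *(3) left_inverse_mult_dim[OF *(6)] morD(2,3)[OF *(1)] morD(2,3)[OF *(2)] morD(2,3)[OF *(4)] morD(2,3)[OF *(5)]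
    by (simp add: mult_assoc_dim)
  then show ?thesis unfolding retract_def
    using mor_comp[OF assms(1-3) *(1,4)] mor_comp[OF assms(3,2,1) *(5,2)] by blast
qed

text \<open>The inverse of an equivariant matrix is equivariant, so an isomorphism is a pair of
  mutually inverse homomorphisms, which is how it combines with retracts.\<close>

lemma iso_mod_iff:
  assumes "kG_module G M" "kG_module G N"
  shows "iso_mod G M N \<longleftrightarrow>
    (\<exists>i q. mor G M N i \<and> mor G N M q \<and> q * i = 1\<^sub>m (deg M) \<and> i * q = 1\<^sub>m (deg N))"
proof
  assume "iso_mod G M N"
  then obtain P where d: "deg M = deg N" and P: "P \<in> carrier_mat (deg M) (deg M)" "invertible_mat P"
    and PG: "\<And>g. g \<in> carrier G \<Longrightarrow> P * act M g = act N g * P"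
    by (auto simp: iso_mod_def)
  then obtain Q where Q: "P * Q = 1\<^sub>m (deg M)" "Q * P = 1\<^sub>m (dim_row Q)"
    by (auto simp: invertible_mat_def inverts_mat_def)
  have dq: "dim_row Q = deg M" "dim_col Q = deg M"
    by (metis Q(1) Q(2) P(1) carrier_matD(2) index_mult_mat(3) index_one_mat(3))
      (metis Q(1) index_mult_mat(3) index_one_mat(3))
  have dp: "dim_row P = deg M" "dim_col P = deg M" using P by auto
  have "mor G N M Q" unfolding mor_def
  proof (intro conjI ballI)
    fix g assume g: "g \<in> carrier G"
    note da = kG_dim[OF assms(1) g] kG_dim[OF assms(2) g]
    have "Q * (P * act M g) * Q = Q * (act N g * P) * Q" using PG[OF g] by simp
    then show "Q * act N g = act M g * Q"
      using Q da dq dp d left_inverse_mult_dim[OF Q(2)] by (simp add: mat_dim_simps)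
  qed (use dq d in \<open>auto intro: carrier_matI\<close>)
  moreover have "mor G M N P" using P PG d by (auto simp: mor_def)
  ultimately show "\<exists>i q. mor G M N i \<and> mor G N M q \<and> q * i = 1\<^sub>m (deg M) \<and> i * q = 1\<^sub>m (deg N)"
    using Q dq d by metis
next
  assume "\<exists>i q. mor G M N i \<and> mor G N M q \<and> q * i = 1\<^sub>m (deg M) \<and> i * q = 1\<^sub>m (deg N)"
  then obtain i q where *: "mor G M N i" "mor G N M q" "q * i = 1\<^sub>m (deg M)" "i * q = 1\<^sub>m (deg N)" by blast
  have d: "deg M = deg N"
    using right_inverse_dim_le[OF _ _ *(3)] right_inverse_dim_le[OF _ _ *(4)] morD(1)[OF *(1)] morD(1)[OF *(2)]
    by (metis le_antisym)
  then show "iso_mod G M N" unfolding iso_mod_def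
    using * morD[OF *(1)] morD[OF *(2)]
    by (intro conjI bexI[of _ i]) (auto simp: invertible_mat_def inverts_mat_def square_mat.simps)
qed

lemma iso_mod_retract:
  assumes "kG_module G M" "kG_module G N" "iso_mod G M N"
  shows "retract G M N" "retract G N M"
  using assms iso_mod_iff[OF assms(1,2)] by (auto simp: retract_def)

section \<open>Direct sums, tensor products and duals\<close>

lemma kG_triv: "kG_module G (triv_mod n)"
  by (auto simp: kG_module_def triv_mod_def)

lemma triv_simps [simp]: "deg (triv_mod n) = n" "act (triv_mod n) g = 1\<^sub>m n"
  by (auto simp: triv_mod_def)

lemma dsum_simps:
  "deg (dsum M N) = deg M + deg N"
  "act (dsum M N) g = four_block_mat (act M g) (0\<^sub>m (deg M) (deg N)) (0\<^sub>m (deg N) (deg M)) (act N g)"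
  by (auto simp: dsum_def)

lemma kG_dsum:
  assumes "group G" "kG_module G M" "kG_module G N"
  shows "kG_module G (dsum M N)"
proof -
  interpret group G by fact
  note c = assms(2,3)[unfolded kG_module_def]
  show ?thesis unfolding kG_module_def dsum_simps
  proof (intro conjI ballI)
    fix g h assume gh: "g \<in> carrier G" "h \<in> carrier G"
    show "four_block_mat (act M (g \<otimes>\<^bsub>G\<^esub> h)) (0\<^sub>m (deg M) (deg N)) (0\<^sub>m (deg N) (deg M)) (act N (g \<otimes>\<^bsub>G\<^esub> h))
      = four_block_mat (act M g) (0\<^sub>m (deg M) (deg N)) (0\<^sub>m (deg N) (deg M)) (act N g) *
        four_block_mat (act M h) (0\<^sub>m (deg M) (deg N)) (0\<^sub>m (deg N) (deg M)) (act N h)"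
      using c gh by (subst mult_four_block_mat[where ?nr1.0 = "deg M" and ?n1.0 = "deg M" and ?n2.0 = "deg N"
          and ?nr2.0 = "deg N" and ?nc1.0 = "deg M" and ?nc2.0 = "deg N"])
        (auto simp: mult_zero_dim add_zero_dim zero_add_dim kG_dim[OF assms(2)] kG_dim[OF assms(3)])
  qed (use c in auto)
qed

lemma mor_biprod:
  assumes "kG_module G M" "kG_module G N"
  shows "mor G M (dsum M N) (in1 (deg M) (deg N))" "mor G N (dsum M N) (in2 (deg M) (deg N))"
    "mor G (dsum M N) M (pr1 (deg M) (deg N))" "mor G (dsum M N) N (pr2 (deg M) (deg N))"
  using assms by (auto simp: mor_def dsum_simps kG_module_def four_block_biprod intro!: carrier_matI)

lemma kG_tensor:
  assumes "group G" "kG_module G M" "kG_module G N"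
  shows "kG_module G (tensor_mod M N)"
    and act_tensor: "g \<in> carrier G \<Longrightarrow> act (tensor_mod M N) g = kron (act M g) (act N g)"
proof -
  interpret group G by fact
  note c = assms(2,3)[unfolded kG_module_def]
  have a: "act (tensor_mod M N) g = kron (act M g) (act N g)" if "g \<in> carrier G" for g
    using kG_dim[OF assms(2) that] kG_dim[OF assms(3) that]
    by (simp add: tensor_mod_def Let_def kron_def)
  then show "g \<in> carrier G \<Longrightarrow> act (tensor_mod M N) g = kron (act M g) (act N g)" .
  have deg: "deg (tensor_mod M N) = deg M * deg N" by (simp add: tensor_mod_def Let_def)
  show "kG_module G (tensor_mod M N)"
    unfolding kG_module_def deg using c
    by (auto simp: a kron_mult kG_dim[OF assms(2)] kG_dim[OF assms(3)] kron_one intro!: carrier_matI)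
qed

lemma deg_tensor [simp]: "deg (tensor_mod M N) = deg M * deg N"
  by (simp add: tensor_mod_def Let_def)

lemma deg_dual [simp]: "deg (dual_mod G M) = deg M"
  by (simp add: dual_mod_def)

lemma kG_dual:
  assumes "group G" "kG_module G M"
  shows "kG_module G (dual_mod G M)"
proof -
  interpret group G by fact
  show ?thesis using assms(2)
    by (auto simp: kG_module_def dual_mod_def inv_mult_group transpose_mult_dim[symmetric] carrier_matD
       kG_dim[OF assms(2)])
qed

lemma End_rep_eq:
  assumes "group G" "kG_module G M"
  shows "rep_eq G (End_mod G M) (tensor_mod M (dual_mod G M))"
proof -
  interpret group G by fact
  show ?thesis
    unfolding rep_eq_def
  proof (intro conjI ballI)
    fix g assume g: "g \<in> carrier G"
    show "act (End_mod G M) g = act (tensor_mod M (dual_mod G M)) g"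
      unfolding act_tensor[OF assms(1,2) kG_dual[OF assms] g]
      using kG_dim[OF assms(2) g] kG_dim[OF assms(2) inv_closed[OF g]]
      by (auto simp: End_mod_def Let_def dual_mod_def kron_def div_mod_lt intro!: eq_matI)
  qed (simp add: End_mod_def Let_def)
qed

lemma mor_kron:
  assumes "group G" "kG_module G M" "kG_module G N" "kG_module G M'" "kG_module G N'"
    and "mor G M M' F" "mor G N N' H"
  shows "mor G (tensor_mod M N) (tensor_mod M' N') (kron F H)"
  using assms(6,7) unfolding mor_def
  by (auto simp: act_tensor[OF assms(1-3)] act_tensor[OF assms(1,4,5)] kron_mult
     kG_dim[OF assms(2)] kG_dim[OF assms(3)] kG_dim[OF assms(4)] kG_dim[OF assms(5)] intro!: carrier_matI)

lemma mor_swap: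
  assumes "group G" "kG_module G M" "kG_module G N"
  shows "mor G (tensor_mod M N) (tensor_mod N M) (swap_mat (deg M) (deg N))"
  unfolding mor_def
proof (intro conjI ballI)
  fix g assume g: "g \<in> carrier G"
  show "swap_mat (deg M) (deg N) * act (tensor_mod M N) g = act (tensor_mod N M) g * swap_mat (deg M) (deg N)"
    using swap_mat_kron[of "act M g" "act N g"]
    by (simp add: act_tensor[OF assms g] act_tensor[OF assms(1,3,2) g] kG_dim[OF assms(2) g] kG_dim[OF assms(3) g])
qed (auto intro!: carrier_matI)

lemma mor_dual:
  assumes "group G" "mor G M N F" "kG_module G M" "kG_module G N"
  shows "mor G (dual_mod G N) (dual_mod G M) (transpose_mat F)"
proof -
  interpret group G by fact
  show ?thesis using assms
    by (auto simp: mor_def dual_mod_def kG_dim transpose_mult_dim[symmetric])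
qed

text \<open>The numbering \<open>i * n + j\<close> of tensor bases is itself associative, so this is
  an equality of records and not just an isomorphism; later proofs rewrite with it.\<close>

lemma tensor_assoc: "tensor_mod (tensor_mod L M) N = tensor_mod L (tensor_mod M N)"
proof -
  have *: "a div l < m * n" "a mod (n * l) < n * l" "a div l div n = a div (n * l)"
    "a div l mod n = a mod (n * l) div l" "a mod (n * l) mod l = a mod l"
    if "a < m * n * l" for a m n l :: nat
  proof -
    show "a div l < m * n" using div_mod_lt[OF that] by simp
    show "a mod (n * l) < n * l" using div_mod_lt(2)[of a m "n * l"] that by (simp add: mult_ac)
    show "a div l div n = a div (n * l)" by (metis div_mult2_eq mult.commute)
    show "a div l mod n = a mod (n * l) div l"
      using div_mod_lt[OF that] by (cases "l = 0") (auto simp: mult.commute[of n l] mod_mult2_eq)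
    show "a mod (n * l) mod l = a mod l" by (simp add: mod_mod_cancel)
  qed
  show ?thesis
    unfolding tensor_mod_def Let_def by (auto simp: mult.assoc[symmetric] * intro!: ext cong_mat)
qed

lemma tensor_triv_left:
  assumes "group G" "kG_module G M"
  shows "rep_eq G (tensor_mod (triv_mod 1) M) M"
  by (simp add: rep_eq_def act_tensor[OF assms(1) kG_triv assms(2)] kron_one_left del: One_nat_def)

lemma tensor_triv_right:
  assumes "group G" "kG_module G M"
  shows "rep_eq G (tensor_mod M (triv_mod 1)) M"
  by (simp add: rep_eq_def act_tensor[OF assms kG_triv] kron_one_right del: One_nat_def)

lemma tensor_triv_triv:
  assumes "group G"
  shows "rep_eq G (tensor_mod (triv_mod m) (triv_mod n)) (triv_mod (m * n))"
  by (simp add: rep_eq_def act_tensor[OF assms kG_triv kG_triv] kron_one)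

lemma dual_dual:
  assumes "group G"
  shows "rep_eq G (dual_mod G (dual_mod G M)) M"
proof -
  interpret group G by fact
  show ?thesis by (simp add: rep_eq_def dual_mod_def)
qed

lemma dual_tensor:
  assumes "group G" "kG_module G M" "kG_module G N"
  shows "rep_eq G (dual_mod G (tensor_mod M N)) (tensor_mod (dual_mod G M) (dual_mod G N))"
proof -
  interpret group G by fact
  show ?thesis 
    by (simp add: rep_eq_def act_tensor[OF assms(1) kG_dual[OF assms(1,2)] kG_dual[OF assms(1,3)]])
      (simp add: dual_mod_def act_tensor[OF assms] kron_transpose)
qed

lemma dual_triv:
  shows "rep_eq G (dual_mod G (triv_mod n)) (triv_mod n)"
  by (simp add: rep_eq_def dual_mod_def)

lemma tensor_cong:
  assumes "rep_eq G M M'" "rep_eq G N N'"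
  shows "rep_eq G (tensor_mod M N) (tensor_mod M' N')"
  using assms by (auto simp: rep_eq_def tensor_mod_def Let_def)

lemma retract_tensor:
  assumes "group G" "kG_module G M" "kG_module G N" "kG_module G M'" "kG_module G N'"
    and "retract G M M'" "retract G N N'"
  shows "retract G (tensor_mod M N) (tensor_mod M' N')"
proof -
  obtain i q j r where *: "mor G M M' i" "mor G M' M q" "q * i = 1\<^sub>m (deg M)"
    "mor G N N' j" "mor G N' N r" "r * j = 1\<^sub>m (deg N)"
    using assms(6,7) by (auto simp: retract_def)
  have "kron q r * kron i j = 1\<^sub>m (deg M * deg N)"
    using * by (simp add: kron_mult morD kron_one)
  then show ?thesis unfolding retract_def
    using mor_kron[OF assms(1-5) *(1,4)] mor_kron[OF assms(1,4,5,2,3) *(2,5)] by auto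
qed

lemma retract_dual:
  assumes "group G" "kG_module G M" "kG_module G N" "retract G M N"
  shows "retract G (dual_mod G M) (dual_mod G N)"
proof -
  obtain i q where *: "mor G M N i" "mor G N M q" "q * i = 1\<^sub>m (deg M)"
    using assms(4) by (auto simp: retract_def)
  have "transpose_mat i * transpose_mat q = 1\<^sub>m (deg M)"
    using * by (metis morD(2,3) transpose_mult_dim transpose_one)
  then show ?thesis unfolding retract_def
    using mor_dual[OF assms(1) *(1) assms(2,3)] mor_dual[OF assms(1) *(2) assms(3,2)] by auto
qed

lemma retract_swap:
  assumes "group G" "kG_module G M" "kG_module G N"
  shows "retract G (tensor_mod M N) (tensor_mod N M)"
  unfolding retract_def using mor_swap[OF assms] mor_swap[OF assms(1,3,2)] swap_mat_swap
  by (metis deg_tensor)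

text \<open>Being a retract of A \<oplus> B means that the identity is a sum of two endomorphisms,
  one through A and one through B. With this rule and its converse below, arguments on summands
  become computations with such sums.\<close>

lemma retract_dsumI:
  assumes "group G" "kG_module G X" "kG_module G A" "kG_module G B"
    and "mor G A X a1" "mor G X A b1" "mor G B X a2" "mor G X B b2" "a1 * b1 + a2 * b2 = 1\<^sub>m (deg X)"
  shows "retract G X (dsum A B)"
proof -
  let ?i = "in1 (deg A) (deg B) * b1 + in2 (deg A) (deg B) * b2"
  let ?q = "a1 * pr1 (deg A) (deg B) + a2 * pr2 (deg A) (deg B)"
  note K = kG_dsum[OF assms(1,3,4)]
  note m = mor_biprod[OF assms(3,4)]
  have "mor G X (dsum A B) ?i"
    by (intro mor_add assms K mor_comp[OF _ assms(3)] mor_comp[OF _ assms(4)] m)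
  moreover have "mor G (dsum A B) X ?q"
    by (intro mor_add assms K mor_comp[OF _ assms(3)] mor_comp[OF _ assms(4)] m)
  moreover have "?q * ?i = 1\<^sub>m (deg X)"
    using morD(2,3)[OF assms(5)] morD(2,3)[OF assms(6)] morD(2,3)[OF assms(7)] morD(2,3)[OF assms(8)]
    by (simp add: mat_dim_simps assms(9))
  ultimately show ?thesis unfolding retract_def by blast
qed

lemma retract_dsumE:
  assumes "group G" "kG_module G X" "kG_module G A" "kG_module G B" "retract G X (dsum A B)"
  obtains a1 b1 a2 b2 where "mor G A X a1" "mor G X A b1" "mor G B X a2" "mor G X B b2"
    "a1 * b1 + a2 * b2 = 1\<^sub>m (deg X)"
proof -
  let ?m = "deg A" and ?n = "deg B"
  obtain i q where *: "mor G X (dsum A B) i" "mor G (dsum A B) X q" "q * i = 1\<^sub>m (deg X)"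
    using assms(5) by (auto simp: retract_def)
  note K = kG_dsum[OF assms(1,3,4)]
  note m = mor_biprod[OF assms(3,4)]
  note d = morD(2,3)[OF *(1), unfolded dsum_simps(1)] morD(2,3)[OF *(2), unfolded dsum_simps(1)]
  have "(q * in1 ?m ?n) * (pr1 ?m ?n * i) + (q * in2 ?m ?n) * (pr2 ?m ?n * i)
      = q * ((in1 ?m ?n * pr1 ?m ?n + in2 ?m ?n * pr2 ?m ?n) * i)"
    using d by (simp add: mat_dim_simps)
  also have "\<dots> = 1\<^sub>m (deg X)"
    unfolding biprod_sum using d *(3) by (simp add: mat_dim_simps)
  finally show ?thesis
    using that mor_comp[OF assms(3) K assms(2) m(1) *(2)] mor_comp[OF assms(4) K assms(2) m(2) *(2)]
      mor_comp[OF assms(2) K assms(3) *(1) m(3)] mor_comp[OF assms(2) K assms(4) *(1) m(4)] by blast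
qed

lemma retract_dsum_left:
  assumes "kG_module G M" "kG_module G N"
  shows "retract G M (dsum M N)"
  unfolding retract_def using mor_biprod[OF assms] biprod_mult(1) by blast

lemma retract_dsum_right:
  assumes "kG_module G M" "kG_module G N"
  shows "retract G N (dsum M N)"
  unfolding retract_def using mor_biprod[OF assms] biprod_mult(2) by blast

lemma retract_tensor_dsum_left:
  assumes "group G" "kG_module G A" "kG_module G B" "kG_module G Y"
  shows "retract G (tensor_mod (dsum A B) Y) (dsum (tensor_mod A Y) (tensor_mod B Y))"
proof -
  note K = kG_dsum[OF assms(1-3)]
  note m = mor_biprod[OF assms(2,3)] mor_one[OF assms(4)]
  show ?thesis
    by (rule retract_dsumI[OF assms(1) kG_tensor(1) kG_tensor(1) kG_tensor(1)
          mor_kron[OF _ _ _ _ _ m(1,5)] mor_kron[OF _ _ _ _ _ m(3,5)]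
          mor_kron[OF _ _ _ _ _ m(2,5)] mor_kron[OF _ _ _ _ _ m(4,5)]])
      (simp_all add: assms K kron_mult kron_add_left[symmetric] biprod_sum kron_one dsum_simps(1))
qed

lemma retract_tensor_dsum_right:
  assumes "group G" "kG_module G A" "kG_module G B" "kG_module G Y"
  shows "retract G (tensor_mod Y (dsum A B)) (dsum (tensor_mod Y A) (tensor_mod Y B))"
proof -
  note K = kG_dsum[OF assms(1-3)]
  note m = mor_biprod[OF assms(2,3)] mor_one[OF assms(4)]
  show ?thesis
    by (rule retract_dsumI[OF assms(1) kG_tensor(1) kG_tensor(1) kG_tensor(1)
          mor_kron[OF _ _ _ _ _ m(5,1)] mor_kron[OF _ _ _ _ _ m(5,3)]
          mor_kron[OF _ _ _ _ _ m(5,2)] mor_kron[OF _ _ _ _ _ m(5,4)]])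
      (simp_all add: assms K kron_mult kron_add_right[symmetric] biprod_sum kron_one dsum_simps(1))
qed

lemma retract_dsum:
  assumes "group G" "kG_module G M" "kG_module G N" "kG_module G M'" "kG_module G N'"
    and "retract G M M'" "retract G N N'"
  shows "retract G (dsum M N) (dsum M' N')"
proof -
  obtain i q j r where *: "mor G M M' i" "mor G M' M q" "q * i = 1\<^sub>m (deg M)"
    "mor G N N' j" "mor G N' N r" "r * j = 1\<^sub>m (deg N)"
    using assms(6,7) by (auto simp: retract_def)
  note m = mor_biprod[OF assms(2,3)]
  note K = kG_dsum[OF assms(1-3)]
  note d = morD(2,3)[OF *(1)] morD(2,3)[OF *(2)] morD(2,3)[OF *(4)] morD(2,3)[OF *(5)]
  show ?thesis
  proof (rule retract_dsumI[OF assms(1) K assms(4,5) mor_comp[OF _ _ _ *(2) m(1)] mor_comp[OF _ _ _ m(3) *(1)]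
          mor_comp[OF _ _ _ *(5) m(2)] mor_comp[OF _ _ _ m(4) *(4)]])
    show "in1 (deg M) (deg N) * q * (i * pr1 (deg M) (deg N)) + in2 (deg M) (deg N) * r * (j * pr2 (deg M) (deg N))
      = 1\<^sub>m (deg (dsum M N))"
      using d left_inverse_mult_dim[OF *(3)] left_inverse_mult_dim[OF *(6)]
      by (simp add: mult_assoc_dim biprod_sum dsum_simps(1))
  qed (use assms K in auto)
qed

lemma retract_dsum_swap:
  fixes M N :: "('g, 'k::field) rep"
  assumes "group G" "kG_module G M" "kG_module G N"
  shows "retract G (dsum M N) (dsum N M)"
proof -
  let ?m = "deg M" and ?n = "deg N"
  note m = mor_biprod[OF assms(2,3)]
  have "in2 ?m ?n * pr2 ?m ?n + in1 ?m ?n * pr1 ?m ?n = (in1 ?m ?n * pr1 ?m ?n + in2 ?m ?n * pr2 ?m ?n :: 'k mat)"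
    by (rule comm_add_mat[of _ "?m + ?n" "?m + ?n"]) (auto intro!: carrier_matI)
  then show ?thesis
    by (intro retract_dsumI[OF assms(1) kG_dsum[OF assms] assms(3,2) m(2,4,1,3)])
      (simp add: biprod_sum dsum_simps(1))
qed

lemma retract_dsum_assoc:
  assumes "group G" "kG_module G A" "kG_module G B" "kG_module G C"
  shows "retract G (dsum (dsum A B) C) (dsum A (dsum B C))"
    "retract G (dsum A (dsum B C)) (dsum (dsum A B) C)"
proof -
  have *: "rep_eq G (dsum (dsum A B) C) (dsum A (dsum B C))"
    unfolding rep_eq_def dsum_simps
  proof (intro conjI ballI)
    fix g assume g: "g \<in> carrier G"
    note d = kG_dim[OF assms(2) g] kG_dim[OF assms(3) g] kG_dim[OF assms(4) g]
    show "four_block_mat (four_block_mat (act A g) (0\<^sub>m (deg A) (deg B)) (0\<^sub>m (deg B) (deg A)) (act B g))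
       (0\<^sub>m (deg A + deg B) (deg C)) (0\<^sub>m (deg C) (deg A + deg B)) (act C g) =
      four_block_mat (act A g) (0\<^sub>m (deg A) (deg B + deg C)) (0\<^sub>m (deg B + deg C) (deg A))
       (four_block_mat (act B g) (0\<^sub>m (deg B) (deg C)) (0\<^sub>m (deg C) (deg B)) (act C g))"
      using d by (intro eq_matI) auto
  qed simp
  note K = kG_dsum[OF assms(1) kG_dsum[OF assms(1-3)] assms(4)] kG_dsum[OF assms(1,2) kG_dsum[OF assms(1,3,4)]]
  show "retract G (dsum (dsum A B) C) (dsum A (dsum B C))" 
    "retract G (dsum A (dsum B C)) (dsum (dsum A B) C)"
    using rep_eq_retract[OF K(1) *] rep_eq_retract[OF K(2) rep_eq_sym[OF *]] by auto
qed

lemma triv_dsum: "rep_eq G (dsum (triv_mod m) (triv_mod n)) (triv_mod (m + n))"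
  by (auto simp: rep_eq_def dsum_simps)

section \<open>Splitting idempotents\<close>

text \<open>The image of an equivariant idempotent is a submodule. In the basis given by the columns
  of \<open>u\<close>, with coordinates read off by \<open>v\<close>, the element \<open>g\<close>
  acts on it by \<open>v * act M g * u\<close>.\<close>

lemma split_endomorphism:
  assumes "group G" "kG_module G M" "mor G M M e" "e * e = e"
  obtains A u v where "kG_module G A" "mor G A M u" "mor G M A v" "e = u * v" "v * u = 1\<^sub>m (deg A)"
proof -
  interpret group G by fact
  obtain r u v where *: "u \<in> carrier_mat (deg M) r" "v \<in> carrier_mat r (deg M)" "e = u * v" "v * u = 1\<^sub>m r"
    using idempotent_mat_split[OF morD(1)[OF assms(3)] assms(4)] .
  define A where "A = \<lparr>deg = r, act = (\<lambda>g. v * act M g * u)\<rparr>"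
  have A: "deg A = r" "act A g = v * act M g * u" for g by (auto simp: A_def)
  have d: "dim_row u = deg M" "dim_col u = r" "dim_row v = r" "dim_col v = deg M" using * by auto
  note K = kG_dim[OF assms(2)]
  note vu = left_inverse_mult_dim[OF *(4)]
  have eM: "u * (v * act M g) = act M g * (u * v)" if "g \<in> carrier G" for g
    using morD(4)[OF assms(3) that] d K[OF that] unfolding *(3) by (simp add: mult_assoc_dim)
  have gu: "act M g * u = u * (v * (act M g * u))" if g: "g \<in> carrier G" for g
  proof -
    have "u * (v * (act M g * u)) = (u * (v * act M g)) * u" using d K[OF g] by (simp add: mult_assoc_dim)
    also have "\<dots> = act M g * u" unfolding eM[OF g] using d K[OF g] by (simp add: mult_assoc_dim *(4) mult_one_dim)
    finally show ?thesis by simp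
  qed
  have vg: "v * act M g = v * (act M g * (u * v))" if g: "g \<in> carrier G" for g
    unfolding eM[OF g, symmetric] using d K[OF g] by (simp add: vu)
  have "kG_module G A" unfolding kG_module_def A
  proof (intro conjI ballI)
    show "v * act M \<one>\<^bsub>G\<^esub> * u = 1\<^sub>m r"
      using assms(2) d *(4) by (simp add: kG_module_def mult_one_dim)
    fix g h assume gh: "g \<in> carrier G" "h \<in> carrier G"
    have "v * act M (g \<otimes>\<^bsub>G\<^esub> h) * u = v * (act M g * (act M h * u))"
      using assms(2) gh d K by (simp add: kG_module_def mult_assoc_dim)
    also have "\<dots> = v * (act M g * (u * (v * (act M h * u))))" by (subst gu[OF gh(2)]) simp
    also have "\<dots> = v * act M g * u * (v * act M h * u)" using d K gh by (simp add: mult_assoc_dim)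
    finally show "v * act M (g \<otimes>\<^bsub>G\<^esub> h) * u = v * act M g * u * (v * act M h * u)" .
  qed (use d in \<open>auto intro: carrier_matI\<close>)
  moreover have "mor G A M u" unfolding mor_def A
    using *(1) gu d K by (auto simp: mult_assoc_dim)
  moreover have "mor G M A v" unfolding mor_def A
    using *(2) d K by (auto simp: mult_assoc_dim vg[symmetric])
  ultimately show ?thesis using that[of A u v] * A by simp
qed

lemma mat_diff_add: 
  fixes A B :: "'a::ab_group_add mat"
  assumes "dim_row A = dim_row B" "dim_col A = dim_col B"
  shows "B + (A - B) = A"
  using assms by (intro eq_matI) auto

lemma mor_diff:
  assumes "kG_module G M" "kG_module G N" "mor G M N F" "mor G M N H"
  shows "mor G M N (F - H)"
proof -
  have "F - H = F + (-1) \<cdot>\<^sub>m H" using morD(2,3)[OF assms(3)] morD(2,3)[OF assms(4)] by (intro eq_matI) auto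
  then show ?thesis using mor_add[OF assms(1-3) mor_smult[OF assms(1,2,4), of "-1"]] by simp
qed

text \<open>The complement is the image of the idempotent \<open>1 - a * b\<close>. The
  orthogonality relations are part of the conclusion because the proof that a complement of k^m is
  \<F>-projective computes with them.\<close>

lemma complement_decomposition:
  fixes M A :: "('g, 'k::field) rep"
  assumes "group G" "kG_module G M" "kG_module G A" "mor G A M a" "mor G M A b" "b * a = 1\<^sub>m (deg A)"
  obtains B u v where "kG_module G B" "mor G B M u" "mor G M B v" "a * b + u * v = 1\<^sub>m (deg M)"
    "v * u = 1\<^sub>m (deg B)" "b * u = 0\<^sub>m (deg A) (deg B)" "v * a = 0\<^sub>m (deg B) (deg A)" "iso_mod G M (dsum A B)"
proof -
  define e where "e = 1\<^sub>m (deg M) - a * b"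
  note d = morD(2,3)[OF assms(4)] morD(2,3)[OF assms(5)]
  have ab: "mor G M M (a * b)" using mor_comp[OF assms(2,3,2,5,4)] .
  have e: "mor G M M e" unfolding e_def by (rule mor_diff[OF assms(2,2) mor_one[OF assms(2)] ab])
  have abe: "a * b + e = 1\<^sub>m (deg M)" unfolding e_def using d by (intro mat_diff_add) auto
  have de: "dim_row e = deg M" "dim_col e = deg M" using morD[OF e] by auto
  have cancel: "X = 0\<^sub>m m n" if "Y + X = Y" "dim_row X = m" "dim_col X = n" "dim_row Y = m" "dim_col Y = n" for X Y :: "'k mat" and m n
  proof (rule eq_matI)
    fix i j assume ij: "i < dim_row (0\<^sub>m m n :: 'k mat)" "j < dim_col (0\<^sub>m m n :: 'k mat)"
    have "(Y + X) $$ (i, j) = Y $$ (i, j) + X $$ (i, j)" by (rule index_add_mat(1)) (use ij that(2-) in auto)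
    then show "X $$ (i, j) = 0\<^sub>m m n $$ (i, j)" using ij unfolding that(1) by simp
  qed (use that in auto)
  have "b * (a * b + e) = b" unfolding abe using d by (simp add: mult_one_dim)
  then have "b + b * e = b" using d de left_inverse_mult_dim[OF assms(6)] by (simp add: mult_add_dim)
  then have be: "b * e = 0\<^sub>m (deg A) (deg M)" by (rule cancel) (use d de in auto)
  have "(a * b + e) * a = a" unfolding abe using d by (simp add: one_mult_dim)
  then have "a + e * a = a" using d de assms(6) by (simp add: add_mult_dim mult_assoc_dim mult_one_dim)
  then have ea: "e * a = 0\<^sub>m (deg M) (deg A)" by (rule cancel) (use d de in auto)
  have "(a * b + e) * e = e" unfolding abe using de by (simp add: one_mult_dim)
  then have ee: "e * e = e" using d de be by (simp add: mat_dim_simps)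
  obtain B u v where B: "kG_module G B" "mor G B M u" "mor G M B v" "e = u * v" "v * u = 1\<^sub>m (deg B)"
    using split_endomorphism[OF assms(1,2) e ee] .
  note d' = morD(2,3)[OF B(2)] morD(2,3)[OF B(3)]
  have "b * e * u = 0\<^sub>m (deg A) (deg B)" unfolding be using d' by (simp add: mult_zero_dim)
  then have bu: "b * u = 0\<^sub>m (deg A) (deg B)" unfolding B(4) using d d' B(5) by (simp add: mult_assoc_dim mult_one_dim)
  have "v * (e * a) = 0\<^sub>m (deg B) (deg A)" unfolding ea using d' by (simp add: mult_zero_dim)
  then have va: "v * a = 0\<^sub>m (deg B) (deg A)" unfolding B(4) using d d' left_inverse_mult_dim[OF B(5)] by (simp add: mult_assoc_dim)
  let ?m = "deg A" and ?n = "deg B"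
  let ?i = "in1 ?m ?n * b + in2 ?m ?n * v" and ?q = "a * pr1 ?m ?n + u * pr2 ?m ?n"
  note K = kG_dsum[OF assms(1,3) B(1)]
  note m = mor_biprod[OF assms(3) B(1)]
  have "mor G M (dsum A B) ?i"
    by (intro mor_add assms K B mor_comp[OF _ assms(3)] mor_comp[OF _ B(1)] m)
  moreover have "mor G (dsum A B) M ?q"
    by (intro mor_add assms K B mor_comp[OF _ assms(3)] mor_comp[OF _ B(1)] m)
  moreover have "?q * ?i = 1\<^sub>m (deg M)"
    using d d' abe unfolding B(4) by (simp add: mat_dim_simps)
  moreover have "?i * ?q = 1\<^sub>m (deg (dsum A B))"
  proof -
    have z: "b * (u * X) = 0\<^sub>m ?m (dim_col X)" "v * (a * Y) = 0\<^sub>m ?n (dim_col Y)" if "dim_row X = ?n" "dim_row Y = ?m" for X Y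
      using that d d' by (simp_all add: mult_assoc_dim[symmetric] bu va mult_zero_dim del: assoc_mult_mat)
    show ?thesis
      using d d' biprod_sum[of ?m ?n] left_inverse_mult_dim[OF B(5)] left_inverse_mult_dim[OF assms(6)]
      by (simp add: mat_dim_simps z dsum_simps(1))
  qed
  ultimately have "iso_mod G M (dsum A B)"
    unfolding iso_mod_iff[OF assms(2) K] by blast
  then show ?thesis using that B bu va abe by simp
qed

text \<open>A retract has a complement because idempotents split. Summands can therefore be replaced
  by retracts, for which transitivity is composition of maps.\<close>

lemma summand_iff_retract:
  assumes "group G" "kG_module G M"
  shows "summand G N M \<longleftrightarrow> kG_module G N \<and> retract G N M"
proof
  assume "summand G N M"
  then obtain L where "kG_module G N" "kG_module G L" "iso_mod G M (dsum N L)" by (auto simp: summand_def)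
  then show "kG_module G N \<and> retract G N M"
    using iso_mod_retract[OF assms(2) kG_dsum[OF assms(1)]] retract_dsum_left
      retract_trans[OF _ kG_dsum[OF assms(1)] assms(2)] by blast
next
  assume N: "kG_module G N \<and> retract G N M"
  then obtain i q where "mor G N M i" "mor G M N q" "q * i = 1\<^sub>m (deg N)" by (auto simp: retract_def)
  then obtain B where "kG_module G B" "iso_mod G M (dsum N B)"
    using complement_decomposition[OF assms] N by metis
  then show "summand G N M" using N by (auto simp: summand_def)
qed

section \<open>Permutation modules\<close>

lemma retractI: "mor G M X i \<Longrightarrow> mor G X M q \<Longrightarrow> q * i = 1\<^sub>m (deg M) \<Longrightarrow> retract G M X"
  unfolding retract_def by blast

text \<open>A permutation module with the G-set left implicit: each element only has to act by some
  index map. Bijectivity and the action laws follow from the module laws, and closure under sums and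
  products is easily checked in this form.\<close>

definition is_perm :: "('g, 'b) monoid_scheme \<Rightarrow> ('g, 'k::field) rep \<Rightarrow> bool" where
  "is_perm G N \<longleftrightarrow> kG_module G N \<and>
     (\<forall>g\<in>carrier G. \<exists>f. (\<forall>j<deg N. f j < deg N) \<and> act N g = sel_mat (deg N) (deg N) f)"

lemma sel_mat_inject:
  assumes "(sel_mat m n f :: 'a::semiring_1 mat) = sel_mat m n f'" "0 \<noteq> (1::'a)" "j < n" "f j < m"
  shows "f j = f' j"
proof -
  have "(sel_mat m n f :: 'a mat) $$ (f j, j) = sel_mat m n f' $$ (f j, j)" using assms(1) by simp
  then show ?thesis using assms(2-4) by (simp split: if_splits)
qed

lemma sel_mat_cong: "(\<And>j. j < n \<Longrightarrow> f j = f' j) \<Longrightarrow> sel_mat m n f = sel_mat m n f'"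
  by (intro eq_matI) auto

lemma enum_list:
  assumes "finite X"
  shows "distinct (enum_list X)" "set (enum_list X) = X"
proof -
  have "\<exists>xs. distinct xs \<and> set xs = X" using finite_distinct_list[OF assms] by blast
  then have "distinct (enum_list X) \<and> set (enum_list X) = X"
    unfolding enum_list_def by (rule someI_ex)
  then show "distinct (enum_list X)" "set (enum_list X) = X" by auto
qed

lemma length_enum_list: "finite X \<Longrightarrow> length (enum_list X) = card X"
  by (metis distinct_card enum_list)

definition pos :: "'a set \<Rightarrow> 'a \<Rightarrow> nat" where
  "pos X x = (THE i. i < card X \<and> enum_list X ! i = x)"

lemma pos:
  assumes "finite X" "x \<in> X"
  shows "pos X x < card X" "enum_list X ! pos X x = x"
proof -
  have "\<exists>!i. i < card X \<and> enum_list X ! i = x"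
    using assms enum_list[OF assms(1)] length_enum_list[OF assms(1)]
    by (metis in_set_conv_nth nth_eq_iff_index_eq)
  then have "pos X x < card X \<and> enum_list X ! pos X x = x" unfolding pos_def by (rule theI')
  then show "pos X x < card X" "enum_list X ! pos X x = x" by auto
qed

lemma pos_nth:
  assumes "finite X" "i < card X"
  shows "enum_list X ! i \<in> X" "pos X (enum_list X ! i) = i"
proof -
  show *: "enum_list X ! i \<in> X"
    using assms enum_list(2)[OF assms(1)] length_enum_list[OF assms(1)] by (metis nth_mem)
  show "pos X (enum_list X ! i) = i"
    using pos[OF assms(1) *] assms enum_list(1)[OF assms(1)] length_enum_list[OF assms(1)]
    by (metis nth_eq_iff_index_eq)
qed

lemma perm_mod_act:
  assumes "finite X" "\<And>x. x \<in> X \<Longrightarrow> \<phi> g x \<in> X"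
  shows "deg (perm_mod X \<phi>) = card X"
    "act (perm_mod X \<phi>) g = sel_mat (card X) (card X) (\<lambda>j. pos X (\<phi> g (enum_list X ! j)))"
proof -
  show "deg (perm_mod X \<phi>) = card X" using assms by (simp add: perm_mod_def Let_def length_enum_list)
  have "enum_list X ! i = \<phi> g (enum_list X ! j) \<longleftrightarrow> i = pos X (\<phi> g (enum_list X ! j))"
    if "i < card X" "j < card X" for i j
    using pos_nth[OF assms(1) that(1)] pos_nth[OF assms(1) that(2)] pos[OF assms(1) assms(2)] by metis
  then show "act (perm_mod X \<phi>) g = sel_mat (card X) (card X) (\<lambda>j. pos X (\<phi> g (enum_list X ! j)))"
    using assms(1) by (intro eq_matI) (simp_all add: perm_mod_def Let_def length_enum_list)
qed

lemma (in group) perm_mod_is_perm: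
  assumes "finite X" "\<And>g x. g \<in> carrier G \<Longrightarrow> x \<in> X \<Longrightarrow> \<phi> g x \<in> X"
    and "\<And>x. x \<in> X \<Longrightarrow> \<phi> \<one> x = x"
    and "\<And>g h x. g \<in> carrier G \<Longrightarrow> h \<in> carrier G \<Longrightarrow> x \<in> X \<Longrightarrow> \<phi> (g \<otimes> h) x = \<phi> g (\<phi> h x)"
  shows "is_perm G (perm_mod X \<phi> :: ('a, 'k::field) rep)"
proof -
  have a: "deg (perm_mod X \<phi> :: ('a, 'k) rep) = card X"
    "act (perm_mod X \<phi> :: ('a, 'k) rep) g = sel_mat (card X) (card X) (\<lambda>j. pos X (\<phi> g (enum_list X ! j)))"
    if "g \<in> carrier G" for g
    using perm_mod_act[of X \<phi> g] assms(1,2) that by auto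
  note P = pos[OF assms(1)] and N = pos_nth[OF assms(1)]
  have d: "deg (perm_mod X \<phi> :: ('a, 'k) rep) = card X" using a(1)[OF one_closed] by simp
  have "kG_module G (perm_mod X \<phi> :: ('a, 'k) rep)"
    unfolding kG_module_def d
  proof (intro conjI ballI)
    show "act (perm_mod X \<phi> :: ('a, 'k) rep) \<one> = 1\<^sub>m (card X)"
      by (subst a(2)) (auto simp: assms(2,3) N intro!: sel_mat_id)
    fix g h assume gh: "g \<in> carrier G" "h \<in> carrier G"
    show "act (perm_mod X \<phi> :: ('a, 'k) rep) (g \<otimes> h) = act (perm_mod X \<phi>) g * act (perm_mod X \<phi>) h"
      unfolding a(2)[OF gh(1)] a(2)[OF gh(2)] a(2)[OF m_closed[OF gh]]
      using gh by (subst sel_mult_sel) (auto simp: P N assms(2,4) intro!: sel_mat_cong)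
  qed (auto simp: a(2) intro!: carrier_matI)
  moreover have "\<exists>f. (\<forall>j<card X. f j < card X) \<and> act (perm_mod X \<phi> :: ('a, 'k) rep) g = sel_mat (card X) (card X) f"
    if "g \<in> carrier G" for g
    using that by (intro exI[of _ "\<lambda>j. pos X (\<phi> g (enum_list X ! j))"]) (simp add: a P assms(2) N)
  ultimately show ?thesis unfolding is_perm_def d by simp
qed

text \<open>A matrix of this kind determines its index map, so the index maps inherit the laws of a
  group action from the matrices.\<close>

lemma (in group) is_perm_permutation_module:
  assumes "is_perm G N"
  shows "permutation_module G (N :: ('a, 'k::field) rep)"
proof -
  let ?n = "deg N"
  have K: "kG_module G N" using assms by (simp add: is_perm_def)
  have "\<forall>g\<in>carrier G. \<exists>f. (\<forall>j<?n. f j < ?n) \<and> act N g = sel_mat ?n ?n f"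
    using assms unfolding is_perm_def by (rule conjunct2)
  from bchoice[OF this] obtain f where f: "\<And>g j. g \<in> carrier G \<Longrightarrow> j < ?n \<Longrightarrow> f g j < ?n"
    and act: "\<And>g. g \<in> carrier G \<Longrightarrow> act N g = sel_mat ?n ?n (f g)"
    by auto
  have f1: "f \<one> j = j" if "j < ?n" for j
  proof (rule sel_mat_inject[of ?n ?n "f \<one>" "\<lambda>j. j", where 'a = 'k])
    show "(sel_mat ?n ?n (f \<one>) :: 'k mat) = sel_mat ?n ?n (\<lambda>j. j)"
      using K act[OF one_closed] by (simp add: kG_module_def sel_mat_id)
  qed (use that f in auto)
  have fm: "f (g \<otimes> h) j = f g (f h j)" if "g \<in> carrier G" "h \<in> carrier G" "j < ?n" for g h j
  proof (rule sel_mat_inject[of ?n ?n "f (g \<otimes> h)" "\<lambda>j. f g (f h j)", where 'a = 'k])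
    have "act N (g \<otimes> h) = act N g * act N h" using K that by (simp add: kG_module_def)
    then show "(sel_mat ?n ?n (f (g \<otimes> h)) :: 'k mat) = sel_mat ?n ?n (\<lambda>j. f g (f h j))"
      using act that f by (simp add: sel_mult_sel)
  qed (use that f in auto)
  \<comment> \<open>\<open>BijGroup\<close> consists of extensional functions, hence the
    restriction.\<close>
  define \<phi> where "\<phi> g = restrict (f g) {..<?n}" for g
  have bij: "bij_betw (\<phi> g) {..<?n} {..<?n}" if g: "g \<in> carrier G" for g
  proof (rule bij_betw_byWitness[where f' = "f (inv g)"])
    show "\<forall>a\<in>{..<?n}. f (inv g) (\<phi> g a) = a" "\<forall>a'\<in>{..<?n}. \<phi> g (f (inv g) a') = a'"
      using g f f1 by (auto simp: \<phi>_def simp flip: fm)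
  qed (use g f in \<open>auto simp: \<phi>_def\<close>)
  have B: "\<phi> g \<in> Bij {..<?n}" if g: "g \<in> carrier G" for g
    using bij[OF g] by (auto simp: Bij_def \<phi>_def)
  have "\<phi> \<in> hom G (BijGroup {..<?n})"
  proof (rule homI)
    fix g h assume gh: "g \<in> carrier G" "h \<in> carrier G"
    have "\<phi> (g \<otimes> h) = compose {..<?n} (\<phi> g) (\<phi> h)"
      unfolding compose_def \<phi>_def by (intro restrict_ext) (use gh fm f in auto)
    then show "\<phi> (g \<otimes> h) = \<phi> g \<otimes>\<^bsub>BijGroup {..<?n}\<^esub> \<phi> h"
      using gh B by (simp add: BijGroup_def)
  qed (use B in \<open>simp add: BijGroup_def\<close>)
  then have ga: "group_action G {..<?n} \<phi>"
    by (intro group_action.intro group_hom.intro group_hom_axioms.intro group_BijGroup is_group)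
  let ?X = "{..<?n}"
  have ph: "\<phi> g x \<in> ?X" if "g \<in> carrier G" "x \<in> ?X" for g x using that f by (auto simp: \<phi>_def)
  have KP: "kG_module G (perm_mod ?X \<phi> :: ('a, 'k) rep)"
    using perm_mod_is_perm[of ?X \<phi>] ph f1 fm f by (auto simp: \<phi>_def is_perm_def)
  note P = pos[of ?X, simplified] and N = pos_nth[of ?X, simplified]
  note a = perm_mod_act[of ?X \<phi>, OF finite_lessThan ph, simplified]
  have d: "deg (perm_mod ?X \<phi> :: ('a, 'k) rep) = ?n" using a(1)[OF one_closed] by simp
  \<comment> \<open>\<open>perm_mod\<close> lists the basis in the arbitrary order of
    \<open>enum_list\<close>, so the isomorphism is a renumbering of the basis.\<close>
  let ?i = "sel_mat ?n ?n (pos ?X) :: 'k mat" and ?q = "sel_mat ?n ?n ((!) (enum_list ?X)) :: 'k mat"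
  have "mor G N (perm_mod ?X \<phi>) ?i" unfolding mor_def d
  proof (intro conjI ballI)
    fix g assume g: "g \<in> carrier G"
    show "?i * act N g = act (perm_mod ?X \<phi>) g * ?i"
      using g f N P ph by (simp add: a(2) act sel_mult_sel) (intro sel_mat_cong, auto simp: \<phi>_def)
  qed (auto intro: carrier_matI)
  moreover have "mor G (perm_mod ?X \<phi>) N ?q" unfolding mor_def d
  proof (intro conjI ballI)
    fix g assume g: "g \<in> carrier G"
    show "?q * act (perm_mod ?X \<phi>) g = act N g * ?q"
      using g f N P ph by (simp add: a(2) act sel_mult_sel) (intro sel_mat_cong, auto simp: \<phi>_def)
  qed (auto intro: carrier_matI)
  moreover have "?q * ?i = 1\<^sub>m ?n" using P N by (simp add: sel_mult_sel sel_mat_id)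
  moreover have "?i * ?q = 1\<^sub>m ?n" using P N by (simp add: sel_mult_sel sel_mat_id)
  ultimately have "iso_mod G N (perm_mod ?X \<phi>)"
    unfolding iso_mod_iff[OF K KP] d by (intro exI[of _ ?i] exI[of _ ?q]) simp
  then show ?thesis using K ga unfolding permutation_module_def by blast
qed

lemma (in group) permutation_module_retract:
  assumes "permutation_module G (P :: ('a, 'k::field) rep)"
  shows "\<exists>N :: ('a, 'k) rep. is_perm G N \<and> retract G P N"
proof -
  obtain n \<phi> where K: "kG_module G P" and ga: "group_action G {..<n::nat} \<phi>"
    and iso: "iso_mod G P (perm_mod {..<n} \<phi>)"
    using assms by (auto simp: permutation_module_def)
  interpret A: group_action G "{..<n}" \<phi> by fact
  have "is_perm G (perm_mod {..<n} \<phi> :: ('a, 'k) rep)"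
    by (rule perm_mod_is_perm) (auto simp: A.composition_rule A.id_eq_one[symmetric] dest: A.element_image[OF _ _ refl])
  then show ?thesis using iso_mod_retract(1)[OF K _ iso] by (auto simp: is_perm_def)
qed

lemma (in group) p_permutation_iff:
  "p_permutation G (M :: ('a, 'k::field) rep) \<longleftrightarrow> kG_module G M \<and> (\<exists>N :: ('a, 'k) rep. is_perm G N \<and> retract G M N)"
proof
  assume "p_permutation G M"
  then obtain P :: "('a, 'k) rep" where P: "permutation_module G P" "summand G M P"
    by (auto simp: p_permutation_def)
  then have K: "kG_module G P" "kG_module G M" "retract G M P"
    using summand_iff_retract[OF is_group] by (auto simp: permutation_module_def)
  obtain N :: "('a, 'k) rep" where "is_perm G N" "retract G P N"
    using permutation_module_retract[OF P(1)] by blast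
  then show "kG_module G M \<and> (\<exists>N :: ('a, 'k) rep. is_perm G N \<and> retract G M N)"
    using K retract_trans[OF K(2,1)] by (auto simp: is_perm_def)
next
  assume "kG_module G M \<and> (\<exists>N :: ('a, 'k) rep. is_perm G N \<and> retract G M N)"
  then obtain N :: "('a, 'k) rep" where "kG_module G M" "is_perm G N" "retract G M N" by blast
  then show "p_permutation G M"
    unfolding p_permutation_def using is_perm_permutation_module[of N] summand_iff_retract[OF is_group, of N M]
    by (auto simp: is_perm_def)
qed

lemma is_permE:
  assumes "is_perm G N" "g \<in> carrier G"
  obtains f where "\<And>j. j < deg N \<Longrightarrow> f j < deg N" "act N g = sel_mat (deg N) (deg N) f"
proof -
  have "\<exists>f. (\<forall>j<deg N. f j < deg N) \<and> act N g = sel_mat (deg N) (deg N) f"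
    using assms by (auto simp: is_perm_def)
  then show ?thesis using that by auto
qed

lemma is_perm_kG: "is_perm G N \<Longrightarrow> kG_module G N"
  by (simp add: is_perm_def)

lemma is_perm_triv: "is_perm G (triv_mod n)"
  unfolding is_perm_def using kG_triv[of G n] by (auto simp: sel_mat_id intro!: exI[of _ "\<lambda>j. j"])

lemma is_perm_dsum:
  assumes "group G" "is_perm G M" "is_perm G N"
  shows "is_perm G (dsum M N)"
  unfolding is_perm_def
proof (intro conjI ballI)
  show "kG_module G (dsum M N)" using assms by (simp add: kG_dsum is_perm_def)
  fix g assume g: "g \<in> carrier G"
  obtain f where f: "\<And>j. j < deg M \<Longrightarrow> f j < deg M" "act M g = sel_mat (deg M) (deg M) f"
    by (rule is_permE[OF assms(2) g], rule that)
  obtain h where h: "\<And>j. j < deg N \<Longrightarrow> h j < deg N" "act N g = sel_mat (deg N) (deg N) h"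
    by (rule is_permE[OF assms(3) g], rule that)
  let ?F = "\<lambda>j. if j < deg M then f j else deg M + h (j - deg M)"
  have "act (dsum M N) g = sel_mat (deg M + deg N) (deg M + deg N) ?F"
    unfolding dsum_simps f(2) h(2)
  proof (rule eq_matI)
    fix i j assume "i < dim_row (sel_mat (deg M + deg N) (deg M + deg N) ?F)" "j < dim_col (sel_mat (deg M + deg N) (deg M + deg N) ?F)"
    then have l: "i < deg M + deg N" "j < deg M + deg N" by auto
    show "four_block_mat (sel_mat (deg M) (deg M) f) (0\<^sub>m (deg M) (deg N)) (0\<^sub>m (deg N) (deg M)) (sel_mat (deg N) (deg N) h) $$ (i, j) =
      sel_mat (deg M + deg N) (deg M + deg N) ?F $$ (i, j)"
      using l f(1)[of j] h(1)[of "j - deg M"] by auto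
  qed auto
  moreover have "?F j < deg M + deg N" if "j < deg M + deg N" for j
    using that f(1)[of j] h(1)[of "j - deg M"] by auto
  ultimately show "\<exists>f. (\<forall>j<deg (dsum M N). f j < deg (dsum M N)) \<and> act (dsum M N) g = sel_mat (deg (dsum M N)) (deg (dsum M N)) f"
    unfolding dsum_simps(1) by (intro exI[of _ ?F]) simp
qed

lemma is_perm_tensor:
  assumes "group G" "is_perm G M" "is_perm G N"
  shows "is_perm G (tensor_mod M N)"
  unfolding is_perm_def
proof (intro conjI ballI)
  have K: "kG_module G M" "kG_module G N" using assms by (auto simp: is_perm_def)
  show "kG_module G (tensor_mod M N)" using kG_tensor(1)[OF assms(1) K] .
  fix g assume g: "g \<in> carrier G"
  obtain f where f: "\<And>j. j < deg M \<Longrightarrow> f j < deg M" "act M g = sel_mat (deg M) (deg M) f"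
    by (rule is_permE[OF assms(2) g], rule that)
  obtain h where h: "\<And>j. j < deg N \<Longrightarrow> h j < deg N" "act N g = sel_mat (deg N) (deg N) h"
    by (rule is_permE[OF assms(3) g], rule that)
  let ?F = "\<lambda>j. f (j div deg N) * deg N + h (j mod deg N)"
  have lt: "?F j < deg M * deg N" if "j < deg M * deg N" for j
    using div_mod_lt[OF that] f(1) h(1) by (intro mult_add_lt) auto
  have "act (tensor_mod M N) g = sel_mat (deg M * deg N) (deg M * deg N) ?F"
    unfolding act_tensor[OF assms(1) K g] f(2) h(2)
  proof (rule eq_matI)
    fix i j assume "i < dim_row (sel_mat (deg M * deg N) (deg M * deg N) ?F)" "j < dim_col (sel_mat (deg M * deg N) (deg M * deg N) ?F)"
    then have l: "i < deg M * deg N" "j < deg M * deg N" by auto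
    have "i = ?F j \<longleftrightarrow> i div deg N = f (j div deg N) \<and> i mod deg N = h (j mod deg N)"
      using h(1)[OF div_mod_lt(2)[OF l(2)]] div_mod_eq_iff[of i "?F j" "deg N"] by auto
    then show "kron (sel_mat (deg M) (deg M) f) (sel_mat (deg N) (deg N) h) $$ (i, j) =
      sel_mat (deg M * deg N) (deg M * deg N) ?F $$ (i, j)"
      using l by (simp add: kron_index div_mod_lt)
  qed auto
  then show "\<exists>f. (\<forall>j<deg (tensor_mod M N). f j < deg (tensor_mod M N)) \<and> act (tensor_mod M N) g = sel_mat (deg (tensor_mod M N)) (deg (tensor_mod M N)) f"
    unfolding deg_tensor using lt by (intro exI[of _ ?F]) simp
qed

lemma (in group) perm_mod_retract_bij:
  assumes X: "finite X" "\<And>g x. g \<in> carrier G \<Longrightarrow> x \<in> X \<Longrightarrow> \<phi> g x \<in> X"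
    and Y: "\<And>g y. g \<in> carrier G \<Longrightarrow> y \<in> Y \<Longrightarrow> \<psi> g y \<in> Y"
    and h: "bij_betw h X Y" "\<And>g x. g \<in> carrier G \<Longrightarrow> x \<in> X \<Longrightarrow> h (\<phi> g x) = \<psi> g (h x)"
  shows "retract G (perm_mod X \<phi> :: ('a, 'k::field) rep) (perm_mod Y \<psi>)"
proof -
  have fY: "finite Y" and c: "card Y = card X" using h(1) X(1) bij_betw_finite bij_betw_same_card by metis+
  let ?n = "card X"
  define k where "k = inv_into X h"
  have k: "k y \<in> X" "h (k y) = y" if "y \<in> Y" for y
    using that h(1) unfolding k_def by (auto simp: bij_betw_def inv_into_into f_inv_into_f)
  have kh: "k (h x) = x" if "x \<in> X" for x using that h(1) by (simp add: k_def bij_betw_def)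
  have hY: "h x \<in> Y" if "x \<in> X" for x using that h(1) by (auto simp: bij_betw_def)
  have kg: "k (\<psi> g y) = \<phi> g (k y)" if "g \<in> carrier G" "y \<in> Y" for g y
    using that h(2)[of g "k y"] k kh X(2) by metis
  note P = pos[OF X(1)] pos[OF fY, unfolded c] and N = pos_nth[OF X(1)] pos_nth[OF fY, unfolded c]
  note a = perm_mod_act[of X \<phi>, OF X(1,2)] perm_mod_act[of Y \<psi>, OF fY Y, unfolded c]
  let ?i = "sel_mat ?n ?n (\<lambda>j. pos Y (h (enum_list X ! j))) :: 'k mat"
  let ?q = "sel_mat ?n ?n (\<lambda>j. pos X (k (enum_list Y ! j))) :: 'k mat"
  have d: "deg (perm_mod X \<phi> :: ('a, 'k) rep) = ?n" "deg (perm_mod Y \<psi> :: ('a, 'k) rep) = ?n"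
    using a(1)[OF one_closed] a(3)[OF one_closed] by auto
  have "mor G (perm_mod X \<phi>) (perm_mod Y \<psi>) ?i"
    unfolding mor_def d
  proof (intro conjI ballI)
    fix g assume g: "g \<in> carrier G"
    show "?i * act (perm_mod X \<phi>) g = act (perm_mod Y \<psi>) g * ?i"
      using g P N X(2) Y hY by (simp add: a sel_mult_sel) (intro sel_mat_cong, auto simp: h(2))
  qed (auto intro: carrier_matI)
  moreover have "mor G (perm_mod Y \<psi>) (perm_mod X \<phi>) ?q"
    unfolding mor_def d
  proof (intro conjI ballI)
    fix g assume g: "g \<in> carrier G"
    show "?q * act (perm_mod Y \<psi>) g = act (perm_mod X \<phi>) g * ?q"
      using g P N X(2) Y k by (simp add: a sel_mult_sel) (intro sel_mat_cong, auto simp: kg)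
  qed (auto intro: carrier_matI)
  moreover have "?q * ?i = 1\<^sub>m ?n"
    using P N hY kh by (simp add: sel_mult_sel sel_mat_id)
  ultimately show ?thesis by (intro retractI[of _ _ _ ?i ?q]) (simp_all add: d)
qed


section \<open>Graded modules\<close>

text \<open>\<open>X\<close> is a sum of \<open>l\<close> blocks of dimension \<open>d\<close>, the basis element \<open>r\<close> lying in block \<open>r div d\<close>, and \<open>g\<close> maps block \<open>i\<close> to block \<open>f g i\<close>.\<close>

definition graded ::
  "('g, 'b) monoid_scheme \<Rightarrow> ('g, 'k::field) rep \<Rightarrow> nat \<Rightarrow> nat \<Rightarrow> ('g \<Rightarrow> nat \<Rightarrow> nat) \<Rightarrow> bool" where
  "graded G X l d f \<longleftrightarrow> deg X = l * d \<and> (\<forall>g\<in>carrier G. act X g \<in> carrier_mat (l * d) (l * d) \<and>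
     (\<forall>i<l. f g i < l) \<and> inj_on (f g) {..<l} \<and>
     (\<forall>r<l * d. \<forall>c<l * d. act X g $$ (r, c) \<noteq> 0 \<longrightarrow> r div d = f g (c div d)))"

lemma gradedD:
  assumes "graded G X l d f" "g \<in> carrier G"
  shows "dim_row (act X g) = l * d" "dim_col (act X g) = l * d"
    "i < l \<Longrightarrow> f g i < l" "inj_on (f g) {..<l}"
    "r < l * d \<Longrightarrow> c < l * d \<Longrightarrow> r div d \<noteq> f g (c div d) \<Longrightarrow> act X g $$ (r, c) = 0"
  using assms by (auto simp: graded_def)

text \<open>The embedding sends a vector \<open>x\<close> of block \<open>i\<close> to
  \<open>e_i \<otimes> x\<close>. Its transpose sends \<open>e_i \<otimes> x\<close> back to
  \<open>x\<close> if \<open>x\<close> lies in block \<open>i\<close>, and to zero if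
  \<open>x\<close> lies in another block. Both are equivariant since \<open>P\<close> permutes its
  basis as \<open>X\<close> permutes its blocks. Applied to induced modules, this makes them
  retracts of their product with k[G/Q].\<close>

lemma graded_retract:
  assumes "group G" "graded G X l d f" "kG_module G P" "kG_module G X"
    and P: "deg P = l" "\<And>g. g \<in> carrier G \<Longrightarrow> act P g = sel_mat l l (f g)"
  shows "retract G (X :: ('g, 'k::field) rep) (tensor_mod P X)"
proof -
  have dX: "deg X = l * d" using assms(2) by (simp add: graded_def)
  \<comment> \<open>The number of \<open>e_i \<otimes> e_c\<close> in the tensor basis, where
    \<open>i = c div d\<close> is the block of \<open>e_c\<close>.\<close>
  let ?F = "\<lambda>c. (c div d) * (l * d) + c"
  define i :: "'k mat" where "i = sel_mat (l * (l * d)) (l * d) ?F"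
  have F: "?F c < l * (l * d)" "?F c div (l * d) = c div d" "?F c mod (l * d) = c" if "c < l * d" for c
  proof -
    show "?F c < l * (l * d)" using div_mod_lt(1)[OF that] that by (rule mult_add_lt)
    have "l * d \<noteq> 0" using that by linarith
    then show "?F c div (l * d) = c div d" using that by (subst div_mult_self3) auto
    show "?F c mod (l * d) = c" using that by (subst mod_mult_self3) auto
  qed
  have Finj: "inj_on ?F {..<l * d}" 
  proof (rule inj_onI)
    fix x y assume "x \<in> {..<l * d}" "y \<in> {..<l * d}" "?F x = ?F y"
    have "x = ?F x mod (l * d)" using F(3)[of x] \<open>x \<in> {..<l * d}\<close> by simp
    also have "\<dots> = ?F y mod (l * d)" by (rule arg_cong[OF \<open>?F x = ?F y\<close>])
    also have "\<dots> = y" using F(3)[of y] \<open>y \<in> {..<l * d}\<close> by simp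
    finally show "x = y" .
  qed
  have Fex: "(\<exists>c'<l * d. r = ?F c') \<longleftrightarrow> r div (l * d) = (r mod (l * d)) div d" if "r < l * (l * d)" for r
  proof
    assume "\<exists>c'<l * d. r = ?F c'"
    then obtain c' where "c' < l * d" "r = ?F c'" by blast
    then show "r div (l * d) = (r mod (l * d)) div d" using F(2,3)[of c'] by simp
  next
    assume "r div (l * d) = (r mod (l * d)) div d"
    then have "r = ?F (r mod (l * d))" using div_mult_mod_eq[of r "l * d"] by simp
    then show "\<exists>c'<l * d. r = ?F c'" using div_mod_lt(2)[OF that] by blast
  qed
  have Finv: "inv_into {..<l * d} ?F r = r mod (l * d)" if "\<exists>c'<l * d. r = ?F c'" for r
  proof -
    from that obtain c' where c': "c' < l * d" "r = ?F c'" by blast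
    then show ?thesis using F(3)[of c'] inv_into_f_f[OF Finj, of c'] by simp
  qed
  have *: "i * act X g = act (tensor_mod P X) g * i \<and> transpose_mat i * act (tensor_mod P X) g = act X g * transpose_mat i"
    if g: "g \<in> carrier G" for g
  proof -
    note X = gradedD(1,2)[OF assms(2) g] and fl = gradedD(3)[OF assms(2) g] and fi = gradedD(4)[OF assms(2) g]
      and X0 = gradedD(5)[OF assms(2) g]
    have act: "act (tensor_mod P X) g = kron (sel_mat l l (f g)) (act X g)"
      using act_tensor[OF assms(1,3,4) g] P(2)[OF g] by simp
    have "i * act X g = kron (sel_mat l l (f g)) (act X g) * i"
    proof (rule eq_matI)
      fix r c assume "r < dim_row (kron (sel_mat l l (f g)) (act X g) * i)" "c < dim_col (kron (sel_mat l l (f g)) (act X g) * i)"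
      then have rc: "r < l * (l * d)" "c < l * d" using X by (auto simp: i_def)
      note r = div_mod_lt[OF rc(1)] and c = div_mod_lt(1)[OF rc(2)]
      have "(i * act X g) $$ (r, c) = (if r div (l * d) = (r mod (l * d)) div d then act X g $$ (r mod (l * d), c) else 0)"
        unfolding i_def using rc X Finj Fex[OF rc(1)] Finv[of r] by (subst sel_mult_index) auto
      also have "\<dots> = (if r div (l * d) = f g (c div d) then 1 else 0) * act X g $$ (r mod (l * d), c)"
        using X0[OF r(2) rc(2)] by auto
      also have "\<dots> = kron (sel_mat l l (f g)) (act X g) $$ (r, ?F c)"
        using rc r c X F[OF rc(2)] by (subst kron_index) auto
      also have "\<dots> = (kron (sel_mat l l (f g)) (act X g) * i) $$ (r, c)"
        unfolding i_def using rc X F[OF rc(2)] by (subst mult_sel_index) auto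
      finally show "(i * act X g) $$ (r, c) = (kron (sel_mat l l (f g)) (act X g) * i) $$ (r, c)" .
    qed (use X in \<open>auto simp: i_def\<close>)
    moreover have "transpose_mat i * kron (sel_mat l l (f g)) (act X g) = act X g * transpose_mat i"
    proof (rule eq_matI)
      fix r c assume "r < dim_row (act X g * transpose_mat i)" "c < dim_col (act X g * transpose_mat i)"
      then have rc: "c < l * (l * d)" "r < l * d" using X by (auto simp: i_def)
      note c = div_mod_lt[OF rc(1)] and r = div_mod_lt(1)[OF rc(2)]
      have "(transpose_mat i * kron (sel_mat l l (f g)) (act X g)) $$ (r, c) = kron (sel_mat l l (f g)) (act X g) $$ (?F r, c)"
        unfolding i_def using rc X F[OF rc(2)] by (subst transpose_sel_mult_index) auto
      also have "\<dots> = (if r div d = f g (c div (l * d)) then 1 else 0) * act X g $$ (r, c mod (l * d))"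
        using rc r c X F[OF rc(2)] by (subst kron_index) auto
      \<comment> \<open>A nonzero entry forces \<open>r div d\<close> to be the image under
        \<open>f g\<close> of the block of \<open>c mod (l * d)\<close>; injectivity of
        \<open>f g\<close> then identifies the two conditions.\<close>
      also have "\<dots> = (if c div (l * d) = (c mod (l * d)) div d then act X g $$ (r, c mod (l * d)) else 0)"
        using X0[OF rc(2) c(2)] inj_on_eq_iff[OF fi, of "c div (l * d)" "(c mod (l * d)) div d"] c div_mod_lt(1)[OF c(2)]
        by (cases "act X g $$ (r, c mod (l * d)) = 0") auto
      also have "\<dots> = (act X g * transpose_mat i) $$ (r, c)"
        unfolding i_def using rc X Finj Fex[OF rc(1)] Finv[of c] by (subst mult_transpose_sel_index) auto
      finally show "(transpose_mat i * kron (sel_mat l l (f g)) (act X g)) $$ (r, c) = (act X g * transpose_mat i) $$ (r, c)" .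
    qed (use X in \<open>auto simp: i_def\<close>)
    ultimately show ?thesis unfolding act by blast
  qed
  have "transpose_mat i * i = 1\<^sub>m (l * d)"
    unfolding i_def using Finj F by (intro transpose_sel_mult_self) auto
  moreover have "i \<in> carrier_mat (l * (l * d)) (l * d)" by (auto simp: i_def intro: carrier_matI)
  ultimately show ?thesis
    using * by (intro retractI[of _ _ _ i "transpose_mat i"]) (auto simp: mor_def dX P(1))
qed

lemma sum_blocks:
  fixes F :: "nat \<Rightarrow> 'a::comm_monoid_add"
  shows "(\<Sum>c<m * n. F c) = (\<Sum>i<m. \<Sum>j<n. F (i * n + j))"
  using sum_div_mod[of "\<lambda>i j. F (i * n + j)" n m] by simp

text \<open>Let \<open>E i\<close> be the projection to block \<open>i\<close>. The scalar
  \<open>b * E i * a\<close> does not depend on \<open>i\<close>: the element \<open>g\<close>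
  carries \<open>E i\<close> to \<open>E (f g i)\<close>, \<open>a\<close> and \<open>b\<close> are
  invariant, and the blocks are permuted transitively. So \<open>b * a\<close> is \<open>l\<close>
  times one scalar.\<close>

lemma graded_composite_zero:
  assumes "kG_module G (X :: ('g, 'k::field) rep)" "graded G X l d f" "of_nat l = (0::'k)"
    and trans: "\<And>i j. i < l \<Longrightarrow> j < l \<Longrightarrow> \<exists>g\<in>carrier G. f g i = j"
    and a: "mor G (triv_mod 1) X a" and b: "mor G X (triv_mod 1) b"
  shows "b * a = 0\<^sub>m 1 1"
proof (rule eq_matI)
  have dX: "deg X = l * d" using assms(2) by (simp add: graded_def)
  have da: "dim_row a = l * d" "dim_col a = 1" "dim_row b = 1" "dim_col b = l * d"
    using morD(2,3)[OF a] morD(2,3)[OF b] dX by auto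
  define E where "E i = mat (l * d) (l * d) (\<lambda>(r, c). if r = c \<and> r div d = i then 1 else (0::'k))" for i
  define s where "s i = (\<Sum>j<d. b $$ (0, i * d + j) * a $$ (i * d + j, 0))" for i
  have dE: "dim_row (E i) = l * d" "dim_col (E i) = l * d" for i by (auto simp: E_def)
  have Emult: "(E i * A) $$ (r, c) = (if r div d = i then A $$ (r, c) else 0)"
    if "r < l * d" "c < dim_col A" "dim_row A = l * d" for A :: "'k mat" and r c i
  proof -
    have "(E i * A) $$ (r, c) = (\<Sum>k<l * d. (if r = k then 1 else 0) * ((if r div d = i then 1 else 0) * A $$ (k, c)))"
      using that by (subst index_mult_mat_sum) (auto simp: E_def intro!: sum.cong)
    also have "\<dots> = (if r div d = i then 1 else 0) * A $$ (r, c)"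
      using that(1) by (rule sum_delta_times(2))
    finally show ?thesis by simp
  qed
  have multE: "(A * E i) $$ (r, c) = (if c div d = i then A $$ (r, c) else 0)"
    if "r < dim_row A" "c < l * d" "dim_col A = l * d" for A :: "'k mat" and r c i
  proof -
    have "(A * E i) $$ (r, c) = (\<Sum>k<l * d. (A $$ (r, k) * (if k div d = i then 1 else 0)) * (if k = c then 1 else 0))"
      using that by (subst index_mult_mat_sum) (auto simp: E_def intro!: sum.cong)
    also have "\<dots> = A $$ (r, c) * (if c div d = i then 1 else 0)"
      using that(2) by (rule sum_delta_times(1))
    finally show ?thesis by simp
  qed
  have s: "(b * (E i * a)) $$ (0, 0) = s i" if i: "i < l" for i
  proof -
    have "(b * (E i * a)) $$ (0, 0) = (\<Sum>c<l * d. b $$ (0, c) * (if c div d = i then a $$ (c, 0) else 0))"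
      using da dE by (subst index_mult_mat_sum) (auto simp: Emult simp del: index_mult_mat(1) intro!: sum.cong)
    also have "\<dots> = (\<Sum>k<l. \<Sum>j<d. b $$ (0, k * d + j) * (if (k * d + j) div d = i then a $$ (k * d + j, 0) else 0))"
      by (rule sum_blocks)
    also have "\<dots> = (\<Sum>k<l. if k = i then s i else 0)"
      by (intro sum.cong) (auto simp: s_def)
    also have "\<dots> = s i" using i by simp
    finally show ?thesis .
  qed
  have ss: "s (f g i) = s i" if g: "g \<in> carrier G" and i: "i < l" for g i
  proof -
    note X = gradedD(1,2)[OF assms(2) g] and fl = gradedD(3)[OF assms(2) g] and fi = gradedD(4)[OF assms(2) g]
      and X0 = gradedD(5)[OF assms(2) g]
    have EX: "E (f g i) * act X g = act X g * E i"
    proof (rule eq_matI)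
      fix r c assume "r < dim_row (act X g * E i)" "c < dim_col (act X g * E i)"
      then have rc: "r < l * d" "c < l * d" using X dE by auto
      have "(r div d = f g i) = (c div d = i)" if "act X g $$ (r, c) \<noteq> 0"
      proof -
        have "r div d = f g (c div d)" using X0[OF rc] that by blast
        then show ?thesis
          using inj_on_eq_iff[OF fi, of "c div d" i] div_mod_lt(1)[OF rc(2)] i by simp
      qed
      then show "(E (f g i) * act X g) $$ (r, c) = (act X g * E i) $$ (r, c)"
        using rc X Emult[of r c "act X g" "f g i"] multE[of r "act X g" c i] by auto
    qed (use X dE in auto)
    have ga: "act X g * a = a" and gb: "b * act X g = b"
      using morD(4)[OF a g] morD(4)[OF b g] da by (simp_all add: mult_one_dim one_mult_dim)
    have "b * (E (f g i) * a) = b * (E (f g i) * (act X g * a))" unfolding ga ..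
    also have "\<dots> = b * ((E (f g i) * act X g) * a)" using X dE da by (simp add: mult_assoc_dim)
    also have "\<dots> = (b * act X g) * (E i * a)" unfolding EX using X dE da by (simp add: mult_assoc_dim)
    also have "\<dots> = b * (E i * a)" unfolding gb ..
    finally show ?thesis using s[OF i] s[OF fl[OF i]] by simp
  qed
  fix i j assume "i < dim_row (0\<^sub>m 1 1 :: 'k mat)" "j < dim_col (0\<^sub>m 1 1 :: 'k mat)"
  then have ij: "i = 0" "j = 0" by auto
  have "(b * a) $$ (0, 0) = (\<Sum>c<l * d. b $$ (0, c) * a $$ (c, 0))"
    using da by (subst index_mult_mat_sum) auto
  also have "\<dots> = (\<Sum>i<l. s i)" unfolding s_def by (rule sum_blocks)
  also have "\<dots> = (\<Sum>i<l. s 0)"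
  proof (rule sum.cong[OF refl])
    fix i assume i: "i \<in> {..<l}"
    then obtain g where "g \<in> carrier G" "f g 0 = i" using trans[of 0 i] by auto
    then show "s i = s 0" using ss[of g 0] i by auto
  qed
  also have "\<dots> = 0" using assms(3) by simp
  finally show "(b * a) $$ (i, j) = 0\<^sub>m 1 1 $$ (i, j)" using ij by simp
qed (use morD(2,3)[OF a] morD(2,3)[OF b] in auto)

section \<open>Induced modules\<close>

definition bdiag :: "nat \<Rightarrow> nat \<Rightarrow> (nat \<Rightarrow> 'a::comm_semiring_1 mat) \<Rightarrow> 'a mat" where
  "bdiag l d B = mat (l * d) (l * d) (\<lambda>(r, c). if r div d = c div d then B (r div d) $$ (r mod d, c mod d) else 0)"

lemma bdiag_dim [simp]: "dim_row (bdiag l d B) = l * d" "dim_col (bdiag l d B) = l * d"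
  by (auto simp: bdiag_def)

lemma bdiag_mult_index:
  assumes "r < l * d" "c < dim_col A" "dim_row A = l * d"
  shows "(bdiag l d B * A) $$ (r, c) = (\<Sum>a<d. B (r div d) $$ (r mod d, a) * A $$ ((r div d) * d + a, c))"
proof -
  have lt: "i * d + a < l * d" if "i < l" "a < d" for i a using that by (rule mult_add_lt)
  have "(bdiag l d B * A) $$ (r, c) = (\<Sum>k<l * d. bdiag l d B $$ (r, k) * A $$ (k, c))"
    using assms by (subst index_mult_mat_sum) auto
  also have "\<dots> = (\<Sum>i<l. \<Sum>a<d. bdiag l d B $$ (r, i * d + a) * A $$ (i * d + a, c))"
    by (rule sum_blocks)
  also have "\<dots> = (\<Sum>i<l. if i = r div d then (\<Sum>a<d. B (r div d) $$ (r mod d, a) * A $$ ((r div d) * d + a, c)) else 0)"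
    using assms lt by (intro sum.cong) (auto simp: bdiag_def)
  also have "\<dots> = (\<Sum>a<d. B (r div d) $$ (r mod d, a) * A $$ ((r div d) * d + a, c))"
    using div_mod_lt(1)[OF assms(1)] by simp
  finally show ?thesis .
qed

lemma mult_bdiag_index:
  assumes "c < l * d" "r < dim_row A" "dim_col A = l * d"
  shows "(A * bdiag l d B) $$ (r, c) = (\<Sum>a<d. A $$ (r, (c div d) * d + a) * B (c div d) $$ (a, c mod d))"
proof -
  have lt: "i * d + a < l * d" if "i < l" "a < d" for i a using that by (rule mult_add_lt)
  have "(A * bdiag l d B) $$ (r, c) = (\<Sum>k<l * d. A $$ (r, k) * bdiag l d B $$ (k, c))"
    using assms by (subst index_mult_mat_sum) auto
  also have "\<dots> = (\<Sum>i<l. \<Sum>a<d. A $$ (r, i * d + a) * bdiag l d B $$ (i * d + a, c))"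
    by (rule sum_blocks)
  also have "\<dots> = (\<Sum>i<l. if i = c div d then (\<Sum>a<d. A $$ (r, (c div d) * d + a) * B (c div d) $$ (a, c mod d)) else 0)"
    using assms lt by (intro sum.cong) (auto simp: bdiag_def)
  also have "\<dots> = (\<Sum>a<d. A $$ (r, (c div d) * d + a) * B (c div d) $$ (a, c mod d))"
    using div_mod_lt(1)[OF assms(1)] by simp
  finally show ?thesis .
qed

lemma bdiag_inverse:
  fixes B B' :: "nat \<Rightarrow> 'a::comm_semiring_1 mat"
  assumes "\<And>i. i < l \<Longrightarrow> B i \<in> carrier_mat d d" "\<And>i. i < l \<Longrightarrow> B' i \<in> carrier_mat d d"
    and "\<And>i. i < l \<Longrightarrow> B i * B' i = 1\<^sub>m d"
  shows "bdiag l d B * bdiag l d B' = 1\<^sub>m (l * d)"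
proof (rule eq_matI)
  fix r c assume "r < dim_row (1\<^sub>m (l * d) :: 'a mat)" "c < dim_col (1\<^sub>m (l * d) :: 'a mat)"
  then have rc: "r < l * d" "c < l * d" by auto
  note r = div_mod_lt[OF rc(1)] and c = div_mod_lt[OF rc(2)]
  have lt: "(r div d) * d + a < l * d" if "a < d" for a using r(1) that by (rule mult_add_lt)
  have "(bdiag l d B * bdiag l d B') $$ (r, c) =
      (\<Sum>a<d. if r div d = c div d then B (r div d) $$ (r mod d, a) * B' (r div d) $$ (a, c mod d) else 0)"
    using rc lt by (subst bdiag_mult_index) (auto simp: bdiag_def intro!: sum.cong)
  also have "\<dots> = (if r div d = c div d then (\<Sum>a<d. B (r div d) $$ (r mod d, a) * B' (r div d) $$ (a, c mod d)) else 0)"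
    by simp
  also have "(\<Sum>a<d. B (r div d) $$ (r mod d, a) * B' (r div d) $$ (a, c mod d)) = (B (r div d) * B' (r div d)) $$ (r mod d, c mod d)"
    using assms(1,2)[OF r(1)] r c by (subst index_mult_mat_sum) auto
  also have "(if r div d = c div d then (B (r div d) * B' (r div d)) $$ (r mod d, c mod d) else 0) = 1\<^sub>m (l * d) $$ (r, c)"
    using assms(3)[OF r(1)] rc r c div_mod_eq_iff[of r c d] by auto
  finally show "(bdiag l d B * bdiag l d B') $$ (r, c) = 1\<^sub>m (l * d) $$ (r, c)" .
qed auto

text \<open>For data \<open>A\<close> whose module laws are not yet known: an intertwiner
  \<open>D\<close> with left inverse \<open>D'\<close> gives
  \<open>act A g = D' * act B g * D\<close>, and \<open>A\<close> inherits the laws of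
  \<open>B\<close>. Induced modules are treated this way.\<close>

lemma kG_module_transport:
  assumes "group G" "kG_module G B" "\<And>g. g \<in> carrier G \<Longrightarrow> act A g \<in> carrier_mat (deg A) (deg A)"
    and "mor G A B D" "D' \<in> carrier_mat (deg A) (deg B)" "D' * D = 1\<^sub>m (deg A)"
  shows "kG_module G A"
proof -
  interpret group G by fact
  note d = morD(2,3)[OF assms(4)] carrier_matD[OF assms(5)]
  note K = kG_dim[OF assms(2)]
  have A: "dim_row (act A g) = deg A" "dim_col (act A g) = deg A" if "g \<in> carrier G" for g
    using assms(3)[OF that] by auto
  have e: "act A g = D' * (act B g * D)" if g: "g \<in> carrier G" for g
  proof -
    have "D' * (D * act A g) = act A g"
      using d A[OF g] by (simp add: left_inverse_mult_dim[OF assms(6)])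
    then show ?thesis unfolding morD(4)[OF assms(4) g] by simp
  qed
  show ?thesis unfolding kG_module_def
  proof (intro conjI ballI)
    have "act B \<one>\<^bsub>G\<^esub> = 1\<^sub>m (deg B)" using assms(2) by (simp add: kG_module_def)
    then show "act A \<one>\<^bsub>G\<^esub> = 1\<^sub>m (deg A)"
      unfolding e[OF one_closed] using d assms(6) by (simp add: one_mult_dim)
    fix g h assume gh: "g \<in> carrier G" "h \<in> carrier G"
    have "act A (g \<otimes>\<^bsub>G\<^esub> h) = D' * (act B g * (act B h * D))"
      unfolding e[OF m_closed[OF gh]] using assms(2) gh d K by (simp add: kG_module_def mult_assoc_dim)
    also have "\<dots> = D' * (act B g * (D * act A h))" using morD(4)[OF assms(4) gh(2)] by simp
    also have "\<dots> = D' * (act B g * D) * act A h" using gh d K A by (simp add: mult_assoc_dim)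
    finally show "act A (g \<otimes>\<^bsub>G\<^esub> h) = act A g * act A h" unfolding e[OF gh(1), symmetric] .
  qed (use assms(3) in auto)
qed

section \<open>Coset modules, induced modules and conjugate subgroups\<close>

context group
begin

lemma lcosets_finite: "finite (carrier G) \<Longrightarrow> subgroup Q G \<Longrightarrow> finite (lcosets Q)"
  by (simp add: LCOSETS_def)

lemma lcosets_act:
  assumes "subgroup Q G"
  shows "g \<in> carrier G \<Longrightarrow> C \<in> lcosets Q \<Longrightarrow> g <#\<^bsub>G\<^esub> C \<in> lcosets Q"
    "C \<in> lcosets Q \<Longrightarrow> \<one> <#\<^bsub>G\<^esub> C = C"
    "g \<in> carrier G \<Longrightarrow> h \<in> carrier G \<Longrightarrow> C \<in> lcosets Q \<Longrightarrow> (g \<otimes> h) <#\<^bsub>G\<^esub> C = g <#\<^bsub>G\<^esub> (h <#\<^bsub>G\<^esub> C)"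
  using subgroup.subset[OF assms]
  by (auto simp: LCOSETS_def lcos_m_assoc lcos_mult_one l_coset_subset_G m_assoc)

lemma coset_mod_is_perm:
  assumes "finite (carrier G)" "subgroup Q G"
  shows "is_perm G (coset_mod G Q)"
  unfolding coset_mod_def
  by (rule perm_mod_is_perm) (use lcosets_finite[OF assms] lcosets_act[OF assms(2)] in auto)

definition coset_perm :: "'a set \<Rightarrow> 'a \<Rightarrow> nat \<Rightarrow> nat" where
  "coset_perm Q g j = pos (lcosets Q) (g <#\<^bsub>G\<^esub> (enum_list (lcosets Q) ! j))"

lemma coset_mod_act:
  assumes "finite (carrier G)" "subgroup Q G" "g \<in> carrier G"
  shows "deg (coset_mod G Q) = card (lcosets Q)"
    "act (coset_mod G Q) g = sel_mat (card (lcosets Q)) (card (lcosets Q)) (coset_perm Q g)"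
  unfolding coset_mod_def coset_perm_def
  using perm_mod_act[OF lcosets_finite[OF assms(1,2)], of "\<lambda>g C. g <#\<^bsub>G\<^esub> C" g] lcosets_act(1)[OF assms(2,3)] by auto

lemma coset_perm:
  assumes "finite (carrier G)" "subgroup Q G" "g \<in> carrier G"
  shows "j < card (lcosets Q) \<Longrightarrow> coset_perm Q g j < card (lcosets Q)"
    "inj_on (coset_perm Q g) {..<card (lcosets Q)}"
proof -
  note f = lcosets_finite[OF assms(1,2)]
  show "j < card (lcosets Q) \<Longrightarrow> coset_perm Q g j < card (lcosets Q)"
    unfolding coset_perm_def by (intro pos(1) f lcosets_act(1) assms pos_nth(1))
  show "inj_on (coset_perm Q g) {..<card (lcosets Q)}"
  proof (rule inj_onI)
    fix i j assume ij: "i \<in> {..<card (lcosets Q)}" "j \<in> {..<card (lcosets Q)}" "coset_perm Q g i = coset_perm Q g j"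
    let ?C = "\<lambda>i. enum_list (lcosets Q) ! i"
    have C: "?C i \<in> lcosets Q" "?C j \<in> lcosets Q" using ij pos_nth(1)[OF f] by auto
    have e: "enum_list (lcosets Q) ! coset_perm Q g k = g <#\<^bsub>G\<^esub> ?C k" if "?C k \<in> lcosets Q" for k
      unfolding coset_perm_def by (rule pos(2)[OF f lcosets_act(1)[OF assms(2,3) that]])
    have "g <#\<^bsub>G\<^esub> ?C i = g <#\<^bsub>G\<^esub> ?C j"
      unfolding e[OF C(1), symmetric] e[OF C(2), symmetric] ij(3) ..
    moreover have "inv g <#\<^bsub>G\<^esub> (g <#\<^bsub>G\<^esub> C) = C" if "C \<in> lcosets Q" for C
      using lcosets_act(3)[OF assms(2) inv_closed[OF assms(3)] assms(3) that] lcosets_act(2)[OF assms(2) that] assms(3) by simp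
    ultimately have "?C i = ?C j" using C by metis
    then have "pos (lcosets Q) (?C i) = pos (lcosets Q) (?C j)" by simp
    then show "i = j" using pos_nth(2)[OF f] ij(1,2) by simp
  qed
qed

lemma coset_perm_transitive:
  assumes "finite (carrier G)" "subgroup Q G" "i < card (lcosets Q)" "j < card (lcosets Q)"
  shows "\<exists>g\<in>carrier G. coset_perm Q g i = j"
proof -
  note f = lcosets_finite[OF assms(1,2)] and s = subgroup.subset[OF assms(2)]
  let ?C = "\<lambda>i. enum_list (lcosets Q) ! i"
  have "?C i \<in> lcosets Q" "?C j \<in> lcosets Q" using assms pos_nth(1)[OF f] by auto
  then obtain x y where xy: "x \<in> carrier G" "?C i = x <#\<^bsub>G\<^esub> Q" "y \<in> carrier G" "?C j = y <#\<^bsub>G\<^esub> Q"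
    by (auto simp: LCOSETS_def)
  have "(y \<otimes> inv x) <#\<^bsub>G\<^esub> ?C i = ?C j"
    using xy s by (simp add: lcos_m_assoc m_assoc)
  then have "coset_perm Q (y \<otimes> inv x) i = j"
    unfolding coset_perm_def using pos_nth(2)[OF f assms(4)] by simp
  then show ?thesis using xy by blast
qed

lemma coset_reps:
  assumes "finite (carrier G)" "subgroup Q G"
  shows "length (coset_reps G Q) = card (lcosets Q)"
    "i < card (lcosets Q) \<Longrightarrow> coset_reps G Q ! i \<in> carrier G"
    "i < card (lcosets Q) \<Longrightarrow> enum_list (lcosets Q) ! i = (coset_reps G Q ! i) <#\<^bsub>G\<^esub> Q"
proof -
  note f = lcosets_finite[OF assms]
  show l: "length (coset_reps G Q) = card (lcosets Q)"
    by (simp add: coset_reps_def length_enum_list[OF f])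
  have *: "coset_reps G Q ! i \<in> carrier G \<and> enum_list (lcosets Q) ! i = (coset_reps G Q ! i) <#\<^bsub>G\<^esub> Q"
    if i: "i < card (lcosets Q)" for i
  proof -
    let ?C = "enum_list (lcosets Q) ! i"
    have "?C \<in> lcosets Q" using i pos_nth(1)[OF f] by auto
    then obtain x where x: "x \<in> carrier G" "?C = x <#\<^bsub>G\<^esub> Q" by (auto simp: LCOSETS_def)
    have "x \<in> ?C" using x lcos_self[OF x(1) assms(2)] by simp
    then have "(SOME x. x \<in> ?C) \<in> ?C" by (rule someI)
    moreover have "coset_reps G Q ! i = (SOME x. x \<in> ?C)"
      using i by (simp add: coset_reps_def length_enum_list[OF f])
    ultimately have "coset_reps G Q ! i \<in> x <#\<^bsub>G\<^esub> Q" using x by simp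
    then show ?thesis using l_repr_independence[OF _ x(1) assms(2)] l_coset_carrier[OF _ x(1) assms(2)] x(2) by metis
  qed
  show "i < card (lcosets Q) \<Longrightarrow> coset_reps G Q ! i \<in> carrier G"
    "i < card (lcosets Q) \<Longrightarrow> enum_list (lcosets Q) ! i = (coset_reps G Q ! i) <#\<^bsub>G\<^esub> Q"
    using * by auto
qed

text \<open>The element \<open>t_i\<^sup>-\<^sup>1 g t_j\<close> lies in \<open>Q\<close> exactly
  when \<open>g t_j Q = t_i Q\<close>, so the blocks of \<open>ind_mod\<close> that can be nonzero
  follow the action on cosets.\<close>

lemma coset_perm_reps:
  assumes "finite (carrier G)" "subgroup Q G" "g \<in> carrier G" "i < card (lcosets Q)" "j < card (lcosets Q)"
  shows "inv (coset_reps G Q ! i) \<otimes> g \<otimes> coset_reps G Q ! j \<in> Q \<longleftrightarrow> i = coset_perm Q g j"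
proof -
  note f = lcosets_finite[OF assms(1,2)]
  let ?t = "\<lambda>i. coset_reps G Q ! i"
  note t = coset_reps(2,3)[OF assms(1,2,4)] coset_reps(2,3)[OF assms(1,2,5)]
  interpret Q: subgroup Q G by fact
  have "inv (?t i) \<otimes> g \<otimes> ?t j \<in> Q \<longleftrightarrow> g \<otimes> ?t j \<in> ?t i <#\<^bsub>G\<^esub> Q"
  proof
    assume "inv (?t i) \<otimes> g \<otimes> ?t j \<in> Q"
    moreover have "g \<otimes> ?t j = ?t i \<otimes> (inv (?t i) \<otimes> g \<otimes> ?t j)"
      using t assms(3) by (simp add: m_assoc[symmetric])
    ultimately show "g \<otimes> ?t j \<in> ?t i <#\<^bsub>G\<^esub> Q" unfolding l_coset_def by blast
  next
    assume "g \<otimes> ?t j \<in> ?t i <#\<^bsub>G\<^esub> Q"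
    then show "inv (?t i) \<otimes> g \<otimes> ?t j \<in> Q"
      using Q.lcos_module_imp[OF is_group t(1)] t assms(3) by (simp add: m_assoc)
  qed
  also have "\<dots> \<longleftrightarrow> ?t i <#\<^bsub>G\<^esub> Q = (g \<otimes> ?t j) <#\<^bsub>G\<^esub> Q"
    using l_repr_independence[OF _ t(1) assms(2)] lcos_self[OF _ assms(2)] t assms(3) by (metis m_closed)
  also have "(g \<otimes> ?t j) <#\<^bsub>G\<^esub> Q = g <#\<^bsub>G\<^esub> enum_list (lcosets Q) ! j"
    using t assms(3) Q.subset by (simp add: lcos_m_assoc)
  also have "?t i <#\<^bsub>G\<^esub> Q = \<dots> \<longleftrightarrow> i = coset_perm Q g j"
  proof -
    have "g <#\<^bsub>G\<^esub> enum_list (lcosets Q) ! j \<in> lcosets Q"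
      by (intro lcosets_act(1) assms pos_nth(1) f)
    then show ?thesis unfolding coset_perm_def t(2)[symmetric]
      using pos[OF f] pos_nth[OF f assms(4)] by metis
  qed
  finally show ?thesis .
qed

lemma ind_mod_entries:
  assumes "finite (carrier G)" "subgroup Q G"
  defines "l \<equiv> card (lcosets Q)"
  shows "deg (ind_mod G Q N) = l * deg N"
    "dim_row (act (ind_mod G Q N) g) = l * deg N" "dim_col (act (ind_mod G Q N) g) = l * deg N"
    "g \<in> carrier G \<Longrightarrow> r < l * deg N \<Longrightarrow> c < l * deg N \<Longrightarrow> act (ind_mod G Q N) g $$ (r, c) =
      (if r div deg N = coset_perm Q g (c div deg N)
       then act N (inv (coset_reps G Q ! (r div deg N)) \<otimes> g \<otimes> coset_reps G Q ! (c div deg N)) $$ (r mod deg N, c mod deg N)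
       else 0)"
  using coset_perm_reps[OF assms(1,2)] unfolding l_def
  by (simp_all add: ind_mod_def Let_def coset_reps(1)[OF assms(1,2)] div_mod_lt)

lemma ind_mod_graded:
  fixes N :: "('a, 'k::field) rep"
  assumes "finite (carrier G)" "subgroup Q G"
  shows "graded G (ind_mod G Q N) (card (lcosets Q)) (deg N) (coset_perm Q)"
  unfolding graded_def
proof (intro conjI ballI allI impI)
  note e = ind_mod_entries[OF assms, where N = N]
  fix g r c assume g: "g \<in> carrier G" and rc: "r < card (lcosets Q) * deg N" "c < card (lcosets Q) * deg N"
    and nz: "act (ind_mod G Q N) g $$ (r, c) \<noteq> 0"
  show "r div deg N = coset_perm Q g (c div deg N)"
    using nz unfolding e(4)[OF g rc] by (auto split: if_splits)
qed (use ind_mod_entries[OF assms, where N = N] coset_perm[OF assms] in \<open>auto intro!: carrier_matI\<close>)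

lemma coset_tensor_graded:
  fixes N :: "('a, 'k::field) rep"
  assumes "finite (carrier G)" "subgroup Q G" "kG_module G N"
  shows "graded G (tensor_mod (coset_mod G Q) N) (card (lcosets Q)) (deg N) (coset_perm Q)"
proof -
  have act: "act (tensor_mod (coset_mod G Q) N) g =
      kron (sel_mat (card (lcosets Q)) (card (lcosets Q)) (coset_perm Q g)) (act N g)" if "g \<in> carrier G" for g
    unfolding act_tensor[OF is_group is_perm_kG[OF coset_mod_is_perm[OF assms(1,2)]] assms(3) that]
      coset_mod_act(2)[OF assms(1,2) that] ..
  show ?thesis unfolding graded_def
  proof (intro conjI ballI allI impI)
    fix g r c assume g: "g \<in> carrier G" and rc: "r < card (lcosets Q) * deg N" "c < card (lcosets Q) * deg N"
      and nz: "act (tensor_mod (coset_mod G Q) N) g $$ (r, c) \<noteq> 0"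
    show "r div deg N = coset_perm Q g (c div deg N)"
      using nz rc kG_dim[OF assms(3) g] unfolding act[OF g]
      by (auto simp: kron_index div_mod_lt split: if_splits)
  qed (use act kG_dim[OF assms(3)] coset_mod_act(1)[OF assms(1,2) one_closed] coset_perm[OF assms(1,2)] in \<open>auto intro!: carrier_matI\<close>)
qed

text \<open>The tensor identity: for \<open>N\<close> defined over all of \<open>G\<close>, inducing
  its restriction gives k[G/Q] \<otimes> N by
  \<open>t_i \<otimes> x \<mapsto> t_i Q \<otimes> t_i x\<close>. In coordinates this is the block
  diagonal matrix \<open>D\<close>.\<close>

lemma coset_tensor_ind:
  fixes N :: "('a, 'k::field) rep"
  assumes "finite (carrier G)" "subgroup Q G" "kG_module G N"
  shows "kG_module G (ind_mod G Q N)" "retract G (tensor_mod (coset_mod G Q) N) (ind_mod G Q N)"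
proof -
  let ?l = "card (lcosets Q)" and ?d = "deg N" and ?t = "\<lambda>i. coset_reps G Q ! i"
  let ?I = "ind_mod G Q N" and ?T = "tensor_mod (coset_mod G Q) N"
  note KC = is_perm_kG[OF coset_mod_is_perm[OF assms(1,2)]]
  note e = ind_mod_entries[OF assms(1,2), where N = N]
  note t = coset_reps(2)[OF assms(1,2)]
  interpret Q: subgroup Q G by fact
  note K = kG_dim[OF assms(3)]
  have one: "act N \<one> = 1\<^sub>m ?d" and mul: "\<And>g h. g \<in> carrier G \<Longrightarrow> h \<in> carrier G \<Longrightarrow> act N (g \<otimes> h) = act N g * act N h"
    and car: "\<And>g. g \<in> carrier G \<Longrightarrow> act N g \<in> carrier_mat ?d ?d"
    using assms(3) by (auto simp: kG_module_def)
  have dT: "deg ?T = ?l * ?d" unfolding deg_tensor coset_mod_act(1)[OF assms(1,2) one_closed] ..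
  define D where "D = bdiag ?l ?d (\<lambda>i. act N (?t i))"
  define D' where "D' = bdiag ?l ?d (\<lambda>i. act N (inv (?t i)))"
  have DD: "D * D' = 1\<^sub>m (?l * ?d)" "D' * D = 1\<^sub>m (?l * ?d)"
    unfolding D_def D'_def using t car one by (auto intro!: bdiag_inverse simp flip: mul)
  have morD: "mor G ?I ?T D" unfolding mor_def dT e(1)
  proof (intro conjI ballI)
    fix g assume g: "g \<in> carrier G"
    have act: "act ?T g = kron (sel_mat ?l ?l (coset_perm Q g)) (act N g)"
      unfolding act_tensor[OF is_group KC assms(3) g] coset_mod_act(2)[OF assms(1,2) g] ..
    show "D * act ?I g = act ?T g * D"
    proof (rule eq_matI)
      fix r c assume "r < dim_row (act ?T g * D)" "c < dim_col (act ?T g * D)"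
      then have rc: "r < ?l * ?d" "c < ?l * ?d" using act K[OF g] by (auto simp: D_def)
      note r = div_mod_lt[OF rc(1)] and c = div_mod_lt[OF rc(2)]
      let ?i = "r div ?d" and ?j = "c div ?d"
      let ?x = "inv (?t ?i) \<otimes> g \<otimes> ?t ?j"
      have x: "?x \<in> carrier G" "?t ?i \<otimes> ?x = g \<otimes> ?t ?j"
        using t[OF r(1)] t[OF c(1)] g by (simp_all add: m_assoc[symmetric])
      have lt: "?i * ?d + a < ?l * ?d" "?j * ?d + a < ?l * ?d" if "a < ?d" for a
        using r(1) c(1) that by (auto intro: mult_add_lt)
      have "(D * act ?I g) $$ (r, c) = (\<Sum>a<?d. act N (?t ?i) $$ (r mod ?d, a) * act ?I g $$ (?i * ?d + a, c))"
        unfolding D_def using rc e(2,3) by (subst bdiag_mult_index) auto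
      also have "\<dots> = (\<Sum>a<?d. if ?i = coset_perm Q g ?j then act N (?t ?i) $$ (r mod ?d, a) * act N ?x $$ (a, c mod ?d) else 0)"
        using rc lt g by (intro sum.cong refl) (simp add: e(4))
      also have "\<dots> = (if ?i = coset_perm Q g ?j then (\<Sum>a<?d. act N (?t ?i) $$ (r mod ?d, a) * act N ?x $$ (a, c mod ?d)) else 0)"
        by simp
      also have "(\<Sum>a<?d. act N (?t ?i) $$ (r mod ?d, a) * act N ?x $$ (a, c mod ?d)) = (act N (?t ?i) * act N ?x) $$ (r mod ?d, c mod ?d)"
        using K[OF t[OF r(1)]] K[OF x(1)] r c by (subst index_mult_mat_sum) auto
      also have "act N (?t ?i) * act N ?x = act N g * act N (?t ?j)"
        using mul[OF t[OF r(1)] x(1)] mul[OF g t[OF c(1)]] x(2) by simp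
      also have "(act N g * act N (?t ?j)) $$ (r mod ?d, c mod ?d) = (\<Sum>a<?d. act N g $$ (r mod ?d, a) * act N (?t ?j) $$ (a, c mod ?d))"
        using K[OF t[OF c(1)]] K[OF g] r c by (subst index_mult_mat_sum) auto
      also have "(if ?i = coset_perm Q g ?j then (\<Sum>a<?d. act N g $$ (r mod ?d, a) * act N (?t ?j) $$ (a, c mod ?d)) else 0)
        = (\<Sum>a<?d. act ?T g $$ (r, ?j * ?d + a) * act N (?t ?j) $$ (a, c mod ?d))"
        unfolding act using rc lt K[OF g] r c by (auto simp: kron_index intro!: sum.cong sum.neutral[symmetric])
      also have "\<dots> = (act ?T g * D) $$ (r, c)"
        unfolding D_def using rc act K[OF g] by (subst mult_bdiag_index) auto
      finally show "(D * act ?I g) $$ (r, c) = (act ?T g * D) $$ (r, c)" .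
    qed (use e K[OF g] act in \<open>auto simp: D_def\<close>)
  qed (auto simp: D_def intro!: carrier_matI)
  have D'c: "D' \<in> carrier_mat (deg ?I) (deg ?T)" unfolding e(1) dT by (auto simp: D'_def intro!: carrier_matI)
  note KT = kG_tensor(1)[OF is_group KC assms(3)]
  show KI: "kG_module G ?I"
    by (rule kG_module_transport[OF is_group KT _ morD D'c]) (use e DD in \<open>auto intro!: carrier_matI\<close>)
  have "iso_mod G ?I ?T"
    unfolding iso_mod_def dT e(1)
    using morD[unfolded mor_def dT e(1)] DD
    by (intro conjI bexI[of _ D]) (auto simp: invertible_mat_def inverts_mat_def square_mat.simps D_def D'_def intro!: exI[of _ D'])
  then show "retract G ?T ?I" using iso_mod_retract(2)[OF KI KT] by simp
qed

text \<open>Right multiplication by \<open>inv h\<close> takes the cosets of \<open>Q\<close> to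
  those of its conjugate, and it commutes with left multiplication.\<close>

lemma coset_mod_conj:
  assumes "finite (carrier G)" "subgroup Q G" "h \<in> carrier G"
  shows "retract G (coset_mod G Q :: ('a, 'k::field) rep) (coset_mod G (h <#\<^bsub>G\<^esub> Q #> inv h))"
proof -
  note s = subgroup.subset[OF assms(2)]
  define R where "R = h <#\<^bsub>G\<^esub> Q #> inv h"
  have sR: "subgroup R G" unfolding R_def using subgroup_conjugation_is_surj2[OF assms(3,2)] .
  have k: "(x <#\<^bsub>G\<^esub> Q) #> inv h = (x \<otimes> inv h) <#\<^bsub>G\<^esub> R" if "x \<in> carrier G" for x
  proof -
    have "(x \<otimes> inv h) <#\<^bsub>G\<^esub> R = ((x \<otimes> inv h) <#\<^bsub>G\<^esub> (h <#\<^bsub>G\<^esub> Q)) #> inv h"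
      unfolding R_def using that assms(3) s by (simp add: coset_assoc l_coset_subset_G)
    also have "(x \<otimes> inv h) <#\<^bsub>G\<^esub> (h <#\<^bsub>G\<^esub> Q) = x <#\<^bsub>G\<^esub> Q"
      using that assms(3) s by (simp add: lcos_m_assoc m_assoc)
    finally show ?thesis by simp
  qed
  show ?thesis
    unfolding coset_mod_def R_def[symmetric]
  proof (rule perm_mod_retract_bij[where h = "\<lambda>C. C #> inv h"])
    show "finite (lcosets Q)" by (rule lcosets_finite[OF assms(1,2)])
    show "g <#\<^bsub>G\<^esub> C \<in> lcosets Q" if "g \<in> carrier G" "C \<in> lcosets Q" for g C
      using lcosets_act(1)[OF assms(2) that] .
    show "g <#\<^bsub>G\<^esub> C \<in> lcosets R" if "g \<in> carrier G" "C \<in> lcosets R" for g C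
      using lcosets_act(1)[OF sR that] .
    show "bij_betw (\<lambda>C. C #> inv h) (lcosets Q) (lcosets R)"
    proof (rule bij_betw_byWitness[where f' = "\<lambda>C. C #> h"])
      show "\<forall>C\<in>lcosets Q. C #> inv h #> h = C"
        using assms(3) s by (auto simp: LCOSETS_def coset_mult_assoc l_coset_subset_G)
      show "\<forall>C\<in>lcosets R. C #> h #> inv h = C"
        using assms(3) subgroup.subset[OF sR] by (auto simp: LCOSETS_def coset_mult_assoc l_coset_subset_G)
      show "(\<lambda>C. C #> inv h) ` (lcosets Q) \<subseteq> (lcosets R)"
        using assms(3) by (force simp: LCOSETS_def k)
      show "(\<lambda>C. C #> h) ` (lcosets R) \<subseteq> (lcosets Q)"
      proof
        fix C assume "C \<in> (\<lambda>C. C #> h) ` (lcosets R)"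
        then obtain x where x: "x \<in> carrier G" "C = (x <#\<^bsub>G\<^esub> R) #> h" by (auto simp: LCOSETS_def)
        have "x <#\<^bsub>G\<^esub> R = ((x \<otimes> h) <#\<^bsub>G\<^esub> Q) #> inv h"
          using k[of "x \<otimes> h"] x(1) assms(3) by (simp add: m_assoc)
        then have "C = (x \<otimes> h) <#\<^bsub>G\<^esub> Q"
          using x assms(3) s by (simp add: coset_mult_assoc l_coset_subset_G)
        then show "C \<in> lcosets Q" using x(1) assms(3) by (auto simp: LCOSETS_def)
      qed
    qed
    show "(g <#\<^bsub>G\<^esub> C) #> inv h = g <#\<^bsub>G\<^esub> (C #> inv h)" if "g \<in> carrier G" "C \<in> lcosets Q" for g C
      using that assms(3) s by (auto simp: LCOSETS_def coset_assoc l_coset_subset_G)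
  qed
qed

text \<open>The source \<open>N\<close> is a module for \<open>Q\<close> only and cannot be the
  tensor factor; the induced module itself takes this role, being a retract of its product with
  k[G/Q]. The conjugate is there because \<open>V_non_sylow\<close> has one subgroup per conjugacy
  class, and because in general only a conjugate of \<open>Q\<close> lies in
  \<open>S\<close>.\<close>

lemma rel_projective_imp_retract:
  assumes "finite (carrier G)" "subgroup Q G" "kG_module G (M :: ('a, 'k::field) rep)" "rel_projective G Q M" "h \<in> carrier G"
  shows "\<exists>X :: ('a, 'k) rep. kG_module G X \<and> retract G M (tensor_mod (coset_mod G (h <#\<^bsub>G\<^esub> Q #> inv h)) X)"
proof -
  obtain N L :: "('a, 'k) rep" where L: "kG_module G L" and iso: "iso_mod G (ind_mod G Q N) (dsum M L)"
    using assms(4) by (auto simp: rel_projective_def summand_def)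
  let ?X = "ind_mod G Q N"
  note KD = kG_dsum[OF is_group assms(3) L]
  have car: "act ?X g \<in> carrier_mat (deg ?X) (deg ?X)" for g
    using ind_mod_entries[OF assms(1,2), where N = N] by (auto intro: carrier_matI)
  \<comment> \<open>That the induced data form a module is read off from their isomorphism with the
    module \<open>dsum M L\<close>.\<close>
  have KX: "kG_module G ?X"
  proof -
    obtain P where d: "deg ?X = deg (dsum M L)" and P: "P \<in> carrier_mat (deg ?X) (deg ?X)" "invertible_mat P"
      and PG: "\<And>g. g \<in> carrier G \<Longrightarrow> P * act ?X g = act (dsum M L) g * P"
      using iso by (auto simp: iso_mod_def)
    then obtain R where R: "P * R = 1\<^sub>m (deg ?X)" "R * P = 1\<^sub>m (dim_row R)"
      by (auto simp: invertible_mat_def inverts_mat_def)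
    have dR: "dim_row R = deg ?X" "dim_col R = deg ?X"
      using arg_cong[OF R(2), of dim_col] arg_cong[OF R(1), of dim_col] P(1) by auto
    show ?thesis
      by (rule kG_module_transport[OF is_group KD car, of P R])
        (use P PG R dR d in \<open>auto simp: mor_def intro: carrier_matI\<close>)
  qed
  let ?R = "h <#\<^bsub>G\<^esub> Q #> inv h"
  have sR: "subgroup ?R G" using subgroup_conjugation_is_surj2[OF assms(5,2)] .
  note KC = is_perm_kG[OF coset_mod_is_perm[OF assms(1,2)]] is_perm_kG[OF coset_mod_is_perm[OF assms(1) sR]]
  have 1: "retract G M ?X"
    using retract_trans[OF assms(3) KD KX retract_dsum_left[OF assms(3) L]] iso_mod_retract(2)[OF KX KD iso] by simp
  have 2: "retract G ?X (tensor_mod (coset_mod G Q) ?X)"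
    by (rule graded_retract[OF is_group ind_mod_graded[OF assms(1,2)] KC(1) KX])
      (use coset_mod_act[OF assms(1,2)] in auto)
  have 3: "retract G (tensor_mod (coset_mod G Q) ?X) (tensor_mod (coset_mod G ?R) ?X)"
    by (rule retract_tensor[OF is_group KC(1) KX KC(2) KX coset_mod_conj[OF assms(1,2,5)] retract_refl[OF KX]])
  have "retract G M (tensor_mod (coset_mod G ?R) ?X)"
    using retract_trans[OF assms(3) KX kG_tensor(1)[OF is_group KC(2) KX] 1]
      retract_trans[OF KX kG_tensor(1)[OF is_group KC(1) KX] kG_tensor(1)[OF is_group KC(2) KX] 2 3] by blast
  then show ?thesis using KX by blast
qed

text \<open>By the tensor identity, the restriction of \<open>X\<close> to \<open>Q\<close> is a
  source from which \<open>M\<close> is induced up to a summand.\<close>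

lemma retract_imp_rel_projective:
  assumes "finite (carrier G)" "subgroup Q G" "kG_module G M" "kG_module G X" "retract G M (tensor_mod (coset_mod G Q) X)"
  shows "rel_projective G Q M"
proof -
  note KC = is_perm_kG[OF coset_mod_is_perm[OF assms(1,2)]]
  note I = coset_tensor_ind[OF assms(1,2,4)]
  have "summand G M (ind_mod G Q X)"
    using summand_iff_retract[OF is_group I(1)] assms(3)
      retract_trans[OF assms(3) kG_tensor(1)[OF is_group KC assms(4)] I(1) assms(5) I(2)] by blast
  moreover have "kG_module (G\<lparr>carrier := Q\<rparr>) X"
    using assms(4) subgroup.subset[OF assms(2)] by (auto simp: kG_module_def)
  ultimately show ?thesis unfolding rel_projective_def by blast
qed

end

section \<open>Fitting's lemma\<close>

lemma pow_mat_add: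
  assumes "A \<in> carrier_mat n n"
  shows "A ^\<^sub>m (j + k) = A ^\<^sub>m j * (A ^\<^sub>m k :: 'a::semiring_1 mat)"
proof (induction k)
  case (Suc k)
  then show ?case using assms by (simp add: mult_assoc_dim pow_mat_dim_square)
qed (use assms in \<open>simp add: pow_mat_dim_square mult_one_dim\<close>)

lemma commute_pow_mat:
  assumes "A \<in> carrier_mat n n" "x \<in> carrier_mat n n" "x * A = A * x"
  shows "x * A ^\<^sub>m k = A ^\<^sub>m k * (x :: 'a::semiring_1 mat)"
proof (induction k)
  case (Suc k)
  note d = assms(1,2)[THEN carrier_matD(1)] assms(1,2)[THEN carrier_matD(2)] pow_mat_dim_square[OF assms(1)]
  have "x * A ^\<^sub>m Suc k = (x * A ^\<^sub>m k) * A" using d by (simp add: mult_assoc_dim)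
  also have "\<dots> = A ^\<^sub>m k * (x * A)" unfolding Suc using d by (simp add: mult_assoc_dim)
  also have "\<dots> = A ^\<^sub>m Suc k * x" unfolding assms(3) using d by (simp add: mult_assoc_dim)
  finally show ?case .
qed (use assms in simp)

text \<open>Fitting's decomposition without kernels and images. Among the positive powers of
  \<open>f\<close>, take a factorization \<open>F = a * b\<close> of least inner dimension. Then
  \<open>b * a\<close> is invertible, since otherwise the square of \<open>F\<close> would factor
  through a smaller dimension. The idempotent built from it commutes with whatever commutes with
  \<open>f\<close>, in particular with the group action.\<close>

lemma fitting_mat:
  fixes f :: "'a::field mat"
  assumes f: "f \<in> carrier_mat n n"
  obtains e m w where "e \<in> carrier_mat n n" "w \<in> carrier_mat n n" "e * e = e"
    "\<And>x. x \<in> carrier_mat n n \<Longrightarrow> x * f = f * x \<Longrightarrow> x * e = e * x"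
    "f ^\<^sub>m Suc m = f ^\<^sub>m Suc m * e" "e = f ^\<^sub>m Suc m * w"
proof -
  define P where "P r \<longleftrightarrow> (\<exists>m. \<exists>a\<in>carrier_mat n r. \<exists>b\<in>carrier_mat r n. f ^\<^sub>m Suc m = a * b)" for r
  have "P n" unfolding P_def
  proof (rule exI, rule bex2I)
    show "f ^\<^sub>m Suc 0 = f * 1\<^sub>m n" using f by simp
  qed (use f in auto)
  define r where "r = (LEAST r. P r)"
  have "P r" unfolding r_def using \<open>P n\<close> by (rule LeastI)
  then obtain m a b where a: "a \<in> carrier_mat n r" and b: "b \<in> carrier_mat r n" and ab: "f ^\<^sub>m Suc m = a * b"
    by (auto simp: P_def)
  define F where "F = f ^\<^sub>m Suc m"
  have d: "dim_row a = n" "dim_col a = r" "dim_row b = r" "dim_col b = n" using a b by auto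
  define s where "s = b * a"
  have s: "s \<in> carrier_mat r r" using a b by (simp add: s_def)
  have "\<exists>t\<in>carrier_mat r r. s * t = 1\<^sub>m r"
  proof (rule ccontr)
    assume "\<not> ?thesis"
    from singular_mat_factor[OF s this] obtain u w where r: "r > 0"
      and u: "u \<in> carrier_mat r (r - 1)" and w: "w \<in> carrier_mat (r - 1) r" and suw: "s * (u * w) = s"
      by auto
    have dd: "dim_row s = r" "dim_col s = r" "dim_row u = r" "dim_col u = r - 1" "dim_row w = r - 1" "dim_col w = r"
      using s u w by auto
    have "f ^\<^sub>m (Suc m + Suc m) = a * b * (a * b)" unfolding pow_mat_add[OF f, of "Suc m" "Suc m"] ab ..
    also have "\<dots> = a * (s * b)" unfolding s_def using d by (simp add: mult_assoc_dim)
    also have "s * b = s * (u * w) * b" unfolding suw ..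
    also have "a * (s * (u * w) * b) = a * s * u * (w * b)" using d dd by (simp add: mult_assoc_dim)
    finally have "f ^\<^sub>m Suc (m + Suc m) = a * s * u * (w * b)" by simp
    then have "\<exists>a\<in>carrier_mat n (r - 1). \<exists>b\<in>carrier_mat (r - 1) n. f ^\<^sub>m Suc (m + Suc m) = a * b"
      by (rule bex2I[rotated 2]) (use a s u w b in auto)
    then have "P (r - 1)" unfolding P_def by (rule exI)
    then show False using not_less_Least[of "r - 1" P] r by (simp add: r_def)
  qed
  then obtain t where t: "t \<in> carrier_mat r r" "s * t = 1\<^sub>m r" by blast
  then have ts: "t * s = 1\<^sub>m r" using mat_mult_left_right_inverse[OF s] by simp
  have ds: "dim_row s = r" "dim_col s = r" "dim_row t = r" "dim_col t = r" using s t by auto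
  have Fab: "F = a * b" using ab by (simp add: F_def)
  have dF: "dim_row F = n" "dim_col F = n" using d Fab by auto
  have Fa: "F * a = a * s" and bF: "b * F = s * b" unfolding Fab s_def using d by (simp_all add: mult_assoc_dim)
  have at: "a = F * (a * t)"
  proof -
    have "F * (a * t) = F * a * t" using d ds dF by (simp add: mult_assoc_dim)
    also have "\<dots> = a" unfolding Fa using d ds by (simp add: mult_assoc_dim t(2) mult_one_dim)
    finally show ?thesis by simp
  qed
  have tb: "b = t * (b * F)" unfolding bF using d ds by (simp add: left_inverse_mult_dim[OF ts])
  \<comment> \<open>With \<open>t\<close> the inverse of \<open>b * a\<close>, the matrix
    \<open>a * t * b\<close> is the projection onto the image of \<open>F\<close> along its kernel,
    and \<open>a * t * t * b\<close> inverts \<open>F\<close> on this image.\<close>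
  define e where "e = a * (t * b)"
  define w where "w = a * (t * (t * b))"
  have e: "e \<in> carrier_mat n n" and w: "w \<in> carrier_mat n n" using a b t by (auto simp: e_def w_def)
  have ba: "b * (a * X) = s * X" if "dim_row X = r" for X unfolding s_def using d that by (simp add: mult_assoc_dim)
  have ee: "e * e = e"
    unfolding e_def using d ds ba by (simp add: mult_assoc_dim left_inverse_mult_dim[OF t(2)])
  have comm: "x * e = e * x" if x: "x \<in> carrier_mat n n" and xf: "x * f = f * x" for x
  proof -
    have dx: "dim_row x = n" "dim_col x = n" using x by auto
    have xF: "x * F = F * x" unfolding F_def by (rule commute_pow_mat[OF f x xf])
    \<comment> \<open>The compression of \<open>x\<close> to the inner dimension. It commutes with
      \<open>s\<close> because \<open>x\<close> commutes with \<open>F\<close>, hence also with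
      \<open>t\<close>.\<close>
    define y where "y = b * (x * a)"
    have dy: "dim_row y = r" "dim_col y = r" using d dx by (auto simp: y_def)
    have "y * s = b * (x * (F * a))" unfolding y_def Fa using d dx ds by (simp add: mult_assoc_dim)
    also have "\<dots> = b * ((x * F) * a)" using d dx dF by (simp add: mult_assoc_dim)
    also have "\<dots> = (b * F) * (x * a)" unfolding xF using d dx dF by (simp add: mult_assoc_dim)
    also have "\<dots> = s * y" unfolding bF y_def using d dx ds by (simp add: mult_assoc_dim)
    finally have ys: "y * s = s * y" .
    have "t * (y * s) * t = t * (s * y) * t" unfolding ys ..
    then have ty: "t * y = y * t"
      using ds dy by (simp add: mult_assoc_dim left_inverse_mult_dim[OF ts] t(2) mult_one_dim)
    have "x * e = x * ((F * (a * t)) * (t * b))" unfolding e_def at[symmetric] ..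
    also have "\<dots> = (x * F) * (a * (t * (t * b)))" using d ds dx dF by (simp add: mult_assoc_dim)
    also have "\<dots> = a * (y * t * (t * b))" unfolding xF unfolding Fab y_def using d ds dx by (simp add: mult_assoc_dim)
    also have "\<dots> = a * (t * y * (t * b))" unfolding ty ..
    also have "\<dots> = a * (t * (y * t * b))" using d ds dy by (simp add: mult_assoc_dim)
    also have "\<dots> = a * (t * (t * y * b))" unfolding ty ..
    also have "\<dots> = a * (t * (t * (b * (x * F))))" unfolding Fab y_def using d ds dx by (simp add: mult_assoc_dim)
    also have "\<dots> = a * (t * (t * (b * F) * x))" unfolding xF using d ds dx dF by (simp add: mult_assoc_dim)
    also have "\<dots> = e * x" unfolding tb[symmetric] e_def using d ds dx by (simp add: mult_assoc_dim)
    finally show ?thesis .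
  qed
  have Fe: "F * e = F" unfolding Fab e_def using d ds ba by (simp add: mult_assoc_dim left_inverse_mult_dim[OF t(2)])
  have Fw: "F * w = e"
  proof -
    have "F * w = (F * (a * t)) * (t * b)" unfolding w_def using d ds dF by (simp add: mult_assoc_dim)
    then show ?thesis unfolding at[symmetric] e_def .
  qed
  show ?thesis
  proof (rule that[OF e w ee comm])
    show "f ^\<^sub>m Suc m = f ^\<^sub>m Suc m * e" using Fe unfolding F_def by (rule sym)
    show "e = f ^\<^sub>m Suc m * w" using Fw unfolding F_def by (rule sym)
  qed
qed

lemma mult_inner_zero:
  fixes A B :: "'a::semiring_0 mat"
  assumes "A \<in> carrier_mat m 0" "B \<in> carrier_mat 0 n"
  shows "A * B = 0\<^sub>m m n"
  using assms by (intro eq_matI) (auto simp: scalar_prod_def)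

lemma mor_inverse:
  assumes "kG_module G M" "kG_module G N" "mor G M N f" "h \<in> carrier_mat (deg M) (deg N)"
    "h * f = 1\<^sub>m (deg M)" "f * h = 1\<^sub>m (deg N)"
  shows "mor G N M h"
  unfolding mor_def
proof (intro conjI ballI)
  fix g assume g: "g \<in> carrier G"
  note d = kG_dim[OF assms(1) g] kG_dim[OF assms(2) g] morD(2,3)[OF assms(3)] carrier_matD[OF assms(4)]
  have "h * (f * act M g) * h = h * (act N g * f) * h" using morD(4)[OF assms(3) g] by simp
  then show "h * act N g = act M g * h"
    using d assms(5,6) left_inverse_mult_dim[OF assms(5)] by (simp add: mult_assoc_dim mult_one_dim)
qed (rule assms)

text \<open>The Fitting idempotent of \<open>f\<close> is equivariant and splits \<open>M\<close>.
  Indecomposability makes it 0, and then a power of \<open>f\<close> vanishes, or 1, and then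
  \<open>f\<close> is invertible. Locality of the endomorphism ring is used in this form.\<close>

lemma indecomposable_endomorphism:
  assumes "group G" "indecomposable G (M :: ('g, 'k::field) rep)" "mor G M M f"
  shows "(\<exists>m. f ^\<^sub>m m = 0\<^sub>m (deg M) (deg M)) \<or> (\<exists>h. mor G M M h \<and> h * f = 1\<^sub>m (deg M) \<and> f * h = 1\<^sub>m (deg M))"
proof -
  let ?n = "deg M"
  have K: "kG_module G M" using assms(2) by (simp add: indecomposable_def)
  note f = morD(1)[OF assms(3)]
  obtain e m w where e: "e \<in> carrier_mat ?n ?n" "w \<in> carrier_mat ?n ?n" "e * e = e"
    "\<And>x. x \<in> carrier_mat ?n ?n \<Longrightarrow> x * f = f * x \<Longrightarrow> x * e = e * x"
    "f ^\<^sub>m Suc m = f ^\<^sub>m Suc m * e" "e = f ^\<^sub>m Suc m * w"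
    by (rule fitting_mat[OF f], rule that)
  have em: "mor G M M e" unfolding mor_def
  proof (intro conjI ballI)
    fix g assume g: "g \<in> carrier G"
    have "act M g * e = e * act M g"
      by (rule e(4)) (use K g morD(4)[OF assms(3) g] in \<open>auto simp: kG_module_def\<close>)
    then show "e * act M g = act M g * e" by simp
  qed (rule e(1))
  obtain A u v where A: "kG_module G A" "mor G A M u" "mor G M A v" "e = u * v" "v * u = 1\<^sub>m (deg A)"
    by (rule split_endomorphism[OF assms(1) K em e(3)], rule that)
  obtain B u' v' where B: "kG_module G B" "mor G B M u'" "mor G M B v'" "u * v + u' * v' = 1\<^sub>m ?n"
     "iso_mod G M (dsum A B)"
    by (rule complement_decomposition[OF assms(1) K A(1,2,3,5)], rule that)
  have "deg A = 0 \<or> deg B = 0" using assms(2) A(1) B(1,5) by (auto simp: indecomposable_def)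
  then show ?thesis
  proof
    assume "deg A = 0"
    then have "e = 0\<^sub>m ?n ?n" unfolding A(4) using morD(1)[OF A(2)] morD(1)[OF A(3)] by (intro mult_inner_zero) auto
    then have "f ^\<^sub>m Suc m = 0\<^sub>m ?n ?n"
      using e(5) f by (simp add: mult_zero_dim pow_mat_dim_square)
    then show ?thesis by blast
  next
    assume "deg B = 0"
    then have "u' * v' = 0\<^sub>m ?n ?n" using morD(1)[OF B(2)] morD(1)[OF B(3)] by (intro mult_inner_zero) auto
    then have "e = 1\<^sub>m ?n" using B(4) e(1) unfolding A(4)[symmetric] by (simp add: add_zero_dim)
    then have "f * (f ^\<^sub>m m * w) = 1\<^sub>m ?n"
      using e(6) pow_mat_comm[OF f, of m] f e(2) mult_assoc_dim[of f "f ^\<^sub>m m" w] by (simp add: pow_mat_dim_square)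
    moreover have h: "f ^\<^sub>m m * w \<in> carrier_mat ?n ?n" using f e(2) by auto
    ultimately have "f * (f ^\<^sub>m m * w) = 1\<^sub>m ?n" "f ^\<^sub>m m * w * f = 1\<^sub>m ?n"
      using mat_mult_left_right_inverse[OF f h] by auto
    then show ?thesis using mor_inverse[OF K K assms(3) h] by blast
  qed
qed

lemma one_mat_neq_zero: "n > 0 \<Longrightarrow> (1\<^sub>m n :: 'a::zero_neq_one mat) \<noteq> 0\<^sub>m n n"
proof
  assume "n > 0" "(1\<^sub>m n :: 'a mat) = 0\<^sub>m n n"
  then have "(1\<^sub>m n :: 'a mat) $$ (0, 0) = 0\<^sub>m n n $$ (0, 0)" by simp
  then show False using \<open>n > 0\<close> by simp
qed

text \<open>If \<open>F\<close> is the last nonzero power of \<open>f\<close>, then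
  \<open>F * f = 0\<close> and \<open>f + h = 1\<close> give \<open>F * h = F\<close>, so no power
  of \<open>h\<close> kills \<open>F\<close>.\<close>

lemma nilpotent_complement:
  fixes f h :: "'a::field mat"
  assumes n: "n > 0" and c: "f \<in> carrier_mat n n" "h \<in> carrier_mat n n" "f + h = 1\<^sub>m n"
    and nil: "f ^\<^sub>m j = 0\<^sub>m n n" "h ^\<^sub>m k = 0\<^sub>m n n"
  shows False
proof -
  define m where "m = (LEAST j. f ^\<^sub>m j = 0\<^sub>m n n)"
  have m: "f ^\<^sub>m m = 0\<^sub>m n n" unfolding m_def by (rule LeastI[of "\<lambda>j. f ^\<^sub>m j = 0\<^sub>m n n", OF nil(1)])
  have "m \<noteq> 0" using m one_mat_neq_zero[OF n] c(1) by (metis carrier_matD(1) pow_mat.simps(1))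
  then obtain l where l: "m = Suc l" by (cases m) auto
  define F where "F = f ^\<^sub>m l"
  have F: "F \<noteq> 0\<^sub>m n n"
    unfolding F_def using not_less_Least[of l "\<lambda>j. f ^\<^sub>m j = 0\<^sub>m n n"] l unfolding m_def by auto
  have d: "dim_row F = n" "dim_col F = n" "dim_row f = n" "dim_col f = n" "dim_row h = n" "dim_col h = n"
    using c pow_mat_dim_square[OF c(1)] by (auto simp: F_def)
  have Ff: "F * f = 0\<^sub>m n n" using m l by (simp add: F_def)
  have "F * (f + h) = F" unfolding c(3) using d by (simp add: mult_one_dim)
  then have Fh: "F * h = F" using d Ff by (simp add: mult_add_dim zero_add_dim)
  have "F * h ^\<^sub>m k = F" for k
  proof (induction k)
    case (Suc k)
    have "F * h ^\<^sub>m Suc k = (F * h ^\<^sub>m k) * h" using d c(2) by (simp add: mult_assoc_dim pow_mat_dim_square[OF c(2)])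
    then show ?case unfolding Suc Fh .
  qed (use d in \<open>simp add: mult_one_dim\<close>)
  from this[of k] have "F = 0\<^sub>m n n" unfolding nil(2) using d by (simp add: mult_zero_dim)
  then show False using F by simp
qed

text \<open>The identity is the sum of an endomorphism through \<open>A\<close> and one through
  \<open>B\<close>. They are not both nilpotent, so one is invertible, and composing with its
  inverse gives the retraction.\<close>

lemma indecomposable_retract_dsum:
  assumes "group G" "indecomposable G (M :: ('g, 'k::field) rep)" "kG_module G A" "kG_module G B" "retract G M (dsum A B)"
  shows "retract G M A \<or> retract G M B"
proof -
  have K: "kG_module G M" and n: "deg M > 0" using assms(2) by (auto simp: indecomposable_def)
  obtain a1 b1 a2 b2 where *: "mor G A M a1" "mor G M A b1" "mor G B M a2" "mor G M B b2"
    "a1 * b1 + a2 * b2 = 1\<^sub>m (deg M)"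
    by (rule retract_dsumE[OF assms(1) K assms(3-5)], rule that)
  have m: "mor G M M (a1 * b1)" "mor G M M (a2 * b2)"
    using mor_comp[OF K assms(3) K *(2,1)] mor_comp[OF K assms(4) K *(4,3)] .
  have key: "retract G M X" if X: "kG_module G X" "mor G X M a" "mor G M X b" "mor G M M h" "h * (a * b) = 1\<^sub>m (deg M)"
    for X a b h
  proof (rule retractI[OF X(3) mor_comp[OF X(1) K K X(2,4)]])
    show "h * a * b = 1\<^sub>m (deg M)"
      using X(5) morD(2,3)[OF X(2)] morD(2,3)[OF X(3)] morD(2,3)[OF X(4)] by (simp add: mult_assoc_dim)
  qed
  show ?thesis
    using indecomposable_endomorphism[OF assms(1,2) m(1)] indecomposable_endomorphism[OF assms(1,2) m(2)]
      nilpotent_complement[OF n morD(1)[OF m(1)] morD(1)[OF m(2)] *(5)]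
      key[OF assms(3) *(1,2)] key[OF assms(4) *(3,4)] by blast
qed

lemma indecomposable_retract_iso:
  assumes "group G" "indecomposable G M" "indecomposable G N" "retract G M N"
  shows "iso_mod G (M :: ('g, 'k::field) rep) N"
proof -
  have K: "kG_module G M" "kG_module G N" "deg M \<noteq> 0" using assms by (auto simp: indecomposable_def)
  obtain i q where *: "mor G M N i" "mor G N M q" "q * i = 1\<^sub>m (deg M)"
    using assms(4) by (auto simp: retract_def)
  obtain B u v where B: "kG_module G B" "mor G B N u" "mor G N B v" "i * q + u * v = 1\<^sub>m (deg N)" "iso_mod G N (dsum M B)"
    by (rule complement_decomposition[OF assms(1) K(2,1) *], rule that)
  have "deg M = 0 \<or> deg B = 0" using assms(3) B(1,5) K(1) by (auto simp: indecomposable_def)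
  then have "deg B = 0" using K(3) by simp
  then have "u * v = 0\<^sub>m (deg N) (deg N)" using morD(1)[OF B(2)] morD(1)[OF B(3)] by (intro mult_inner_zero) auto
  then have "i * q = 1\<^sub>m (deg N)" using B(4) morD(2,3)[OF *(1)] morD(2,3)[OF *(2)] by (simp add: add_zero_dim)
  with * show ?thesis unfolding iso_mod_iff[OF K(1,2)] by (intro exI conjI)
qed

section \<open>Modules projective relative to the non-Sylow subgroups\<close>

lemma retract_deg_zero:
  fixes M X :: "('g, 'k::field) rep"
  assumes "kG_module G M" "kG_module G X" "deg M = 0"
  shows "retract G M X"
proof (rule retractI[OF mor_zero[OF assms(1,2)] mor_zero[OF assms(2,1)]])
  show "0\<^sub>m (deg M) (deg X) * 0\<^sub>m (deg X) (deg M) = (1\<^sub>m (deg M) :: 'k mat)"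
    using assms(3) by (intro eq_matI) auto
qed

lemma mor_triv: "A \<in> carrier_mat m n \<Longrightarrow> mor G (triv_mod n) (triv_mod m) A"
  by (auto simp: mor_def mult_one_dim one_mult_dim)

lemma kG_dsum_list:
  assumes "group G" "\<And>M. M \<in> set Ms \<Longrightarrow> kG_module G M"
  shows "kG_module G (dsum_list Ms)"
  using assms(2) by (induction Ms) (auto simp: dsum_list_def kG_triv kG_dsum[OF assms(1)])

lemma retract_dsum_list:
  assumes "group G" "\<And>M. M \<in> set Ms \<Longrightarrow> kG_module G M" "M \<in> set Ms"
  shows "retract G M (dsum_list Ms)"
  using assms(2,3)
proof (induction Ms)
  case (Cons X Ms)
  have K: "kG_module G X" "kG_module G (dsum_list Ms)" "kG_module G M"
    using Cons.prems kG_dsum_list[OF assms(1), of Ms] by auto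
  have e: "dsum_list (X # Ms) = dsum X (dsum_list Ms)" by (simp add: dsum_list_def)
  show ?case
  proof (cases "M = X")
    case True
    then show ?thesis unfolding e using retract_dsum_left[OF K(1,2)] by simp
  next
    case False
    then have "retract G M (dsum_list Ms)" using Cons by auto
    then show ?thesis unfolding e
      using retract_trans[OF K(3,2) kG_dsum[OF assms(1) K(1,2)]] retract_dsum_right[OF K(1,2)] by blast
  qed
qed simp

lemma indecomposable_retract_dsum_list:
  assumes "group G" "indecomposable G M" "\<And>X. X \<in> set Ms \<Longrightarrow> kG_module G X" "kG_module G N"
    and "retract G M (tensor_mod (dsum_list Ms) N)"
  shows "\<exists>X\<in>set Ms. retract G M (tensor_mod X N)"
  using assms(3,5)
proof (induction Ms)
  case Nil
  then obtain i q where iq: "mor G M (tensor_mod (triv_mod 0) N) i" "mor G (tensor_mod (triv_mod 0) N) M q" "q * i = 1\<^sub>m (deg M)"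
    by (auto simp: retract_def dsum_list_def)
  then have "deg M \<le> 0" using morD(1)[OF iq(1)] morD(1)[OF iq(2)] by (intro right_inverse_dim_le[OF _ _ iq(3)]) auto
  then show ?case using assms(2) by (simp add: indecomposable_def)
next
  case (Cons X Ms)
  have K: "kG_module G X" "kG_module G (dsum_list Ms)" "kG_module G M"
    using Cons.prems kG_dsum_list[OF assms(1), of Ms] assms(2) by (auto simp: indecomposable_def)
  have e: "dsum_list (X # Ms) = dsum X (dsum_list Ms)" by (simp add: dsum_list_def)
  note KT = kG_tensor(1)[OF assms(1) K(1) assms(4)] kG_tensor(1)[OF assms(1) K(2) assms(4)]
  have "retract G M (dsum (tensor_mod X N) (tensor_mod (dsum_list Ms) N))"
    using retract_trans[OF K(3) kG_tensor(1)[OF assms(1) kG_dsum[OF assms(1) K(1,2)] assms(4)] kG_dsum[OF assms(1) KT]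
      Cons.prems(2)[unfolded e] retract_tensor_dsum_left[OF assms(1) K(1,2) assms(4)]] .
  then have "retract G M (tensor_mod X N) \<or> retract G M (tensor_mod (dsum_list Ms) N)"
    by (rule indecomposable_retract_dsum[OF assms(1,2) KT])
  then show ?case using Cons by auto
qed

text \<open>The composites are scalars, so over a field this says that k is not a retract of
  \<open>X\<close>. In the form of vanishing composites it passes to direct sums by adding
  up.\<close>

definition no_triv_through :: "('g, 'b) monoid_scheme \<Rightarrow> ('g, 'k::field) rep \<Rightarrow> bool" where
  "no_triv_through G X \<longleftrightarrow> (\<forall>a b. mor G (triv_mod 1) X a \<longrightarrow> mor G X (triv_mod 1) b \<longrightarrow> b * a = 0\<^sub>m 1 1)"

lemma no_triv_through_retract:
  assumes "no_triv_through G Y" "kG_module G X" "kG_module G Y" "retract G X Y"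
  shows "no_triv_through G X"
  unfolding no_triv_through_def
proof (intro allI impI)
  fix a b assume ab: "mor G (triv_mod 1) X a" "mor G X (triv_mod 1) b"
  obtain i q where iq: "mor G X Y i" "mor G Y X q" "q * i = 1\<^sub>m (deg X)" using assms(4) by (auto simp: retract_def)
  have "(b * q) * (i * a) = 0\<^sub>m 1 1"
    using assms(1) mor_comp[OF kG_triv assms(2,3) ab(1) iq(1)] mor_comp[OF assms(3,2) kG_triv iq(2) ab(2)]
    unfolding no_triv_through_def by blast
  then show "b * a = 0\<^sub>m 1 1"
    using morD(2,3)[OF ab(1)] morD(2,3)[OF ab(2)] morD(2,3)[OF iq(1)] morD(2,3)[OF iq(2)]
    by (simp add: mult_assoc_dim left_inverse_mult_dim[OF iq(3)])
qed

lemma no_triv_through_dsum: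
  assumes "no_triv_through G X" "no_triv_through G Y" "kG_module G X" "kG_module G Y" "group G"
  shows "no_triv_through G (dsum X Y)"
  unfolding no_triv_through_def
proof (intro allI impI)
  fix a b assume ab: "mor G (triv_mod 1) (dsum X Y) a" "mor G (dsum X Y) (triv_mod 1) b"
  let ?m = "deg X" and ?n = "deg Y"
  note K = kG_dsum[OF assms(5,3,4)]
  note m = mor_biprod[OF assms(3,4)]
  note d = morD(2,3)[OF ab(1), unfolded dsum_simps(1)] morD(2,3)[OF ab(2), unfolded dsum_simps(1)]
  have z1: "(b * in1 ?m ?n) * (pr1 ?m ?n * a) = 0\<^sub>m 1 1"
    using assms(1) mor_comp[OF assms(3) K kG_triv m(1) ab(2)] mor_comp[OF kG_triv K assms(3) ab(1) m(3)]
    unfolding no_triv_through_def by blast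
  have z2: "(b * in2 ?m ?n) * (pr2 ?m ?n * a) = 0\<^sub>m 1 1"
    using assms(2) mor_comp[OF assms(4) K kG_triv m(2) ab(2)] mor_comp[OF kG_triv K assms(4) ab(1) m(4)]
    unfolding no_triv_through_def by blast
  have "b * a = b * ((in1 ?m ?n * pr1 ?m ?n + in2 ?m ?n * pr2 ?m ?n) * a)"
    unfolding biprod_sum using d by (simp add: one_mult_dim)
  also have "\<dots> = (b * in1 ?m ?n) * (pr1 ?m ?n * a) + (b * in2 ?m ?n) * (pr2 ?m ?n * a)"
    using d by (simp add: mat_dim_simps)
  finally show "b * a = 0\<^sub>m 1 1" unfolding z1 z2 by simp
qed

text \<open>Entry \<open>(i, j)\<close> of \<open>b * a\<close> is a composite k \<rightarrow> k^n
  \<rightarrow> X \<rightarrow> k^m \<rightarrow> k that begins with a basis vector and ends with a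
  coordinate.\<close>

lemma no_triv_throughD:
  fixes X :: "('g, 'k::field) rep"
  assumes "no_triv_through G X" "kG_module G X" "mor G (triv_mod n) X a" "mor G X (triv_mod m) b"
  shows "b * a = 0\<^sub>m m n"
proof (rule eq_matI)
  note d = morD(2,3)[OF assms(3)] morD(2,3)[OF assms(4)]
  fix i j assume "i < dim_row (0\<^sub>m m n :: 'k mat)" "j < dim_col (0\<^sub>m m n :: 'k mat)"
  then have ij: "i < m" "j < n" by auto
  let ?r = "transpose_mat (sel_mat m 1 (\<lambda>_. i)) :: 'k mat" and ?c = "sel_mat n 1 (\<lambda>_. j) :: 'k mat"
  have r: "mor G (triv_mod m) (triv_mod 1) ?r" by (rule mor_triv) (auto intro: carrier_matI)
  have c: "mor G (triv_mod 1) (triv_mod n) ?c" by (rule mor_triv) (auto intro: carrier_matI)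
  have z: "(?r * b) * (a * ?c) = 0\<^sub>m 1 1"
    using assms(1) mor_comp[OF kG_triv kG_triv assms(2) c assms(3)] mor_comp[OF assms(2) kG_triv kG_triv assms(4) r]
    unfolding no_triv_through_def by blast
  have "(b * a) $$ (i, j) = (b * a * ?c) $$ (i, 0)"
    using d ij by (subst mult_sel_index) auto
  also have "\<dots> = (?r * (b * a * ?c)) $$ (0, 0)"
    using d ij by (subst transpose_sel_mult_index) auto
  also have "?r * (b * a * ?c) = (?r * b) * (a * ?c)" using d by (simp add: mult_assoc_dim)
  finally show "(b * a) $$ (i, j) = 0\<^sub>m m n $$ (i, j)" unfolding z using ij by simp
qed (use morD(2,3)[OF assms(3)] morD(2,3)[OF assms(4)] in auto)

lemma retract_triv_zero_dsum:
  fixes W :: "('g, 'k::field) rep"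
  assumes "group G" "kG_module G W"
  shows "retract G (dsum (triv_mod 0) W) W"
proof (rule retractI)
  note m = mor_biprod[OF kG_triv assms(2), of 0]
  show "mor G (dsum (triv_mod 0) W) W (pr2 0 (deg W))" "mor G W (dsum (triv_mod 0) W) (in2 0 (deg W))" using m by auto
  have "in1 0 (deg W) * pr1 0 (deg W) = (0\<^sub>m (deg W) (deg W) :: 'k mat)"
    by (rule mult_inner_zero) (auto intro: carrier_matI)
  then have "in2 0 (deg W) * pr2 0 (deg W) = (1\<^sub>m (deg W) :: 'k mat)"
    using biprod_sum[of 0 "deg W", where 'a = 'k] zero_add_dim[of "in2 0 (deg W) * pr2 0 (deg W) :: 'k mat" "deg W" "deg W"]
    by simp
  then show "in2 0 (deg W) * pr2 0 (deg W) = (1\<^sub>m (deg (dsum (triv_mod 0) W)) :: 'k mat)" by (simp add: dsum_simps(1))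
qed

lemma retract_triv_le:
  assumes "m \<le> n"
  shows "retract G (triv_mod m :: ('g, 'k::field) rep) (triv_mod n)"
proof (rule retractI[OF mor_triv mor_triv])
  show "transpose_mat (sel_mat n m (\<lambda>j. j)) * sel_mat n m (\<lambda>j. j) = (1\<^sub>m (deg (triv_mod m :: ('g, 'k) rep)) :: 'k mat)"
    using assms by (simp add: transpose_sel_mult_self inj_on_def)
qed (auto intro: carrier_matI)

section \<open>Sylow and non-Sylow subgroups\<close>

locale sylow_rep = group G for G (structure) +
  fixes p :: nat and S :: "'a set" and K :: "'k::alg_closed_field itself"
  assumes fin: "finite (carrier G)" and prime: "prime p" and char_p: "CHAR('k) = p"
    and sylow: "sylow_subgroup G p S"
begin

abbreviation non_syl :: "'a set set" where "non_syl \<equiv> non_sylow G p"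

lemma order_pos: "Coset.order G > 0"
  using fin one_closed by (auto simp: Coset.order_def card_gt_0_iff)

lemma p_not_unit: "\<not> is_unit p"
  using prime by auto

lemma non_sylowD:
  assumes "Q \<in> non_syl"
  shows "subgroup Q G" "\<exists>n. card Q = p ^ n \<and> n < multiplicity p (Coset.order G)"
proof -
  obtain n where Q: "subgroup Q G" "card Q = p ^ n" "\<not> sylow_subgroup G p Q"
    using assms by (auto simp: non_sylow_def p_subgroup_def)
  then show "subgroup Q G" by simp
  have "p ^ n dvd Coset.order G" using l_lagrange[OF fin Q(1)] Q(2) by (metis dvd_triv_right)
  then have "n \<le> multiplicity p (Coset.order G)"
    using order_pos p_not_unit by (intro multiplicity_geI) auto
  moreover have "n \<noteq> multiplicity p (Coset.order G)" using Q by (auto simp: sylow_subgroup_def)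
  ultimately show "\<exists>n. card Q = p ^ n \<and> n < multiplicity p (Coset.order G)" using Q(2) by auto
qed

lemma non_sylowI:
  assumes "subgroup Q G" "card Q = p ^ n" "n < multiplicity p (Coset.order G)"
  shows "Q \<in> non_syl"
  using assms power_inject_exp[OF prime_gt_1_nat[OF prime], of n "multiplicity p (Coset.order G)"]
  by (auto simp: non_sylow_def p_subgroup_def sylow_subgroup_def)

lemma sylowD: "subgroup S G" "card S = p ^ multiplicity p (Coset.order G)"
  using sylow by (auto simp: sylow_subgroup_def)

text \<open>\<open>Q\<close> misses at least one factor \<open>p\<close> of the group order, so
  \<open>p\<close> divides its index.\<close>

lemma index_non_sylow:
  assumes "Q \<in> non_syl"
  shows "of_nat (card (lcosets Q)) = (0 :: 'k)"
proof -
  obtain n where n: "card Q = p ^ n" "n < multiplicity p (Coset.order G)" and Q: "subgroup Q G"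
    using non_sylowD[OF assms] by blast
  have "p ^ Suc n dvd Coset.order G" using n(2) by (intro multiplicity_dvd') auto
  also have "Coset.order G = card (lcosets Q) * p ^ n" using l_lagrange[OF fin Q] n(1) by simp
  finally have "p dvd card (lcosets Q)" using prime by (auto simp: prime_gt_0_nat)
  then show ?thesis using char_p by (simp add: of_nat_eq_0_iff_char_dvd)
qed

lemma index_sylow: "of_nat (card (lcosets S)) \<noteq> (0 :: 'k)"
proof
  assume "of_nat (card (lcosets S)) = (0 :: 'k)"
  then have "p dvd card (lcosets S)" using char_p by (simp add: of_nat_eq_0_iff_char_dvd)
  then have "p ^ Suc (multiplicity p (Coset.order G)) dvd Coset.order G"
    using l_lagrange[OF fin sylowD(1)] sylowD(2) by (metis mult_dvd_mono dvd_refl power_Suc)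
  then have "Suc (multiplicity p (Coset.order G)) \<le> multiplicity p (Coset.order G)"
    by (intro multiplicity_geI) (use order_pos p_not_unit in auto)
  then show False by simp
qed

lemma subgroup_card_pow:
  assumes "subgroup R G" "subgroup Q G" "R \<subseteq> Q" "card Q = p ^ n"
  shows "\<exists>j. card R = p ^ j"
proof -
  interpret Q: group "G\<lparr>carrier := Q\<rparr>" using subgroup_imp_group[OF assms(2)] .
  have "finite Q" using assms(2) fin by (meson finite_subset subgroup.subset)
  then have "card R dvd card Q"
    using Q.l_lagrange[OF _ subgroup_incl[OF assms(1-3)]] by (simp add: Coset.order_def) (metis dvd_triv_right)
  then show ?thesis using divides_primepow_nat[OF prime] assms(4) by auto
qed

lemma non_sylow_mono:
  assumes "Q \<in> non_syl" "subgroup R G" "R \<subseteq> Q"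
  shows "R \<in> non_syl"
proof -
  obtain n where n: "card Q = p ^ n" "n < multiplicity p (Coset.order G)" and Q: "subgroup Q G"
    using non_sylowD[OF assms(1)] by blast
  obtain j where j: "card R = p ^ j" using subgroup_card_pow[OF assms(2) Q assms(3) n(1)] by blast
  have "finite Q" using Q fin by (meson finite_subset subgroup.subset)
  then have "p ^ j \<le> p ^ n" using card_mono[OF _ assms(3)] j n by simp
  then have "j \<le> n" using prime prime_gt_1_nat by (metis power_le_imp_le_exp)
  then show ?thesis using non_sylowI[OF assms(2) j] n by simp
qed

lemma psubset_sylow:
  assumes "subgroup R G" "R \<subset> S"
  shows "R \<in> non_syl"
proof -
  obtain j where j: "card R = p ^ j" using subgroup_card_pow[OF assms(1) sylowD(1) _ sylowD(2)] assms(2) by blast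
  have "finite S" using sylowD(1) fin by (meson finite_subset subgroup.subset)
  then have "p ^ j < p ^ multiplicity p (Coset.order G)" using psubset_card_mono[OF _ assms(2)] j sylowD(2) by simp
  then have "j < multiplicity p (Coset.order G)" using prime prime_gt_1_nat by (metis power_less_imp_less_exp)
  then show ?thesis using non_sylowI[OF assms(1) j] by simp
qed

lemma card_conj:
  assumes "Q \<subseteq> carrier G" "h \<in> carrier G"
  shows "card (h <#\<^bsub>G\<^esub> Q #> inv h) = card Q"
proof -
  have "h <#\<^bsub>G\<^esub> Q #> inv h = (\<lambda>x. h \<otimes> x \<otimes> inv h) ` Q"
    by (auto simp: l_coset_def r_coset_def)
  moreover have "inj_on (\<lambda>x. h \<otimes> x \<otimes> inv h) Q"
    using assms by (intro inj_onI) (auto simp: subset_iff)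
  ultimately show ?thesis by (simp add: card_image)
qed

lemma non_sylow_conj:
  assumes "Q \<in> non_syl" "h \<in> carrier G"
  shows "h <#\<^bsub>G\<^esub> Q #> inv h \<in> non_syl"
proof -
  obtain n where n: "card Q = p ^ n" "n < multiplicity p (Coset.order G)" and Q: "subgroup Q G"
    using non_sylowD[OF assms(1)] by blast
  show ?thesis
    using non_sylowI[OF subgroup_conjugation_is_surj2[OF assms(2) Q] _ n(2)] card_conj[OF subgroup.subset[OF Q] assms(2)] n(1) by simp
qed

text \<open>A \<open>p\<close>-group acting on the cosets of \<open>S\<close>, whose number is prime to \<open>p\<close>, has a fixed point.\<close>

lemma conj_into_sylow:
  assumes "Q \<in> non_syl"
  shows "\<exists>h\<in>carrier G. h <#\<^bsub>G\<^esub> Q #> inv h \<subset> S"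
proof -
  obtain n where n: "card Q = p ^ n" "n < multiplicity p (Coset.order G)" and Q: "subgroup Q G"
    using non_sylowD[OF assms(1)] by blast
  interpret Q: group "G\<lparr>carrier := Q\<rparr>" using subgroup_imp_group[OF Q] .
  note Qs = subgroup.mem_carrier[OF Q]
  let ?E = "lcosets S"
  note act = lcosets_act[OF sylowD(1)]
  define \<phi> where "\<phi> q = restrict (\<lambda>C. q <#\<^bsub>G\<^esub> C) ?E" for q
  have B: "\<phi> q \<in> Bij ?E" if q: "q \<in> carrier G" for q
  proof -
    have "bij_betw (\<lambda>C. q <#\<^bsub>G\<^esub> C) ?E ?E"
      by (rule bij_betw_byWitness[where f' = "\<lambda>C. inv q <#\<^bsub>G\<^esub> C"])
        (use q act(1,2) in \<open>auto simp flip: act(3)\<close>)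
    then show ?thesis by (simp add: Bij_def \<phi>_def bij_betw_restrict_eq)
  qed
  have "\<phi> \<in> hom (G\<lparr>carrier := Q\<rparr>) (BijGroup ?E)"
  proof (rule homI)
    fix g h assume "g \<in> carrier (G\<lparr>carrier := Q\<rparr>)" "h \<in> carrier (G\<lparr>carrier := Q\<rparr>)"
    then have gh: "g \<in> carrier G" "h \<in> carrier G" using Qs by auto
    have "\<phi> (g \<otimes> h) = compose ?E (\<phi> g) (\<phi> h)"
      unfolding compose_def \<phi>_def by (intro restrict_ext) (use gh act in auto)
    then show "\<phi> (g \<otimes>\<^bsub>G\<lparr>carrier := Q\<rparr>\<^esub> h) = \<phi> g \<otimes>\<^bsub>BijGroup ?E\<^esub> \<phi> h"
      using gh B by (simp add: BijGroup_def)
  qed (use B Qs in \<open>simp add: BijGroup_def\<close>)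
  then interpret A: group_action "G\<lparr>carrier := Q\<rparr>" ?E \<phi>
    by (intro group_action.intro group_hom.intro group_hom_axioms.intro group_BijGroup Q.is_group)
  have finE: "finite ?E" by (rule lcosets_finite[OF fin sylowD(1)])
  have "\<exists>C\<in>?E. card (orbit (G\<lparr>carrier := Q\<rparr>) \<phi> C) = 1"
  proof (rule ccontr)
    assume no: "\<not> ?thesis"
    have "p dvd card (orbit (G\<lparr>carrier := Q\<rparr>) \<phi> C)" if "C \<in> ?E" for C
    proof -
      have "card (orbit (G\<lparr>carrier := Q\<rparr>) \<phi> C) dvd p ^ n"
        using A.orbit_stabilizer_theorem[OF that] n(1) by (simp add: Coset.order_def) (metis dvd_triv_left)
      then obtain i where i: "card (orbit (G\<lparr>carrier := Q\<rparr>) \<phi> C) = p ^ i"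
        using divides_primepow_nat[OF prime] by auto
      then have "i \<noteq> 0" using no that by auto
      then show ?thesis unfolding i by simp
    qed
    then have "p dvd card (\<Union> (orbits (G\<lparr>carrier := Q\<rparr>) ?E \<phi>))"
    proof (intro dvd_partition ballI impI)
      show "finite (\<Union> (orbits (G\<lparr>carrier := Q\<rparr>) ?E \<phi>))" using finE A.orbits_coverture by simp
      show "c1 \<inter> c2 = {}" if "c1 \<in> orbits (G\<lparr>carrier := Q\<rparr>) ?E \<phi>" "c2 \<in> orbits (G\<lparr>carrier := Q\<rparr>) ?E \<phi>" "c1 \<noteq> c2" for c1 c2
        using A.disjoint_union[OF that(1,2)] that(3) by blast
    qed (auto simp: orbits_def)
    then show False using A.orbits_coverture index_sylow char_p by (simp add: of_nat_eq_0_iff_char_dvd)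
  qed
  then obtain C where C: "C \<in> ?E" "card (orbit (G\<lparr>carrier := Q\<rparr>) \<phi> C) = 1" by blast
  have fix_C: "q <#\<^bsub>G\<^esub> C = C" if "q \<in> Q" for q
  proof -
    obtain D where D: "orbit (G\<lparr>carrier := Q\<rparr>) \<phi> C = {D}" using C(2) by (auto simp: card_1_singleton_iff)
    have "\<phi> q C \<in> {D}" "\<phi> \<one> C \<in> {D}"
      unfolding D[symmetric] orbit_def using that subgroup.one_closed[OF Q] by auto
    then show ?thesis using C(1) act(2) by (simp add: \<phi>_def)
  qed
  obtain x where x: "x \<in> carrier G" "C = x <#\<^bsub>G\<^esub> S" using C(1) by (auto simp: LCOSETS_def)
  interpret S: subgroup S G by (rule sylowD)
  \<comment> \<open>That \<open>Q\<close> fixes the coset \<open>x S\<close> means that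
    \<open>x\<^sup>-\<^sup>1 Q x\<close> lies in \<open>S\<close>.\<close>
  have "inv x \<otimes> q \<otimes> x \<in> S" if q: "q \<in> Q" for q
  proof -
    have "x \<in> C" unfolding x(2) by (rule lcos_self[OF x(1) sylowD(1)])
    then have "q \<otimes> x \<in> q <#\<^bsub>G\<^esub> C" unfolding l_coset_def by blast
    then have "q \<otimes> x \<in> x <#\<^bsub>G\<^esub> S" using fix_C[OF q] x(2) by simp
    then show ?thesis using S.lcos_module_imp[OF is_group x(1)] x(1) Qs[OF q] by (simp add: m_assoc)
  qed
  then have sub: "inv x <#\<^bsub>G\<^esub> Q #> inv (inv x) \<subseteq> S"
    using x(1) by (auto simp: l_coset_def r_coset_def)
  \<comment> \<open>The inclusion is proper by comparison of orders. This matters because minimality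
    of a vertex is contradicted by proper subgroups only.\<close>
  have "card (inv x <#\<^bsub>G\<^esub> Q #> inv (inv x)) \<noteq> card S"
    using card_conj[OF subgroup.subset[OF Q], of "inv x"] x(1) n sylowD(2)
      power_inject_exp[OF prime_gt_1_nat[OF prime], of n "multiplicity p (Coset.order G)"]
    by auto
  then show ?thesis using sub x(1) by (intro bexI[of _ "inv x"]) auto
qed

section \<open>Closure properties of \<F>-projective modules\<close>

definition V :: "('a, 'k) rep" where "V = V_non_sylow G p"

definition Qs :: "'a set list" where
  "Qs = map (\<lambda>C. SOME Q. Q \<in> C) (enum_list (conj_class G ` non_syl))"

lemma V_eq: "V = dsum_list (map (coset_mod G) Qs)"
  by (simp add: V_def V_non_sylow_def Qs_def comp_def)

lemma Qs: "set Qs \<subseteq> non_syl" "Q \<in> non_syl \<Longrightarrow> \<exists>h\<in>carrier G. h <#\<^bsub>G\<^esub> Q #> inv h \<in> set Qs"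
proof -
  have "non_syl \<subseteq> Pow (carrier G)" using non_sylowD(1) subgroup.subset by blast
  then have "finite (conj_class G ` non_syl)" using fin by (meson finite_Pow_iff finite_imageI finite_subset)
  then have s: "set Qs = (\<lambda>Q. SOME R. R \<in> conj_class G Q) ` non_syl"
    unfolding Qs_def by (simp add: enum_list(2) image_image)
  have *: "\<exists>h\<in>carrier G. (SOME R. R \<in> conj_class G Q) = h <#\<^bsub>G\<^esub> Q #> inv h" for Q
  proof -
    have "\<one> <#\<^bsub>G\<^esub> Q #> inv \<one> \<in> conj_class G Q" unfolding conj_class_def by blast
    then have "(SOME R. R \<in> conj_class G Q) \<in> conj_class G Q" by (rule someI)
    then show ?thesis unfolding conj_class_def by blast
  qed
  show "set Qs \<subseteq> non_syl"
  proof
    fix R assume "R \<in> set Qs"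
    then obtain Q where Q: "Q \<in> non_syl" "R = (SOME R. R \<in> conj_class G Q)" unfolding s by blast
    then show "R \<in> non_syl" using *[of Q] non_sylow_conj[OF Q(1)] by auto
  qed
  show "\<exists>h\<in>carrier G. h <#\<^bsub>G\<^esub> Q #> inv h \<in> set Qs" if Q: "Q \<in> non_syl"
  proof -
    obtain h where "h \<in> carrier G" "(SOME R. R \<in> conj_class G Q) = h <#\<^bsub>G\<^esub> Q #> inv h" using *[of Q] by blast
    then show ?thesis unfolding s using Q by (intro bexI[of _ h]) auto
  qed
qed

lemma coset_mod_perm: "Q \<in> set Qs \<Longrightarrow> is_perm G (coset_mod G Q :: ('a, 'k) rep)"
  using Qs(1) non_sylowD(1) coset_mod_is_perm[OF fin] by blast

lemma V_kG: "kG_module G V"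
  unfolding V_eq by (intro kG_dsum_list is_group) (auto intro: is_perm_kG coset_mod_perm)

definition Fproj :: "('a, 'k) rep \<Rightarrow> bool" where
  "Fproj X \<longleftrightarrow> kG_module G X \<and> (\<exists>N. kG_module G N \<and> retract G X (tensor_mod V N))"

lemma Fproj_kG: "Fproj X \<Longrightarrow> kG_module G X"
  by (simp add: Fproj_def)

lemma V_projective_iff: "V_projective G (V_non_sylow G p) X \<longleftrightarrow> Fproj X"
  unfolding V_projective_def Fproj_def V_def[symmetric]
  using summand_iff_retract[OF is_group kG_tensor(1)[OF is_group V_kG]] by blast

lemma Fproj_retract:
  assumes "Fproj Y" "kG_module G X" "retract G X Y"
  shows "Fproj X"
  using assms retract_trans[OF assms(2) Fproj_kG[OF assms(1)] kG_tensor(1)[OF is_group V_kG]]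
  unfolding Fproj_def by blast

lemma Fproj_tensor:
  assumes "Fproj X" "kG_module G Y"
  shows "Fproj (tensor_mod X Y)" "Fproj (tensor_mod Y X)"
proof -
  obtain N where N: "kG_module G N" "retract G X (tensor_mod V N)" using assms(1) by (auto simp: Fproj_def)
  note KX = Fproj_kG[OF assms(1)]
  have "retract G (tensor_mod X Y) (tensor_mod (tensor_mod V N) Y)"
    by (rule retract_tensor[OF is_group KX assms(2) kG_tensor(1)[OF is_group V_kG N(1)] assms(2) N(2) retract_refl[OF assms(2)]])
  then show 1: "Fproj (tensor_mod X Y)"
    unfolding tensor_assoc Fproj_def using kG_tensor(1)[OF is_group KX assms(2)] kG_tensor(1)[OF is_group N(1) assms(2)] by blast
  show "Fproj (tensor_mod Y X)"
    by (rule Fproj_retract[OF 1 kG_tensor(1)[OF is_group assms(2) KX] retract_swap[OF is_group assms(2) KX]])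
qed

lemma Fproj_dsum:
  assumes "Fproj X" "Fproj Y"
  shows "Fproj (dsum X Y)"
proof -
  obtain M N where M: "kG_module G M" "retract G X (tensor_mod V M)" and N: "kG_module G N" "retract G Y (tensor_mod V N)"
    using assms by (auto simp: Fproj_def)
  note K = Fproj_kG[OF assms(1)] Fproj_kG[OF assms(2)]
  note KMN = kG_dsum[OF is_group M(1) N(1)]
  note KT = kG_tensor(1)[OF is_group V_kG M(1)] kG_tensor(1)[OF is_group V_kG N(1)] kG_tensor(1)[OF is_group V_kG KMN]
  have "Fproj (tensor_mod V (dsum M N))"
    unfolding Fproj_def using KT(3) KMN retract_refl[OF KT(3)] by blast
  moreover have "retract G X (tensor_mod V (dsum M N))"
    using retract_trans[OF K(1) KT(1,3) M(2) retract_tensor[OF is_group V_kG M(1) V_kG KMN retract_refl[OF V_kG] retract_dsum_left[OF M(1) N(1)]]] .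
  moreover have "retract G Y (tensor_mod V (dsum M N))"
    using retract_trans[OF K(2) KT(2,3) N(2) retract_tensor[OF is_group V_kG N(1) V_kG KMN retract_refl[OF V_kG] retract_dsum_right[OF M(1) N(1)]]] .
  \<comment> \<open>This is the direction opposite to \<open>retract_tensor_dsum_right\<close>: the
    sum of the products has to embed, so the maps are assembled from Kronecker products with the
    inclusions and projections.\<close>
  moreover have "retract G (dsum (tensor_mod V M) (tensor_mod V N)) (tensor_mod V (dsum M N))"
  proof -
    note m = mor_biprod[OF M(1) N(1)]
    note o = mor_one[OF V_kG]
    let ?v = "deg V" and ?m = "deg M" and ?n = "deg N"
    note t1 = mor_kron[OF is_group V_kG M(1) V_kG KMN o m(1)] mor_kron[OF is_group V_kG N(1) V_kG KMN o m(2)]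
      mor_kron[OF is_group V_kG KMN V_kG M(1) o m(3)] mor_kron[OF is_group V_kG KMN V_kG N(1) o m(4)]
    note b = mor_biprod[OF KT(1,2)] and KD = kG_dsum[OF is_group KT(1,2)]
    let ?I1 = "in1 (?v * ?m) (?v * ?n) :: 'k mat" and ?I2 = "in2 (?v * ?m) (?v * ?n) :: 'k mat"
    let ?P1 = "pr1 (?v * ?m) (?v * ?n) :: 'k mat" and ?P2 = "pr2 (?v * ?m) (?v * ?n) :: 'k mat"
    let ?A1 = "kron (1\<^sub>m ?v) (in1 ?m ?n) :: 'k mat" and ?A2 = "kron (1\<^sub>m ?v) (in2 ?m ?n) :: 'k mat"
    let ?B1 = "kron (1\<^sub>m ?v) (pr1 ?m ?n) :: 'k mat" and ?B2 = "kron (1\<^sub>m ?v) (pr2 ?m ?n) :: 'k mat"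
    have b': "mor G (tensor_mod V M) (dsum (tensor_mod V M) (tensor_mod V N)) ?I1"
      "mor G (tensor_mod V N) (dsum (tensor_mod V M) (tensor_mod V N)) ?I2"
      "mor G (dsum (tensor_mod V M) (tensor_mod V N)) (tensor_mod V M) ?P1"
      "mor G (dsum (tensor_mod V M) (tensor_mod V N)) (tensor_mod V N) ?P2"
      using b by simp_all
    have z: "kron (1\<^sub>m a) (0\<^sub>m c d) = (0\<^sub>m (a * c) (a * d) :: 'k mat)" for a c d
      by (intro eq_matI) (auto simp: kron_index div_mod_lt)
    have BA: "?B1 * ?A1 = 1\<^sub>m (?v * ?m)" "?B2 * ?A2 = 1\<^sub>m (?v * ?n)" "?B1 * ?A2 = 0\<^sub>m (?v * ?m) (?v * ?n)" "?B2 * ?A1 = 0\<^sub>m (?v * ?n) (?v * ?m)"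
      by (simp_all add: kron_mult kron_one z)
    have zz: "dim_row X = ?v * ?n \<Longrightarrow> ?B1 * (?A2 * X) = 0\<^sub>m (?v * ?m) (dim_col X)"
      "dim_row X = ?v * ?m \<Longrightarrow> ?B2 * (?A1 * X) = 0\<^sub>m (?v * ?n) (dim_col X)" for X :: "'k mat"
      by (simp_all add: mult_assoc_dim[symmetric] BA mult_zero_dim del: assoc_mult_mat)
    show ?thesis
    proof (rule retractI)
      show "mor G (dsum (tensor_mod V M) (tensor_mod V N)) (tensor_mod V (dsum M N)) (?A1 * ?P1 + ?A2 * ?P2)"
        by (rule mor_add[OF KD KT(3) mor_comp[OF KD KT(1,3) b'(3) t1(1)] mor_comp[OF KD KT(2,3) b'(4) t1(2)]])
      show "mor G (tensor_mod V (dsum M N)) (dsum (tensor_mod V M) (tensor_mod V N)) (?I1 * ?B1 + ?I2 * ?B2)"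
        by (rule mor_add[OF KT(3) KD mor_comp[OF KT(3,1) KD t1(3) b'(1)] mor_comp[OF KT(3,2) KD t1(4) b'(2)]])
      have "(?I1 * ?B1 + ?I2 * ?B2) * (?A1 * ?P1 + ?A2 * ?P2) = ?I1 * ?P1 + ?I2 * ?P2"
        by (simp add: mat_dim_simps zz left_inverse_mult_dim[OF BA(1)] left_inverse_mult_dim[OF BA(2)])
      then show "(?I1 * ?B1 + ?I2 * ?B2) * (?A1 * ?P1 + ?A2 * ?P2) = 1\<^sub>m (deg (dsum (tensor_mod V M) (tensor_mod V N)))"
        unfolding biprod_sum by (simp add: dsum_simps(1))
    qed
  qed
  moreover have "retract G (dsum X Y) (dsum (tensor_mod V M) (tensor_mod V N))"
    by (rule retract_dsum[OF is_group K KT(1,2) M(2) N(2)])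
  ultimately show ?thesis
    using Fproj_retract[OF _ kG_dsum[OF is_group K]] retract_trans[OF kG_dsum[OF is_group K] kG_dsum[OF is_group KT(1,2)] KT(3)] by blast
qed

lemma Fproj_deg_zero: "kG_module G X \<Longrightarrow> deg X = 0 \<Longrightarrow> Fproj X"
  unfolding Fproj_def using retract_deg_zero[OF _ kG_tensor(1)[OF is_group V_kG kG_triv]] kG_triv by blast

section \<open>Relative projectivity and vertices in terms of \<F>-projectivity\<close>

lemma rel_projective_Fproj:
  assumes "Q \<in> non_syl" "kG_module G M" "rel_projective G Q M"
  shows "Fproj M"
proof -
  \<comment> \<open>\<open>V\<close> contains one representative of each conjugacy class, so
    \<open>Q\<close> is first replaced by that conjugate.\<close>
  obtain h where h: "h \<in> carrier G" "h <#\<^bsub>G\<^esub> Q #> inv h \<in> set Qs" using Qs(2)[OF assms(1)] by blast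
  let ?R = "h <#\<^bsub>G\<^esub> Q #> inv h"
  obtain X :: "('a, 'k) rep" where X: "kG_module G X" "retract G M (tensor_mod (coset_mod G ?R) X)"
    using rel_projective_imp_retract[OF fin non_sylowD(1)[OF assms(1)] assms(2,3) h(1)] by blast
  have KC: "kG_module G (coset_mod G ?R :: ('a, 'k) rep)" using is_perm_kG[OF coset_mod_perm[OF h(2)]] .
  have "retract G (coset_mod G ?R) V"
    unfolding V_eq using h(2) by (intro retract_dsum_list is_group) (auto intro: is_perm_kG coset_mod_perm)
  then have "retract G (tensor_mod (coset_mod G ?R) X) (tensor_mod V X)"
    by (intro retract_tensor is_group KC X(1) V_kG retract_refl)
  then show ?thesis unfolding Fproj_def
    using assms(2) X(1) retract_trans[OF assms(2) kG_tensor(1)[OF is_group KC X(1)] kG_tensor(1)[OF is_group V_kG X(1)] X(2)] by blast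
qed

text \<open>An indecomposable retract of a sum is a retract of one term, here of some k[G/Q]
  \<otimes> N.\<close>

lemma Fproj_rel_projective:
  assumes "indecomposable G M" "Fproj M"
  shows "\<exists>Q\<in>non_syl. rel_projective G Q M"
proof -
  obtain N where N: "kG_module G N" "retract G M (tensor_mod V N)" and M: "kG_module G M" using assms(2) by (auto simp: Fproj_def)
  have "\<exists>X\<in>set (map (coset_mod G) Qs). retract G M (tensor_mod X N)"
    by (rule indecomposable_retract_dsum_list[OF is_group assms(1) _ N(1) N(2)[unfolded V_eq]])
      (auto intro: is_perm_kG coset_mod_perm)
  then obtain Q where Q: "Q \<in> set Qs" "retract G M (tensor_mod (coset_mod G Q) N)" by auto
  then have "Q \<in> non_syl" using Qs(1) by blast
  then show ?thesis using retract_imp_rel_projective[OF fin non_sylowD(1) M N(1) Q(2)] by blast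
qed

text \<open>The index of \<open>S\<close> is invertible in k, so k is a retract of k[G/S] by means
  of the sum of all cosets and the average of coordinates. Tensoring with \<open>M\<close> gives the
  claim.\<close>

lemma rel_projective_sylow:
  assumes "kG_module G (M :: ('a, 'k) rep)"
  shows "rel_projective G S M"
proof -
  let ?l = "card (lcosets S)" and ?P = "coset_mod G S :: ('a, 'k) rep"
  note KP = is_perm_kG[OF coset_mod_is_perm[OF fin sylowD(1)]]
  note a = coset_mod_act[OF fin sylowD(1)]
  have d: "deg ?P = ?l" using a(1)[OF one_closed] .
  define i :: "'k mat" where "i = mat ?l 1 (\<lambda>_. 1)"
  define q :: "'k mat" where "q = mat 1 ?l (\<lambda>_. 1 / of_nat ?l)"
  have "mor G (triv_mod 1) ?P i" unfolding mor_def d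
  proof (intro conjI ballI)
    fix g assume g: "g \<in> carrier G"
    note f = coset_perm[OF fin sylowD(1) g]
    have "coset_perm S g ` {..<?l} = {..<?l}"
      by (rule endo_inj_surj) (use f in auto)
    then have ex: "\<exists>l<?l. r = coset_perm S g l" if "r < ?l" for r using that by (metis imageE lessThan_iff)
    have "act ?P g * i = i" unfolding a(2)[OF g]
    proof (rule eq_matI)
      fix r c assume rc: "r < dim_row i" "c < dim_col i"
      then obtain l where l: "l < ?l" "r = coset_perm S g l" using ex[of r] by (auto simp: i_def)
      then have "inv_into {..<?l} (coset_perm S g) r = l" using f(2) by (simp add: inv_into_f_f)
      then show "(sel_mat ?l ?l (coset_perm S g) * i) $$ (r, c) = i $$ (r, c)"
        using rc l f(2) by (subst sel_mult_index) (auto simp: i_def)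
    qed (auto simp: i_def)
    then show "i * act (triv_mod 1) g = act ?P g * i" by (simp add: mult_one_dim i_def)
  qed (auto simp: i_def)
  moreover have "mor G ?P (triv_mod 1) q" unfolding mor_def d
  proof (intro conjI ballI)
    fix g assume g: "g \<in> carrier G"
    note f = coset_perm[OF fin sylowD(1) g]
    have "q * act ?P g = q" unfolding a(2)[OF g]
    proof (rule eq_matI)
      fix r c assume rc: "r < dim_row q" "c < dim_col q"
      then show "(q * sel_mat ?l ?l (coset_perm S g)) $$ (r, c) = q $$ (r, c)"
        using f(1)[of c] by (subst mult_sel_index) (auto simp: q_def)
    qed (auto simp: q_def)
    then show "q * act ?P g = act (triv_mod 1) g * q" by (simp add: one_mult_dim q_def)
  qed (auto simp: q_def)
  moreover have "q * i = 1\<^sub>m (deg (triv_mod 1 :: ('a, 'k) rep))"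
  proof (rule eq_matI)
    fix r c assume "r < dim_row (1\<^sub>m (deg (triv_mod 1 :: ('a, 'k) rep)) :: 'k mat)" "c < dim_col (1\<^sub>m (deg (triv_mod 1 :: ('a, 'k) rep)) :: 'k mat)"
    then have rc: "r = 0" "c = 0" by auto
    have "(q * i) $$ (0, 0) = (\<Sum>k<?l. 1 / of_nat ?l)"
      by (subst index_mult_mat_sum) (auto simp: q_def i_def)
    then show "(q * i) $$ (r, c) = 1\<^sub>m (deg (triv_mod 1 :: ('a, 'k) rep)) $$ (r, c)"
      using rc index_sylow by simp
  qed (auto simp: q_def i_def)
  ultimately have "retract G (triv_mod 1) ?P" by (rule retractI)
  then have "retract G (tensor_mod (triv_mod 1) M) (tensor_mod ?P M)"
    by (intro retract_tensor is_group kG_triv assms KP retract_refl)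
  then have "retract G M (tensor_mod ?P M)"
    using retract_cong[OF tensor_triv_left[OF is_group assms] rep_eq_refl] by blast
  then show ?thesis by (rule retract_imp_rel_projective[OF fin sylowD(1) assms assms])
qed

text \<open>Every module is \<open>S\<close>-projective, and the proper subgroups of
  \<open>S\<close> are non-Sylow, so \<open>S\<close> is a vertex unless \<open>N\<close> is
  \<F>-projective. Conversely, a non-Sylow subgroup relative to which \<open>N\<close> is projective
  can be conjugated into a proper subgroup of \<open>S\<close>, against minimality.\<close>

lemma vertex_sylow_iff:
  assumes "indecomposable G (N :: ('a, 'k) rep)"
  shows "vertex G S N \<longleftrightarrow> \<not> Fproj N"
proof
  have KN: "kG_module G N" using assms by (simp add: indecomposable_def)
  assume v: "vertex G S N"
  show "\<not> Fproj N"
  proof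
    assume "Fproj N"
    then obtain Q where Q: "Q \<in> non_syl" "rel_projective G Q N" using Fproj_rel_projective[OF assms] by blast
    obtain h where h: "h \<in> carrier G" "h <#\<^bsub>G\<^esub> Q #> inv h \<subset> S" using conj_into_sylow[OF Q(1)] by blast
    have sR: "subgroup (h <#\<^bsub>G\<^esub> Q #> inv h) G" using non_sylowD(1)[OF non_sylow_conj[OF Q(1) h(1)]] .
    obtain X :: "('a, 'k) rep" where "kG_module G X" "retract G N (tensor_mod (coset_mod G (h <#\<^bsub>G\<^esub> Q #> inv h)) X)"
      using rel_projective_imp_retract[OF fin non_sylowD(1)[OF Q(1)] KN Q(2) h(1)] by blast
    then have "rel_projective G (h <#\<^bsub>G\<^esub> Q #> inv h) N"
      using retract_imp_rel_projective[OF fin sR KN] by blast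
    then show False using v sR h(2) by (auto simp: vertex_def)
  qed
next
  have KN: "kG_module G N" using assms by (simp add: indecomposable_def)
  assume "\<not> Fproj N"
  then show "vertex G S N" unfolding vertex_def
    using assms sylowD(1) rel_projective_sylow[OF KN] psubset_sylow rel_projective_Fproj[OF _ KN] by blast
qed

text \<open>Among the non-Sylow subgroups relative to which \<open>N\<close> is projective, one of
  least order is a vertex, because its subgroups are again non-Sylow.\<close>

lemma vertex_non_sylow_iff:
  assumes "indecomposable G (N :: ('a, 'k) rep)"
  shows "(\<exists>Q\<in>non_syl. vertex G Q N) \<longleftrightarrow> Fproj N"
proof
  have KN: "kG_module G N" using assms by (simp add: indecomposable_def)
  assume "\<exists>Q\<in>non_syl. vertex G Q N"
  then show "Fproj N" using rel_projective_Fproj[OF _ KN] by (auto simp: vertex_def)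
next
  assume "Fproj N"
  define P where "P R \<longleftrightarrow> R \<in> non_syl \<and> rel_projective G R N" for R
  have "\<exists>R. P R" using Fproj_rel_projective[OF assms \<open>Fproj N\<close>] by (auto simp: P_def)
  then obtain R where R: "P R" "\<And>R'. P R' \<Longrightarrow> card R \<le> card R'"
    using ex_has_least_nat[of P _ card] by blast
  have finR: "finite R" using R(1) non_sylowD(1) subgroup.subset fin by (metis P_def finite_subset)
  have "\<not> rel_projective G R' N" if R': "subgroup R' G" "R' \<subset> R" for R'
  proof
    assume "rel_projective G R' N"
    then have "P R'" using non_sylow_mono[of R R'] R(1) R' by (auto simp: P_def)
    then show False using R(2)[of R'] psubset_card_mono[OF finR R'(2)] by simp
  qed
  then show "\<exists>Q\<in>non_syl. vertex G Q N"
    using R(1) assms non_sylowD(1) unfolding P_def vertex_def by blast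
qed

lemma component_retract: "component G N M \<Longrightarrow> kG_module G M \<Longrightarrow> retract G N M"
  using summand_iff_retract[OF is_group] by (auto simp: component_def)

text \<open>Induction on the degree stands in for a decomposition into indecomposables. The
  contrapositive finds a component that is not \<F>-projective in every module that is not.\<close>

lemma all_components_Fproj:
  assumes "kG_module G W" "\<And>N. component G N W \<Longrightarrow> Fproj N"
  shows "Fproj W"
  using assms
proof (induction "deg W" arbitrary: W rule: less_induct)
  case less
  consider "deg W = 0" | "indecomposable G W" | "deg W \<noteq> 0" "\<not> indecomposable G W" by blast
  then show ?case
  proof cases
    case 1
    then show ?thesis using Fproj_deg_zero less.prems(1) by blast
  next
    case 2
    then have "component G W W"
      unfolding component_def summand_iff_retract[OF is_group less.prems(1)] using less.prems(1) retract_refl by blast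
    then show ?thesis using less.prems(2) by blast
  next
    case 3
    then obtain A B where AB: "kG_module G A" "kG_module G B" "iso_mod G W (dsum A B)" "deg A \<noteq> 0" "deg B \<noteq> 0"
      using less.prems(1) by (auto simp: indecomposable_def)
    note KD = kG_dsum[OF is_group AB(1,2)]
    have d: "deg W = deg A + deg B" using AB(3) by (simp add: iso_mod_def dsum_simps)
    note rW = iso_mod_retract[OF less.prems(1) KD AB(3)]
    have rA: "retract G A W" using retract_trans[OF AB(1) KD less.prems(1) retract_dsum_left[OF AB(1,2)] rW(2)] .
    have rB: "retract G B W" using retract_trans[OF AB(2) KD less.prems(1) retract_dsum_right[OF AB(1,2)] rW(2)] .
    have *: "component G N W" if "component G N X" "kG_module G X" "retract G X W" for N X
      using that retract_trans[OF _ that(2) less.prems(1) _ that(3)] 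
      unfolding component_def summand_iff_retract[OF is_group that(2)] summand_iff_retract[OF is_group less.prems(1)] by blast
    have "Fproj A" by (rule less.hyps[OF _ AB(1)]) (use d AB *[OF _ AB(1) rA] less.prems(2) in auto)
    moreover have "Fproj B" by (rule less.hyps[OF _ AB(2)]) (use d AB *[OF _ AB(2) rB] less.prems(2) in auto)
    ultimately show ?thesis using Fproj_retract[OF Fproj_dsum less.prems(1) rW(1)] by blast
  qed
qed

text \<open>\<open>V \<otimes> N\<close> is a retract of a sum of modules k[G/Q] \<otimes> N, each
  graded by the cosets of \<open>Q\<close>, whose number is zero in k. The vanishing passes to sums
  and retracts.\<close>

lemma Fproj_no_triv_through:
  assumes "Fproj W"
  shows "no_triv_through G W"
proof -
  obtain N where N: "kG_module G N" "retract G W (tensor_mod V N)" and W: "kG_module G W" using assms by (auto simp: Fproj_def)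
  have c: "no_triv_through G (tensor_mod (coset_mod G Q) N)" if Q: "Q \<in> set Qs" for Q
  proof -
    have F: "Q \<in> non_syl" using Q Qs(1) by blast
    note Q' = non_sylowD(1)[OF F]
    show ?thesis unfolding no_triv_through_def
      using graded_composite_zero[OF kG_tensor(1)[OF is_group is_perm_kG[OF coset_mod_perm[OF Q]] N(1)]
        coset_tensor_graded[OF fin Q' N(1)] index_non_sylow[OF F] coset_perm_transitive[OF fin Q']] by blast
  qed
  have "no_triv_through G (tensor_mod (dsum_list (map (coset_mod G) Rs)) N)" if "set Rs \<subseteq> set Qs" for Rs
    using that
  proof (induction Rs)
    case Nil
    have "b * a = 0\<^sub>m 1 1" if "mor G (triv_mod 1) (tensor_mod (triv_mod 0) N) a" "mor G (tensor_mod (triv_mod 0) N) (triv_mod 1) b" for a b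
      using morD(1)[OF that(1)] morD(1)[OF that(2)] by (intro mult_inner_zero) auto
    then show ?case by (simp add: no_triv_through_def dsum_list_def)
  next
    case (Cons Q Rs)
    let ?D = "dsum_list (map (coset_mod G) Rs) :: ('a, 'k) rep" and ?C = "coset_mod G Q :: ('a, 'k) rep"
    have e: "dsum_list (map (coset_mod G) (Q # Rs)) = dsum ?C ?D" by (simp add: dsum_list_def)
    have KC: "kG_module G ?C" using Cons.prems is_perm_kG[OF coset_mod_perm] by simp
    have KD: "kG_module G ?D"
      by (intro kG_dsum_list is_group) (use Cons.prems in \<open>auto intro: is_perm_kG coset_mod_perm\<close>)
    note KT = kG_tensor(1)[OF is_group KC N(1)] kG_tensor(1)[OF is_group KD N(1)]
    have "no_triv_through G (dsum (tensor_mod ?C N) (tensor_mod ?D N))"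
      by (rule no_triv_through_dsum[OF c _ KT is_group]) (use Cons in auto)
    then show ?case unfolding e
      by (rule no_triv_through_retract[OF _ kG_tensor(1)[OF is_group kG_dsum[OF is_group KC KD] N(1)] kG_dsum[OF is_group KT]
          retract_tensor_dsum_left[OF is_group KC KD N(1)]])
  qed
  then have "no_triv_through G (tensor_mod V N)" unfolding V_eq by blast
  then show ?thesis by (rule no_triv_through_retract[OF _ W kG_tensor(1)[OF is_group V_kG N(1)] N(2)])
qed

end

section \<open>Coevaluation and trace\<close>

text \<open>The matrix belonging to a column vector in \<open>M \<otimes> N\<^sup>*\<close>, and the matrix that represents a row vector on it through the trace form.\<close>

definition unvec :: "nat \<Rightarrow> nat \<Rightarrow> 'a mat \<Rightarrow> 'a mat" where
  "unvec m n a = mat m n (\<lambda>(i, j). a $$ (i * n + j, 0))"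

definition unrow :: "nat \<Rightarrow> nat \<Rightarrow> 'a mat \<Rightarrow> 'a mat" where
  "unrow m n b = mat n m (\<lambda>(j, i). b $$ (0, i * n + j))"

lemma unvec_carrier: "unvec m n a \<in> carrier_mat m n"
  by (simp add: unvec_def)

lemma unrow_carrier: "unrow m n b \<in> carrier_mat n m"
  by (simp add: unrow_def)

text \<open>In matrix form, evaluating a linear form at a vector is the trace pairing; this is what
  turns a split copy of k into a product of trace 1.\<close>

lemma mult_row_col_tr:
  fixes a b :: "'a::comm_semiring_1 mat"
  assumes "a \<in> carrier_mat (m * n) c" "b \<in> carrier_mat r (m * n)" "c = 1" "r = 1"
  shows "(b * a) $$ (0, 0) = mat_tr (unrow m n b * unvec m n a)"
proof -
  have "(b * a) $$ (0, 0) = (\<Sum>k<m * n. b $$ (0, k) * a $$ (k, 0))"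
    using assms by (subst index_mult_mat_sum) auto
  also have "\<dots> = (\<Sum>i<m. \<Sum>j<n. b $$ (0, i * n + j) * a $$ (i * n + j, 0))"
    by (rule sum_blocks)
  also have "\<dots> = (\<Sum>j<n. \<Sum>i<m. unrow m n b $$ (j, i) * unvec m n a $$ (i, j))"
    by (subst sum.swap) (auto simp: unrow_def unvec_def intro!: sum.cong)
  also have "\<dots> = mat_tr (unrow m n b * unvec m n a)"
    by (rule mat_tr_mult_sum[symmetric, OF unrow_carrier unvec_carrier])
  finally show ?thesis .
qed

text \<open>In matrix form the group acts on \<open>M \<otimes> N\<^sup>*\<close> by
  \<open>X \<mapsto> A * X * B\<close>. With \<open>B\<close> the action of the inverse, invariant
  vectors are homomorphisms.\<close>

lemma unvec_kron:
  fixes A B :: "'a::comm_semiring_1 mat"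
  assumes "A \<in> carrier_mat m m" "B \<in> carrier_mat n n" "a \<in> carrier_mat (m * n) 1"
  shows "unvec m n (kron A (transpose_mat B) * a) = A * (unvec m n a * B)"
proof (rule eq_matI)
  fix r c assume "r < dim_row (A * (unvec m n a * B))" "c < dim_col (A * (unvec m n a * B))"
  then have rc: "r < m" "c < n" using assms by auto
  have lt: "i * n + j < m * n" if "i < m" "j < n" for i j using that by (rule mult_add_lt)
  have "unvec m n (kron A (transpose_mat B) * a) $$ (r, c) = (kron A (transpose_mat B) * a) $$ (r * n + c, 0)"
    using rc by (simp add: unvec_def)
  also have "\<dots> = (\<Sum>k<m * n. kron A (transpose_mat B) $$ (r * n + c, k) * a $$ (k, 0))"
    using assms lt[OF rc] by (subst index_mult_mat_sum) auto
  also have "\<dots> = (\<Sum>i<m. \<Sum>j<n. kron A (transpose_mat B) $$ (r * n + c, i * n + j) * a $$ (i * n + j, 0))"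
    by (rule sum_blocks)
  also have "\<dots> = (\<Sum>i<m. \<Sum>j<n. A $$ (r, i) * (unvec m n a $$ (i, j) * B $$ (j, c)))"
  proof (intro sum.cong refl)
    fix i j assume "i \<in> {..<m}" "j \<in> {..<n}"
    then have ij: "i < m" "j < n" by auto
    have "kron A (transpose_mat B) $$ (r * n + c, i * n + j) = A $$ (r, i) * B $$ (j, c)"
      using assms rc lt[OF rc] lt[OF ij] ij by (subst kron_index) auto
    then show "kron A (transpose_mat B) $$ (r * n + c, i * n + j) * a $$ (i * n + j, 0) =
        A $$ (r, i) * (unvec m n a $$ (i, j) * B $$ (j, c))"
      using ij by (simp add: unvec_def mult_ac)
  qed
  also have "\<dots> = (\<Sum>i<m. A $$ (r, i) * (unvec m n a * B) $$ (i, c))"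
    using assms rc unvec_carrier[of m n a]
    by (intro sum.cong refl) (subst index_mult_mat_sum, auto simp: sum_distrib_left)
  also have "\<dots> = (A * (unvec m n a * B)) $$ (r, c)"
    using assms rc unvec_carrier[of m n a] by (subst (2) index_mult_mat_sum) auto
  finally show "unvec m n (kron A (transpose_mat B) * a) $$ (r, c) = (A * (unvec m n a * B)) $$ (r, c)" .
qed (use assms in \<open>auto simp: unvec_def\<close>)

lemma unrow_eq_unvec:
  fixes b :: "'a::comm_semiring_1 mat"
  assumes "b \<in> carrier_mat 1 (m * n)"
  shows "unrow m n b = transpose_mat (unvec m n (transpose_mat b))"
proof (rule eq_matI)
  fix j i assume "j < dim_row (transpose_mat (unvec m n (transpose_mat b)))" "i < dim_col (transpose_mat (unvec m n (transpose_mat b)))"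
  then have l: "j < n" "i < m" by (auto simp: unvec_def)
  then show "unrow m n b $$ (j, i) = transpose_mat (unvec m n (transpose_mat b)) $$ (j, i)"
    using assms mult_add_lt[OF l(2,1)] by (simp add: unvec_def unrow_def)
qed (auto simp: unvec_def unrow_def)

text \<open>\<open>Hom\<^sub>k(N, M)\<close> in the form \<open>M \<otimes> N\<^sup>*\<close>.\<close>

definition hom_mod :: "('g, 'b) monoid_scheme \<Rightarrow> ('g, 'k::field) rep \<Rightarrow> ('g, 'k) rep \<Rightarrow> ('g, 'k) rep" where
  "hom_mod G M N = tensor_mod M (dual_mod G N)"

lemma deg_hom_mod [simp]: "deg (hom_mod G M N) = deg M * deg N"
  by (simp add: hom_mod_def)

context group
begin

lemma kG_hom_mod: "kG_module G M \<Longrightarrow> kG_module G N \<Longrightarrow> kG_module G (hom_mod G M N)"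
  unfolding hom_mod_def by (intro kG_tensor kG_dual is_group)

lemma act_hom_mod: "kG_module G M \<Longrightarrow> kG_module G N \<Longrightarrow> g \<in> carrier G \<Longrightarrow>
    act (hom_mod G M N) g = kron (act M g) (transpose_mat (act N (inv g)))"
  unfolding hom_mod_def by (subst act_tensor[OF is_group]) (auto simp: kG_dual dual_mod_def is_group intro: kG_dual[OF is_group, unfolded dual_mod_def])

lemma act_inv_mult:
  assumes "kG_module G M" "g \<in> carrier G"
  shows "act M g * act M (inv g) = 1\<^sub>m (deg M)" "act M (inv g) * act M g = 1\<^sub>m (deg M)"
proof -
  have one: "act M \<one> = 1\<^sub>m (deg M)" and mul: "\<And>g h. g \<in> carrier G \<Longrightarrow> h \<in> carrier G \<Longrightarrow> act M (g \<otimes> h) = act M g * act M h"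
    using assms(1) by (auto simp: kG_module_def)
  show "act M g * act M (inv g) = 1\<^sub>m (deg M)" "act M (inv g) * act M g = 1\<^sub>m (deg M)"
    using mul[OF assms(2) inv_closed[OF assms(2)]] mul[OF inv_closed[OF assms(2)] assms(2)] one assms(2) by simp_all
qed

lemma mor_unvec:
  fixes M N :: "('a, 'k::field) rep"
  assumes "kG_module G M" "kG_module G N" "mor G (triv_mod 1) (hom_mod G M N) a"
  shows "mor G N M (unvec (deg M) (deg N) a)"
  unfolding mor_def
proof (intro conjI ballI unvec_carrier)
  fix g assume g: "g \<in> carrier G"
  let ?f = "unvec (deg M) (deg N) a"
  note a = morD(1)[OF assms(3)]
  note d = kG_dim[OF assms(1) g] kG_dim[OF assms(2) g] kG_dim[OF assms(2) inv_closed[OF g]] unvec_carrier[of "deg M" "deg N" a, THEN carrier_matD(1)] unvec_carrier[of "deg M" "deg N" a, THEN carrier_matD(2)]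
  have "kron (act M g) (transpose_mat (act N (inv g))) * a = a"
    using morD(4)[OF assms(3) g] a unfolding act_hom_mod[OF assms(1,2) g] by (simp add: mult_one_dim)
  then have "?f = unvec (deg M) (deg N) (kron (act M g) (transpose_mat (act N (inv g))) * a)" by simp
  also have "\<dots> = act M g * (?f * act N (inv g))"
    by (rule unvec_kron) (use a d in \<open>auto intro: carrier_matI\<close>)
  finally have e: "?f = act M g * (?f * act N (inv g))" .
  have "?f * act N g = act M g * (?f * act N (inv g)) * act N g" by (rule arg_cong[OF e])
  also have "\<dots> = act M g * ?f" using d by (simp add: mult_assoc_dim act_inv_mult(2)[OF assms(2) g] mult_one_dim)
  finally show "?f * act N g = act M g * ?f" .
qed

text \<open>An invariant linear form, transposed, is a vector fixed by the transposed matrices,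
  which reduces the claim to \<open>unvec_kron\<close>.\<close>

lemma mor_unrow:
  fixes M N :: "('a, 'k::field) rep"
  assumes "kG_module G M" "kG_module G N" "mor G (hom_mod G M N) (triv_mod 1) b"
  shows "mor G M N (unrow (deg M) (deg N) b)"
  unfolding mor_def
proof (intro conjI ballI unrow_carrier)
  fix g assume g: "g \<in> carrier G"
  have b: "b \<in> carrier_mat 1 (deg M * deg N)" using morD(1)[OF assms(3)] by simp
  let ?v = "unvec (deg M) (deg N) (transpose_mat b)"
  note d = kG_dim[OF assms(1) g] kG_dim[OF assms(2) g] kG_dim[OF assms(2) inv_closed[OF g]]
    unvec_carrier[of "deg M" "deg N" "transpose_mat b", THEN carrier_matD(1)] unvec_carrier[of "deg M" "deg N" "transpose_mat b", THEN carrier_matD(2)]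
  have "b * kron (act M g) (transpose_mat (act N (inv g))) = b"
    using morD(4)[OF assms(3) g] b unfolding act_hom_mod[OF assms(1,2) g] by (simp add: one_mult_dim)
  then have "transpose_mat (b * kron (act M g) (transpose_mat (act N (inv g)))) = transpose_mat b" by simp
  then have "kron (transpose_mat (act M g)) (transpose_mat (transpose_mat (act N (inv g)))) * transpose_mat b = transpose_mat b"
    using b d by (simp add: transpose_mult_dim kron_transpose)
  then have "?v = unvec (deg M) (deg N) (kron (transpose_mat (act M g)) (transpose_mat (transpose_mat (act N (inv g)))) * transpose_mat b)" by simp
  also have "\<dots> = transpose_mat (act M g) * (?v * transpose_mat (act N (inv g)))"
    by (rule unvec_kron) (use b d in \<open>auto intro: carrier_matI\<close>)
  finally have "transpose_mat ?v = transpose_mat (transpose_mat (act M g) * (?v * transpose_mat (act N (inv g))))" by (rule arg_cong)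
  also have "\<dots> = act N (inv g) * transpose_mat ?v * act M g"
    using d by (simp add: transpose_mult_dim)
  finally have e: "transpose_mat ?v = act N (inv g) * transpose_mat ?v * act M g" .
  have dv: "dim_row (transpose_mat ?v) = deg N" "dim_col (transpose_mat ?v) = deg M" using d by auto
  have "act N g * transpose_mat ?v = act N g * (act N (inv g) * transpose_mat ?v * act M g)" by (rule arg_cong[OF e])
  also have "\<dots> = transpose_mat ?v * act M g"
    using d dv by (simp add: mult_assoc_dim left_inverse_mult_dim[OF act_inv_mult(1)[OF assms(2) g]])
  finally show "unrow (deg M) (deg N) b * act M g = act N g * unrow (deg M) (deg N) b"
    unfolding unrow_eq_unvec[OF b] by simp
qed

text \<open>The section is coevaluation tensored with \<open>M\<close>, the retraction is \<open>M\<close> tensored with evaluation.\<close>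

lemma retract_zigzag:
  fixes M :: "('a, 'k::field) rep"
  assumes "kG_module G M"
  shows "retract G M (tensor_mod M (tensor_mod (dual_mod G M) M))"
proof -
  let ?n = "deg M" and ?D = "dual_mod G M"
  note KD = kG_dual[OF is_group assms]
  \<comment> \<open>\<open>co\<close> is the identity matrix written as a vector, and
    \<open>ev\<close> is the trace written as a linear form. Their invariance comes from
    \<open>act M g\<close> and \<open>act M (inv g)\<close> being inverse to each other.\<close>
  define co :: "'k mat" where "co = mat (?n * ?n) 1 (\<lambda>(r, c). if r div ?n = r mod ?n then 1 else 0)"
  define ev :: "'k mat" where "ev = mat 1 (?n * ?n) (\<lambda>(r, c). if c div ?n = c mod ?n then 1 else 0)"
  have lt: "i * ?n + j < ?n * ?n" if "i < ?n" "j < ?n" for i j using that by (rule mult_add_lt)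
  have dc: "dim_row co = ?n * ?n" "dim_col co = 1" "dim_row ev = 1" "dim_col ev = ?n * ?n" by (auto simp: co_def ev_def)
  have co: "kron A (transpose_mat B) * co = co" if A: "A \<in> carrier_mat ?n ?n" "B \<in> carrier_mat ?n ?n" "A * B = 1\<^sub>m ?n" for A B :: "'k mat"
  proof (rule eq_matI)
    fix r c assume "r < dim_row co" "c < dim_col co"
    then have rc: "r < ?n * ?n" "c = 0" by (auto simp: co_def)
    note r = div_mod_lt[OF rc(1)]
    have "(kron A (transpose_mat B) * co) $$ (r, 0) = (\<Sum>k<?n * ?n. kron A (transpose_mat B) $$ (r, k) * co $$ (k, 0))"
      using rc A dc by (subst index_mult_mat_sum) auto
    also have "\<dots> = (\<Sum>i<?n. \<Sum>j<?n. kron A (transpose_mat B) $$ (r, i * ?n + j) * co $$ (i * ?n + j, 0))"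
      by (rule sum_blocks)
    also have "\<dots> = (\<Sum>i<?n. \<Sum>j<?n. (A $$ (r div ?n, i) * B $$ (j, r mod ?n)) * (if j = i then 1 else 0))"
      using rc A r lt by (intro sum.cong refl) (auto simp: kron_index co_def)
    also have "\<dots> = (\<Sum>i<?n. A $$ (r div ?n, i) * B $$ (i, r mod ?n))"
      by (intro sum.cong refl sum_delta_times(1)) auto
    also have "\<dots> = (A * B) $$ (r div ?n, r mod ?n)" using A r by (subst index_mult_mat_sum) auto
    finally show "(kron A (transpose_mat B) * co) $$ (r, c) = co $$ (r, c)"
      unfolding A(3) using rc r by (simp add: co_def)
  qed (use A dc in auto)
  have ev: "ev * kron (transpose_mat B) A = ev" if A: "A \<in> carrier_mat ?n ?n" "B \<in> carrier_mat ?n ?n" "B * A = 1\<^sub>m ?n" for A B :: "'k mat"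
  proof -
    have t: "transpose_mat ev = co" by (intro eq_matI) (auto simp: ev_def co_def)
    have "transpose_mat (ev * kron (transpose_mat B) A) = kron B (transpose_mat A) * co"
      using A dc by (simp add: transpose_mult_dim kron_transpose t)
    also have "\<dots> = transpose_mat ev" unfolding t by (rule co[OF A(2,1,3)])
    finally show ?thesis by (metis transpose_transpose)
  qed
  have aD: "act ?D g = transpose_mat (act M (inv g))" for g by (simp add: dual_mod_def)
  have mco: "mor G (triv_mod 1) (tensor_mod M ?D) co" unfolding mor_def
  proof (intro conjI ballI)
    fix g assume g: "g \<in> carrier G"
    show "co * act (triv_mod 1) g = act (tensor_mod M ?D) g * co"
      unfolding act_tensor[OF is_group assms KD g] aD
      using co[OF _ _ act_inv_mult(1)[OF assms g]] assms g dc by (simp add: kG_module_def mult_one_dim)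
  qed (use dc in \<open>auto intro: carrier_matI\<close>)
  have mev: "mor G (tensor_mod ?D M) (triv_mod 1) ev" unfolding mor_def
  proof (intro conjI ballI)
    fix g assume g: "g \<in> carrier G"
    show "ev * act (tensor_mod ?D M) g = act (triv_mod 1) g * ev"
      unfolding act_tensor[OF is_group KD assms g] aD
      using ev[OF _ _ act_inv_mult(2)[OF assms g]] assms g dc by (simp add: kG_module_def one_mult_dim)
  qed (use dc in \<open>auto intro: carrier_matI\<close>)
  let ?i = "kron co (1\<^sub>m ?n)" and ?q = "kron (1\<^sub>m ?n) ev"
  let ?T = "tensor_mod M (tensor_mod ?D M)"
  have "mor G (tensor_mod (triv_mod 1) M) (tensor_mod (tensor_mod M ?D) M) ?i"
    by (rule mor_kron[OF is_group kG_triv assms kG_tensor(1)[OF is_group assms KD] assms mco mor_one[OF assms]])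
  then have mi: "mor G M ?T ?i"
    unfolding tensor_assoc using mor_cong[OF tensor_triv_left[OF is_group assms] rep_eq_refl] by blast
  have "mor G ?T (tensor_mod M (triv_mod 1)) ?q"
    by (rule mor_kron[OF is_group assms kG_tensor(1)[OF is_group KD assms] assms kG_triv mor_one[OF assms] mev])
  then have mq: "mor G ?T M ?q"
    using mor_cong[OF rep_eq_refl tensor_triv_right[OF is_group assms]] by blast
  have "?q * ?i = 1\<^sub>m ?n"
  proof (rule eq_matI)
    fix r c assume "r < dim_row (1\<^sub>m ?n :: 'k mat)" "c < dim_col (1\<^sub>m ?n :: 'k mat)"
    then have rc: "r < ?n" "c < ?n" by auto
    have "(?q * ?i) $$ (r, c) = (\<Sum>k<?n * (?n * ?n). ?q $$ (r, k) * ?i $$ (k, c))"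
      using rc dc by (subst index_mult_mat_sum) (auto simp: mult_ac)
    also have "\<dots> = (\<Sum>a<?n. \<Sum>x<?n * ?n. ?q $$ (r, a * (?n * ?n) + x) * ?i $$ (a * (?n * ?n) + x, c))"
      by (rule sum_blocks)
    also have "\<dots> = (\<Sum>a<?n. \<Sum>i<?n. \<Sum>j<?n. ?q $$ (r, a * (?n * ?n) + (i * ?n + j)) * ?i $$ (a * (?n * ?n) + (i * ?n + j), c))"
      by (intro sum.cong refl sum_blocks)
    also have "\<dots> = (\<Sum>a<?n. \<Sum>i<?n. \<Sum>j<?n. (if r = a \<and> a = c then 1 else 0) * (if i = a then 1 else 0) * (if j = i then 1 else 0))"
    proof (intro sum.cong refl)
      fix a i j assume "a \<in> {..<?n}" "i \<in> {..<?n}" "j \<in> {..<?n}"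
      then have aij: "a < ?n" "i < ?n" "j < ?n" by auto
      have l: "a * (?n * ?n) + (i * ?n + j) < ?n * (?n * ?n)" using aij(1) lt[OF aij(2,3)] by (rule mult_add_lt)
      \<comment> \<open>One basis number is read in two groupings, as
        \<open>a \<otimes> (i \<otimes> j)\<close> for \<open>?q\<close> and as
        \<open>(a \<otimes> i) \<otimes> j\<close> for \<open>?i\<close>.\<close>
      have k: "a * (?n * ?n) + (i * ?n + j) = (a * ?n + i) * ?n + j" by (simp add: algebra_simps)
      have 1: "?q $$ (r, a * (?n * ?n) + (i * ?n + j)) = (if r = a then 1 else 0) * (if i = j then 1 else 0)"
        using rc l lt[OF aij(2,3)] aij dc by (subst kron_index) (auto simp: ev_def)
      have 2: "?i $$ (a * (?n * ?n) + (i * ?n + j), c) = (if a = i then 1 else 0) * (if j = c then 1 else 0)"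
        using rc l lt[OF aij(1,2)] aij dc unfolding k by (subst kron_index) (auto simp: co_def)
      show "?q $$ (r, a * (?n * ?n) + (i * ?n + j)) * ?i $$ (a * (?n * ?n) + (i * ?n + j), c)
        = (if r = a \<and> a = c then 1 else 0) * (if i = a then 1 else 0) * (if j = i then 1 else 0)"
        unfolding 1 2 by auto
    qed
    also have "\<dots> = (\<Sum>a<?n. \<Sum>i<?n. (if r = a \<and> a = c then 1 else 0) * (if i = a then 1 else 0))"
      by (intro sum.cong refl sum_delta_times(1)) auto
    also have "\<dots> = (\<Sum>a<?n. (if r = a \<and> a = c then 1 else 0))"
      by (intro sum.cong refl sum_delta_times(1)) auto
    also have "\<dots> = (\<Sum>a<?n. (if a = c then 1 else 0) * (if a = r then 1 else 0))"
      by (intro sum.cong) auto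
    also have "\<dots> = (if r = c then 1 else 0)" by (rule sum_delta_times(1)[OF rc(1)])
    finally show "(?q * ?i) $$ (r, c) = 1\<^sub>m ?n $$ (r, c)" using rc by simp
  qed (use dc in auto)
  then show ?thesis by (rule retractI[OF mi mq])
qed

lemma hom_mod_retract:
  assumes "kG_module G M" "kG_module G M'" "kG_module G N" "kG_module G N'" "retract G M M'" "retract G N N'"
  shows "retract G (hom_mod G M N) (hom_mod G M' N')"
  unfolding hom_mod_def using assms by (intro retract_tensor retract_dual kG_dual is_group)

text \<open>After dualizing the product, only the two middle factors, \<open>N\<close> and the dual
  of \<open>M'\<close>, have to be exchanged.\<close>

lemma retract_hom_mod_tensor:
  assumes "kG_module G M" "kG_module G N" "kG_module G M'" "kG_module G N'"
  shows "retract G (hom_mod G (tensor_mod M N) (tensor_mod M' N')) (tensor_mod (hom_mod G M M') (hom_mod G N N'))"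
proof -
  let ?P = "dual_mod G M'" and ?Q = "dual_mod G N'"
  note D = kG_dual[OF is_group assms(3)] kG_dual[OF is_group assms(4)] and t = kG_tensor(1)[OF is_group]
  have e: "rep_eq G (hom_mod G (tensor_mod M N) (tensor_mod M' N')) (tensor_mod M (tensor_mod N (tensor_mod ?P ?Q)))"
    unfolding hom_mod_def tensor_assoc[symmetric]
    using tensor_cong[OF rep_eq_refl dual_tensor[OF is_group assms(3,4)]] by (metis tensor_assoc)
  have "retract G (tensor_mod (tensor_mod N ?P) ?Q) (tensor_mod (tensor_mod ?P N) ?Q)"
    by (rule retract_tensor[OF is_group t[OF assms(2) D(1)] D(2) t[OF D(1) assms(2)] D(2) retract_swap[OF is_group assms(2) D(1)] retract_refl[OF D(2)]])
  then have "retract G (tensor_mod M (tensor_mod N (tensor_mod ?P ?Q))) (tensor_mod M (tensor_mod ?P (tensor_mod N ?Q)))"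
    unfolding tensor_assoc
    by (rule retract_tensor[OF is_group assms(1) t[OF assms(2) t[OF D]] assms(1) t[OF D(1) t[OF assms(2) D(2)]] retract_refl[OF assms(1)]])
  then show ?thesis
    using retract_cong[OF e rep_eq_refl] unfolding hom_mod_def tensor_assoc by blast
qed

end

section \<open>Dade modules\<close>

context sylow_rep
begin

text \<open>Only a retract of k^n \<oplus> W is asked for, so \<open>n\<close> is an upper bound for
  the multiplicity of k. This makes closure under retracts immediate; the exact decomposition is
  recovered in \<open>triv_upto_structure\<close>.\<close>

definition triv_upto :: "nat \<Rightarrow> ('a, 'k) rep \<Rightarrow> bool" where
  "triv_upto n X \<longleftrightarrow> kG_module G X \<and> (\<exists>W. Fproj W \<and> retract G X (dsum (triv_mod n) W))"

lemma triv_upto_kG: "triv_upto n X \<Longrightarrow> kG_module G X"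
  by (simp add: triv_upto_def)

lemma triv_upto_retract:
  assumes "triv_upto n X" "kG_module G Y" "retract G Y X"
  shows "triv_upto n Y"
  using assms retract_trans[OF assms(2) triv_upto_kG[OF assms(1)] kG_dsum[OF is_group kG_triv Fproj_kG]]
  unfolding triv_upto_def by blast

lemma triv_upto_Fproj: "Fproj W \<Longrightarrow> triv_upto 0 W"
  unfolding triv_upto_def using retract_dsum_right[OF kG_triv] Fproj_kG by blast

lemma triv_upto_triv: "triv_upto n (triv_mod n)"
  unfolding triv_upto_def
  using kG_triv[of G] retract_dsum_left[OF kG_triv[of G n] kG_triv[of G 0]] Fproj_deg_zero[OF kG_triv[of G 0]] by auto

lemma retract_shuffle:
  assumes "kG_module G A" "kG_module G B" "kG_module G C" "kG_module G D"
  shows "retract G (dsum (dsum A B) (dsum C D)) (dsum (dsum A C) (dsum B D))"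
proof -
  note k = kG_dsum[OF is_group] and r = retract_dsum_assoc[OF is_group] and c = retract_dsum[OF is_group]
  note AB = k[OF assms(1,2)] and CD = k[OF assms(3,4)] and BC = k[OF assms(2,3)] and CB = k[OF assms(3,2)]
    and BD = k[OF assms(2,4)] and AC = k[OF assms(1,3)]
  note K = k[OF AB CD] k[OF assms(1) k[OF assms(2) CD]] k[OF assms(1) k[OF BC assms(4)]] k[OF assms(1) k[OF CB assms(4)]]
    k[OF assms(1) k[OF assms(3) BD]] k[OF AC BD]
  have 1: "retract G (dsum (dsum A B) (dsum C D)) (dsum A (dsum B (dsum C D)))" by (rule r(1)[OF assms(1,2) CD])
  have 2: "retract G (dsum A (dsum B (dsum C D))) (dsum A (dsum (dsum B C) D))"
    by (rule c[OF assms(1) k[OF assms(2) CD] assms(1) k[OF BC assms(4)] retract_refl[OF assms(1)] r(2)[OF assms(2,3,4)]])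
  have 3: "retract G (dsum A (dsum (dsum B C) D)) (dsum A (dsum (dsum C B) D))"
    by (rule c[OF assms(1) k[OF BC assms(4)] assms(1) k[OF CB assms(4)] retract_refl[OF assms(1)]
      c[OF BC assms(4) CB assms(4) retract_dsum_swap[OF is_group assms(2,3)] retract_refl[OF assms(4)]]])
  have 4: "retract G (dsum A (dsum (dsum C B) D)) (dsum A (dsum C (dsum B D)))"
    by (rule c[OF assms(1) k[OF CB assms(4)] assms(1) k[OF assms(3) BD] retract_refl[OF assms(1)] r(1)[OF assms(3,2,4)]])
  have 5: "retract G (dsum A (dsum C (dsum B D))) (dsum (dsum A C) (dsum B D))" by (rule r(2)[OF assms(1,3) BD])
  show ?thesis
    using retract_trans[OF K(1,2,6) 1 retract_trans[OF K(2,3,6) 2 retract_trans[OF K(3,4,6) 3 retract_trans[OF K(4,5,6) 4 5]]]] .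
qed

lemma triv_upto_dsum:
  assumes "triv_upto n X" "triv_upto m Y"
  shows "triv_upto (n + m) (dsum X Y)"
proof -
  obtain W W' where W: "Fproj W" "retract G X (dsum (triv_mod n) W)" and W': "Fproj W'" "retract G Y (dsum (triv_mod m) W')"
    using assms by (auto simp: triv_upto_def)
  note K = triv_upto_kG[OF assms(1)] triv_upto_kG[OF assms(2)] Fproj_kG[OF W(1)] Fproj_kG[OF W'(1)]
  note k = kG_dsum[OF is_group]
  note k1 = k[OF kG_triv[of G n] K(3)] k[OF kG_triv[of G m] K(4)]
  note kW = k[OF K(3,4)] and kt = k[OF kG_triv[of G n] kG_triv[of G m]]
  have 1: "retract G (dsum X Y) (dsum (dsum (triv_mod n) W) (dsum (triv_mod m) W'))"
    by (rule retract_dsum[OF is_group K(1,2) k1 W(2) W'(2)])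
  have 2: "retract G (dsum (dsum (triv_mod n) W) (dsum (triv_mod m) W')) (dsum (dsum (triv_mod n) (triv_mod m)) (dsum W W'))"
    by (rule retract_shuffle[OF kG_triv K(3) kG_triv K(4)])
  have 3: "retract G (dsum (dsum (triv_mod n) (triv_mod m)) (dsum W W')) (dsum (triv_mod (n + m)) (dsum W W'))"
    by (rule retract_dsum[OF is_group kt kW kG_triv kW rep_eq_retract[OF kt triv_dsum] retract_refl[OF kW]])
  have "retract G (dsum X Y) (dsum (triv_mod (n + m)) (dsum W W'))"
    using retract_trans[OF k[OF K(1,2)] k[OF k1] k[OF kG_triv kW] 1 retract_trans[OF k[OF k1] k[OF kt kW] k[OF kG_triv kW] 2 3]] .
  then show ?thesis unfolding triv_upto_def using k[OF K(1,2)] Fproj_dsum[OF W(1) W'(1)] by blast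
qed

text \<open>When the product is expanded, every term but k^n \<otimes> k^m has an \<F>-projective
  factor and so is \<F>-projective.\<close>

lemma triv_upto_tensor:
  assumes "triv_upto n X" "triv_upto m Y"
  shows "triv_upto (n * m) (tensor_mod X Y)"
proof -
  obtain W W' where W: "Fproj W" "retract G X (dsum (triv_mod n) W)" and W': "Fproj W'" "retract G Y (dsum (triv_mod m) W')"
    using assms by (auto simp: triv_upto_def)
  note K = triv_upto_kG[OF assms(1)] triv_upto_kG[OF assms(2)] Fproj_kG[OF W(1)] Fproj_kG[OF W'(1)]
  note k = kG_dsum[OF is_group] and t = kG_tensor(1)[OF is_group]
  note kn = kG_triv[of G n] and km = kG_triv[of G m]
  have "triv_upto (n * m) (tensor_mod (triv_mod n) (triv_mod m))"
    using triv_upto_retract[OF triv_upto_triv[of "n * m"] t[OF kn km] rep_eq_retract[OF t[OF kn km] tensor_triv_triv[OF is_group]]] .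
  then have "triv_upto (n * m + 0) (dsum (tensor_mod (triv_mod n) (triv_mod m)) (tensor_mod (triv_mod n) W'))"
    by (rule triv_upto_dsum[OF _ triv_upto_Fproj[OF Fproj_tensor(2)[OF W'(1) kn]]])
  then have "triv_upto (n * m) (tensor_mod (triv_mod n) (dsum (triv_mod m) W'))"
    using triv_upto_retract[OF _ t[OF kn k[OF km K(4)]] retract_tensor_dsum_right[OF is_group km K(4) kn]] by simp
  then have "triv_upto (n * m) (tensor_mod (triv_mod n) Y)"
    using triv_upto_retract[OF _ t[OF kn K(2)] retract_tensor[OF is_group kn K(2) kn k[OF km K(4)] retract_refl[OF kn] W'(2)]] by blast
  then have "triv_upto (n * m + 0) (dsum (tensor_mod (triv_mod n) Y) (tensor_mod W Y))"
    by (rule triv_upto_dsum[OF _ triv_upto_Fproj[OF Fproj_tensor(1)[OF W(1) K(2)]]])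
  then have "triv_upto (n * m) (tensor_mod (dsum (triv_mod n) W) Y)"
    using triv_upto_retract[OF _ t[OF k[OF kn K(3)] K(2)] retract_tensor_dsum_left[OF is_group kn K(3,2)]] by simp
  then show ?thesis
    using triv_upto_retract[OF _ t[OF K(1,2)] retract_tensor[OF is_group K(1,2) k[OF kn K(3)] K(2) W(2) retract_refl[OF K(2)]]] by blast
qed

text \<open>Write the identity of \<open>X\<close> as \<open>a1 * b1 + a2 * b2\<close>, through k^n
  and through \<open>Y\<close>. Modulo maps k^n \<rightarrow> Y \<rightarrow> k^n, which vanish,
  \<open>b1 * a1\<close> is an idempotent matrix. Its rank is the multiplicity \<open>m\<close>, its
  splitting embeds k^m in \<open>X\<close>, and the complement factors through
  \<open>Y\<close>.\<close>

lemma triv_upto_structure: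
  assumes "triv_upto n X"
  obtains m W where "m \<le> n" "Fproj W" "retract G W X" "iso_mod G X (dsum (triv_mod m) W)"
    "\<And>l. retract G (triv_mod l) X \<Longrightarrow> l \<le> m"
proof -
  obtain Y where Y: "Fproj Y" "retract G X (dsum (triv_mod n) Y)" and KX: "kG_module G X" using assms by (auto simp: triv_upto_def)
  note KY = Fproj_kG[OF Y(1)] and kn = kG_triv[of G n]
  obtain a1 b1 a2 b2 where m: "mor G (triv_mod n) X a1" "mor G X (triv_mod n) b1" "mor G Y X a2" "mor G X Y b2"
    and one: "a1 * b1 + a2 * b2 = 1\<^sub>m (deg X)"
    by (rule retract_dsumE[OF is_group KX kn KY Y(2)], rule that)
  note d = morD(2,3)[OF m(1)] morD(2,3)[OF m(2)] morD(2,3)[OF m(3)] morD(2,3)[OF m(4)]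
  define e where "e = b1 * a1"
  have e: "e \<in> carrier_mat n n" using d by (auto simp: e_def intro!: carrier_matI)
  \<comment> \<open>A composite k^n \<rightarrow> Y \<rightarrow> k^n with \<open>Y\<close>
    \<F>-projective; its vanishing makes \<open>e\<close> idempotent.\<close>
  have z: "(b1 * a2) * (b2 * a1) = 0\<^sub>m n n"
    by (rule no_triv_throughD[OF Fproj_no_triv_through[OF Y(1)] KY mor_comp[OF kn KX KY m(1,4)] mor_comp[OF KY KX kn m(3,2)]])
  have "b1 * ((a1 * b1 + a2 * b2) * a1) = e" unfolding one e_def using d by (simp add: one_mult_dim)
  moreover have "b1 * ((a1 * b1 + a2 * b2) * a1) = e * e + (b1 * a2) * (b2 * a1)"
    unfolding e_def using d by (simp add: mat_dim_simps)
  ultimately have ee: "e * e = e" unfolding z using e by (simp add: add_zero_dim)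
  obtain r a b where ab: "a \<in> carrier_mat n r" "b \<in> carrier_mat r n" "e = a * b" "b * a = 1\<^sub>m r"
    by (rule idempotent_mat_split[OF e ee], rule that)
  note d' = carrier_matD[OF ab(1)] carrier_matD[OF ab(2)]
  have rn: "r \<le> n" by (rule right_inverse_dim_le[OF ab(2,1,4)])
  have al: "mor G (triv_mod r) X (a1 * a)" by (rule mor_comp[OF kG_triv kn KX mor_triv[OF ab(1)] m(1)])
  have be: "mor G X (triv_mod r) (b * b1)" by (rule mor_comp[OF KX kn kG_triv m(2) mor_triv[OF ab(2)]])
  have eab: "b1 * (a1 * Z) = a * (b * Z)" if "dim_row Z = n" for Z
    using arg_cong[OF ab(3), of "\<lambda>e. e * Z"] that d d' unfolding e_def by (simp add: mult_assoc_dim)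
  have ba: "(b * b1) * (a1 * a) = 1\<^sub>m (deg (triv_mod r :: ('a, 'k) rep))"
    using d d' by (simp add: mult_assoc_dim eab left_inverse_mult_dim[OF ab(4)] ab(4))
  obtain W u v where W: "kG_module G W" "mor G W X u" "mor G X W v" "(a1 * a) * (b * b1) + u * v = 1\<^sub>m (deg X)"
    "v * u = 1\<^sub>m (deg W)" "(b * b1) * u = 0\<^sub>m (deg (triv_mod r :: ('a, 'k) rep)) (deg W)"
    "v * (a1 * a) = 0\<^sub>m (deg W) (deg (triv_mod r :: ('a, 'k) rep))" "iso_mod G X (dsum (triv_mod r) W)"
    by (rule complement_decomposition[OF is_group KX kG_triv al be ba], rule that)
  note du = morD(2,3)[OF W(2)] morD(2,3)[OF W(3)]
  have FW: "Fproj W"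
  proof (rule Fproj_retract[OF Y(1) W(1)], rule retractI)
    show "mor G W Y (b2 * u)" by (rule mor_comp[OF W(1) KX KY W(2) m(4)])
    have ab1: "mor G X X (a1 * b1)" by (rule mor_comp[OF KX kn KX m(2,1)])
    show "mor G Y W (v * (a1 * b1) * a2 + v * a2)"
      by (rule mor_add[OF KY W(1) mor_comp[OF KY KX W(1) m(3) mor_comp[OF KX KX W(1) ab1 W(3)]] mor_comp[OF KY KX W(1) m(3) W(3)]])
    \<comment> \<open>The inner \<open>b1 * a1\<close> is \<open>e = a * b\<close>, so the product
      runs through \<open>v * (a1 * a)\<close> and \<open>(b * b1) * u\<close>, which are zero.
      Inserting the decomposition of the identity before \<open>u\<close> then sends everything that
      remains of the identity of \<open>W\<close> through \<open>Y\<close>.\<close>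
    have "v * (a1 * (b1 * (a1 * (b1 * u)))) = (v * (a1 * a)) * ((b * b1) * u)"
      using d d' du by (simp add: mult_assoc_dim eab)
    also have "\<dots> = 0\<^sub>m (deg W) (deg W)" unfolding W(6,7) by simp
    finally have zero: "v * (a1 * (b1 * (a1 * (b1 * u)))) = 0\<^sub>m (deg W) (deg W)" .
    have "v * (a1 * (b1 * u)) = v * (a1 * (b1 * ((a1 * b1 + a2 * b2) * u)))" unfolding one using du by (simp add: one_mult_dim)
    also have "\<dots> = v * (a1 * (b1 * (a2 * (b2 * u))))"
      using d du zero by (simp add: mat_dim_simps)
    finally have x: "v * (a1 * (b1 * u)) = v * (a1 * (b1 * (a2 * (b2 * u))))" .
    have "1\<^sub>m (deg W) = v * ((a1 * b1 + a2 * b2) * u)" unfolding one using W(5) du by (simp add: one_mult_dim)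
    also have "\<dots> = v * (a1 * (b1 * u)) + v * (a2 * (b2 * u))" using d du by (simp add: mat_dim_simps)
    also have "\<dots> = (v * (a1 * b1) * a2 + v * a2) * (b2 * u)" unfolding x using d du by (simp add: mat_dim_simps)
    finally show "(v * (a1 * b1) * a2 + v * a2) * (b2 * u) = 1\<^sub>m (deg W)" by simp
  qed
  \<comment> \<open>The part of the identity of k^l that passes through \<open>W\<close> vanishes,
    so the identity factors through k^r.\<close>
  have "l \<le> r" if "retract G (triv_mod l) X" for l
  proof -
    from that obtain s t where st: "mor G (triv_mod l) X s" "mor G X (triv_mod l) t" "t * s = 1\<^sub>m l"
      by (auto simp: retract_def)
    note ds = morD(2,3)[OF st(1)] morD(2,3)[OF st(2)]
    have z': "(t * u) * (v * s) = 0\<^sub>m l l"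
      by (rule no_triv_throughD[OF Fproj_no_triv_through[OF FW] W(1) mor_comp[OF kG_triv KX W(1) st(1) W(3)] mor_comp[OF W(1) KX kG_triv W(2) st(2)]])
    have "1\<^sub>m l = t * (((a1 * a) * (b * b1) + u * v) * s)" unfolding W(4) using ds st(3) by (simp add: one_mult_dim)
    also have "\<dots> = (t * (a1 * a)) * ((b * b1) * s) + (t * u) * (v * s)" using d d' du ds by (simp add: mat_dim_simps)
    also have "\<dots> = (t * (a1 * a)) * ((b * b1) * s)" unfolding z' using d d' ds by (simp add: add_zero_dim)
    finally have "(t * (a1 * a)) * ((b * b1) * s) = 1\<^sub>m l" by simp
    then show ?thesis by (rule right_inverse_dim_le[rotated 2]) (use d d' ds in \<open>auto intro!: carrier_matI\<close>)
  qed
  moreover have "retract G W X" using retractI[OF W(2,3,5)] .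
  ultimately show ?thesis using that[OF rn FW _ W(8)] by blast
qed

section \<open>p-permutation modules that are k^n plus an \<F>-projective module\<close>

definition Dade_type :: "('a, 'k) rep \<Rightarrow> bool" where
  "Dade_type X \<longleftrightarrow> p_permutation G X \<and> (\<exists>n. triv_upto n X)"

lemma p_perm_kG: "p_permutation G (X :: ('a, 'k) rep) \<Longrightarrow> kG_module G X"
  by (simp add: p_permutation_iff)

lemma p_perm_retract:
  assumes "p_permutation G X" "kG_module G (Y :: ('a, 'k) rep)" "retract G Y X"
  shows "p_permutation G Y"
proof -
  obtain N :: "('a, 'k) rep" where "is_perm G N" "retract G X N" using assms(1) by (auto simp: p_permutation_iff)
  then show ?thesis unfolding p_permutation_iff
    using assms(2) retract_trans[OF assms(2) p_perm_kG[OF assms(1)] is_perm_kG assms(3)] by blast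
qed

lemma p_perm_dsum:
  assumes "p_permutation G X" "p_permutation G (Y :: ('a, 'k) rep)"
  shows "p_permutation G (dsum X Y)"
proof -
  obtain M N :: "('a, 'k) rep" where MN: "is_perm G M" "retract G X M" "is_perm G N" "retract G Y N"
    using assms by (auto simp: p_permutation_iff)
  note K = p_perm_kG[OF assms(1)] p_perm_kG[OF assms(2)] is_perm_kG[OF MN(1)] is_perm_kG[OF MN(3)]
  show ?thesis unfolding p_permutation_iff
    using kG_dsum[OF is_group K(1,2)] is_perm_dsum[OF is_group MN(1,3)] retract_dsum[OF is_group K MN(2,4)] by blast
qed

lemma p_perm_tensor:
  assumes "p_permutation G X" "p_permutation G (Y :: ('a, 'k) rep)"
  shows "p_permutation G (tensor_mod X Y)"
proof -
  obtain M N :: "('a, 'k) rep" where MN: "is_perm G M" "retract G X M" "is_perm G N" "retract G Y N"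
    using assms by (auto simp: p_permutation_iff)
  note K = p_perm_kG[OF assms(1)] p_perm_kG[OF assms(2)] is_perm_kG[OF MN(1)] is_perm_kG[OF MN(3)]
  show ?thesis unfolding p_permutation_iff
    using kG_tensor(1)[OF is_group K(1,2)] is_perm_tensor[OF is_group MN(1,3)] retract_tensor[OF is_group K MN(2,4)] by blast
qed

lemma p_perm_triv: "p_permutation G (triv_mod n :: ('a, 'k) rep)"
  unfolding p_permutation_iff using kG_triv is_perm_triv retract_refl by blast

lemma Dade_type_retract: "Dade_type X \<Longrightarrow> kG_module G Y \<Longrightarrow> retract G Y X \<Longrightarrow> Dade_type Y"
  unfolding Dade_type_def using p_perm_retract triv_upto_retract by blast

lemma Dade_type_dsum: "Dade_type X \<Longrightarrow> Dade_type Y \<Longrightarrow> Dade_type (dsum X Y)"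
  unfolding Dade_type_def using p_perm_dsum triv_upto_dsum by blast

lemma Dade_type_tensor: "Dade_type X \<Longrightarrow> Dade_type Y \<Longrightarrow> Dade_type (tensor_mod X Y)"
  unfolding Dade_type_def using p_perm_tensor triv_upto_tensor by blast

lemma Dade_type_triv: "Dade_type (triv_mod n)"
  unfolding Dade_type_def using p_perm_triv triv_upto_triv by blast

text \<open>The condition on vertices of components becomes \<F>-projectivity of \<open>W\<close>.
  Conversely, \<open>triv_upto_structure\<close> yields a \<open>W\<close> that is a retract of
  End(M), so it is again p-permutation.\<close>

lemma Dade_module_iff: "Dade_module G p M \<longleftrightarrow> kG_module G M \<and> Dade_type (hom_mod G M M)"
proof
  assume "Dade_module G p M"
  then obtain n and W :: "('a, 'k) rep" where M: "kG_module G M" and W: "p_permutation G W"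
    "\<And>N. component G N W \<Longrightarrow> \<exists>Q\<in>non_syl. vertex G Q N" "iso_mod G (End_mod G M) (dsum (triv_mod n) W)"
    by (auto simp: Dade_module_def)
  note KW = p_perm_kG[OF W(1)] and KH = kG_hom_mod[OF M M]
  have re: "rep_eq G (hom_mod G M M) (End_mod G M)" using rep_eq_sym[OF End_rep_eq[OF is_group M]] by (simp add: hom_mod_def)
  have KE: "kG_module G (End_mod G M)" by (rule rep_eq_kG_module[OF is_group re KH])
  have KD: "kG_module G (dsum (triv_mod n) W)" by (rule kG_dsum[OF is_group kG_triv KW])
  have "Fproj N" if N: "component G N W" for N
    using W(2)[OF N] vertex_non_sylow_iff[of N] N by (auto simp: component_def)
  then have F: "Fproj W" by (rule all_components_Fproj[OF KW])
  have "Dade_type (dsum (triv_mod n) W)"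
    by (rule Dade_type_dsum[OF Dade_type_triv]) (use W(1) triv_upto_Fproj[OF F] in \<open>auto simp: Dade_type_def\<close>)
  moreover have "retract G (hom_mod G M M) (dsum (triv_mod n) W)"
    using retract_trans[OF KH KE KD rep_eq_retract[OF KH re] iso_mod_retract(1)[OF KE KD W(3)]] .
  ultimately show "kG_module G M \<and> Dade_type (hom_mod G M M)" using M Dade_type_retract KH by blast
next
  assume M: "kG_module G M \<and> Dade_type (hom_mod G M M)"
  then have KM: "kG_module G M" and TH: "Dade_type (hom_mod G M M)" by auto
  have re: "rep_eq G (End_mod G M) (hom_mod G M M)" using End_rep_eq[OF is_group KM] by (simp add: hom_mod_def)
  note KH = kG_hom_mod[OF KM KM]
  have KE: "kG_module G (End_mod G M)" by (rule rep_eq_kG_module[OF is_group rep_eq_sym[OF re] KH])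
  have "Dade_type (End_mod G M)" by (rule Dade_type_retract[OF TH KE rep_eq_retract[OF KE re]])
  then obtain n where n: "triv_upto n (End_mod G M)" and pE: "p_permutation G (End_mod G M)" by (auto simp: Dade_type_def)
  obtain m W where W: "Fproj W" "retract G W (End_mod G M)" "iso_mod G (End_mod G M) (dsum (triv_mod m) W)"
    by (rule triv_upto_structure[OF n]) blast
  note KW = Fproj_kG[OF W(1)]
  have "\<exists>Q\<in>non_syl. vertex G Q N" if N: "component G N W" for N
  proof -
    have i: "indecomposable G N" using N by (simp add: component_def)
    then have "Fproj N"
      using Fproj_retract[OF W(1) _ component_retract[OF N KW]] by (auto simp: indecomposable_def)
    then show ?thesis using vertex_non_sylow_iff[OF i] by blast
  qed
  then show "Dade_module G p M" unfolding Dade_module_def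
    using KM W(3) p_perm_retract[OF pE KW W(2)] by blast
qed

lemma capped_Dade_iff: "M \<in> capped_Dade G p S \<longleftrightarrow> kG_module G M \<and> Dade_type (hom_mod G M M) \<and> \<not> Fproj M"
proof -
  have "(\<exists>N. component G N M \<and> vertex G S N) \<longleftrightarrow> \<not> Fproj M" if KM: "kG_module G M"
  proof
    assume "\<exists>N. component G N M \<and> vertex G S N"
    then obtain N where N: "component G N M" "vertex G S N" by blast
    then have "indecomposable G N" by (simp add: component_def)
    then show "\<not> Fproj M"
      using N vertex_sylow_iff[of N] Fproj_retract[OF _ _ component_retract[OF N(1) KM]] by (auto simp: indecomposable_def)
  next
    assume "\<not> Fproj M"
    then obtain N where "component G N M" "\<not> Fproj N" using all_components_Fproj[OF KM] by blast
    then show "\<exists>N. component G N M \<and> vertex G S N" using vertex_sylow_iff[of N] by (auto simp: component_def)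
  qed
  then show ?thesis unfolding capped_Dade_def by (auto simp: Dade_module_iff)
qed

text \<open>If k had multiplicity zero, \<open>M \<otimes> M\<^sup>*\<close> would be
  \<F>-projective, hence also \<open>M \<otimes> M\<^sup>* \<otimes> M\<close> and its retract
  \<open>M\<close>.\<close>

lemma triv_retract_hom_mod:
  assumes "kG_module G M" "Dade_type (hom_mod G M M)" "\<not> Fproj M"
  shows "retract G (triv_mod 1) (hom_mod G M M)" "retract G (triv_mod 1) (tensor_mod (dual_mod G M) M)"
proof -
  note KH = kG_hom_mod[OF assms(1,1)] and KD = kG_dual[OF is_group assms(1)]
  obtain n where n: "triv_upto n (hom_mod G M M)" using assms(2) by (auto simp: Dade_type_def)
  obtain m W where W: "Fproj W" "iso_mod G (hom_mod G M M) (dsum (triv_mod m) W)"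
    by (rule triv_upto_structure[OF n]) blast
  note KW = Fproj_kG[OF W(1)] and KS = kG_dsum[OF is_group kG_triv Fproj_kG[OF W(1)]]
  have "m \<noteq> 0"
  proof
    assume "m = 0"
    then have "retract G (hom_mod G M M) W"
      using retract_trans[OF KH KS KW iso_mod_retract(1)[OF KH KS W(2)]] retract_triv_zero_dsum[OF is_group KW] by simp
    then have "Fproj (hom_mod G M M)" using Fproj_retract[OF W(1) KH] by blast
    then have "Fproj (tensor_mod (hom_mod G M M) M)" by (rule Fproj_tensor(1)[OF _ assms(1)])
    then have "Fproj M" using Fproj_retract[OF _ assms(1) retract_zigzag[OF assms(1)]] by (simp add: hom_mod_def tensor_assoc)
    then show False using assms(3) by blast
  qed
  then have "retract G (triv_mod 1 :: ('a, 'k) rep) (triv_mod m)" by (intro retract_triv_le) simp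
  then show 1: "retract G (triv_mod 1) (hom_mod G M M)"
    using retract_trans[OF kG_triv kG_triv KS _ retract_dsum_left[OF kG_triv KW]]
      retract_trans[OF kG_triv KS KH _ iso_mod_retract(2)[OF KH KS W(2)]] by blast
  show "retract G (triv_mod 1) (tensor_mod (dual_mod G M) M)"
    using retract_trans[OF kG_triv KH kG_tensor(1)[OF is_group KD assms(1)] 1] retract_swap[OF is_group assms(1) KD]
    unfolding hom_mod_def by blast
qed

lemma Dade_type_hom_mod_trans:
  assumes "kG_module G L" "kG_module G M" "kG_module G N" "Dade_type (hom_mod G M M)" "\<not> Fproj M" "Dade_type (hom_mod G L M)" "Dade_type (hom_mod G M N)"
  shows "Dade_type (hom_mod G L N)"
proof (rule Dade_type_retract[OF Dade_type_tensor[OF assms(6,7)] kG_hom_mod[OF assms(1,3)]])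
  let ?N = "dual_mod G N" and ?M = "dual_mod G M"
  note D = kG_dual[OF is_group assms(3)] kG_dual[OF is_group assms(2)] and t = kG_tensor(1)[OF is_group]
  have "retract G (tensor_mod (triv_mod 1) ?N) (tensor_mod (tensor_mod ?M M) ?N)"
    by (rule retract_tensor[OF is_group kG_triv D(1) t[OF D(2) assms(2)] D(1) triv_retract_hom_mod(2)[OF assms(2,4,5)] retract_refl[OF D(1)]])
  then have "retract G ?N (tensor_mod ?M (tensor_mod M ?N))"
    using retract_cong[OF tensor_triv_left[OF is_group D(1)] rep_eq_refl] unfolding tensor_assoc by blast
  then have "retract G (tensor_mod L ?N) (tensor_mod L (tensor_mod ?M (tensor_mod M ?N)))"
    by (rule retract_tensor[OF is_group assms(1) D(1) assms(1) t[OF D(2) t[OF assms(2) D(1)]] retract_refl[OF assms(1)]])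
  then show "retract G (hom_mod G L N) (tensor_mod (hom_mod G L M) (hom_mod G M N))"
    unfolding hom_mod_def tensor_assoc .
qed

lemma Dade_type_hom_mod_tensor:
  assumes "kG_module G M" "kG_module G N" "kG_module G M'" "kG_module G N'" "Dade_type (hom_mod G M M')" "Dade_type (hom_mod G N N')"
  shows "Dade_type (hom_mod G (tensor_mod M N) (tensor_mod M' N'))" 
proof (rule Dade_type_retract[OF Dade_type_tensor[OF assms(5,6)] kG_hom_mod[OF kG_tensor(1)[OF is_group assms(1,2)] kG_tensor(1)[OF is_group assms(3,4)]]])
  show "retract G (hom_mod G (tensor_mod M N) (tensor_mod M' N')) (tensor_mod (hom_mod G M M') (hom_mod G N N'))"
    by (rule retract_hom_mod_tensor[OF assms(1-4)])
qed

end

section \<open>The Dade group\<close>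

lemma mat_tr_linear:
  fixes g f :: "'a::comm_ring_1 mat"
  assumes "g \<in> carrier_mat n n" "f \<in> carrier_mat n n"
  shows "mat_tr (g * (f + c \<cdot>\<^sub>m 1\<^sub>m n)) = mat_tr (g * f) + c * mat_tr g"
proof -
  have "g * (f + c \<cdot>\<^sub>m 1\<^sub>m n) = g * f + c \<cdot>\<^sub>m g"
    using assms by (simp add: mult_add_dim smult_mat_mult mult_one_dim)
  then show ?thesis
    using assms by (simp add: mat_tr_def sum.distrib sum_distrib_left del: index_mult_mat(1))
qed

lemma dual_dsum:
  fixes M N :: "('g, 'k::field) rep"
  assumes "group G" "kG_module G M" "kG_module G N"
  shows "rep_eq G (dual_mod G (dsum M N)) (dsum (dual_mod G M) (dual_mod G N))"
proof -
  interpret group G by fact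
  show ?thesis unfolding rep_eq_def
  proof (intro conjI ballI)
    fix g assume g: "g \<in> carrier G"
    have c: "act M (inv\<^bsub>G\<^esub> g) \<in> carrier_mat (deg M) (deg M)" "act N (inv\<^bsub>G\<^esub> g) \<in> carrier_mat (deg N) (deg N)"
      using assms g by (auto simp: kG_module_def)
    show "act (dual_mod G (dsum M N)) g = act (dsum (dual_mod G M) (dual_mod G N)) g"
      using transpose_four_block_mat[OF c(1) zero_carrier_mat zero_carrier_mat c(2)]
      by (simp add: dual_mod_def dsum_simps)
  qed (simp add: dual_mod_def dsum_simps)
qed

context sylow_rep
begin

section \<open>Compatibility and tensor products of capped Dade modules\<close>

abbreviation capped :: "('a, 'k) rep set" where "capped \<equiv> capped_Dade G p S"

abbreviation compat :: "(('a, 'k) rep \<times> ('a, 'k) rep) set" where "compat \<equiv> compat_rel G p S"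

lemma cappedD:
  assumes "M \<in> capped"
  shows "kG_module G M" "Dade_type (hom_mod G M M)" "\<not> Fproj M"
  using assms by (auto simp: capped_Dade_iff)

lemma Dade_type_hom_mod_dsum_right:
  assumes "kG_module G L" "kG_module G M" "kG_module G N" "Dade_type (hom_mod G L M)" "Dade_type (hom_mod G L N)"
  shows "Dade_type (hom_mod G L (dsum M N))"
proof (rule Dade_type_retract[OF Dade_type_dsum[OF assms(4,5)] kG_hom_mod[OF assms(1) kG_dsum[OF is_group assms(2,3)]]])
  have "rep_eq G (hom_mod G L (dsum M N)) (tensor_mod L (dsum (dual_mod G M) (dual_mod G N)))"
    unfolding hom_mod_def by (rule tensor_cong[OF rep_eq_refl dual_dsum[OF is_group assms(2,3)]])
  then show "retract G (hom_mod G L (dsum M N)) (dsum (hom_mod G L M) (hom_mod G L N))"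
    using retract_cong[OF _ rep_eq_refl]
      retract_tensor_dsum_right[OF is_group kG_dual[OF is_group assms(2)] kG_dual[OF is_group assms(3)] assms(1)]
    unfolding hom_mod_def by blast
qed

text \<open>End(M \<oplus> N) consists of four blocks. The diagonal ones are of Dade type since
  \<open>M\<close> and \<open>N\<close> are Dade modules, which leaves the two mixed ones.\<close>

lemma compat_iff:
  "(M, N) \<in> compat \<longleftrightarrow> M \<in> capped \<and> N \<in> capped \<and> Dade_type (hom_mod G M N) \<and> Dade_type (hom_mod G N M)"
proof -
  have "Dade_type (hom_mod G (dsum M N) (dsum M N)) \<longleftrightarrow> Dade_type (hom_mod G M N) \<and> Dade_type (hom_mod G N M)" if D: "M \<in> capped" "N \<in> capped"
  proof -
    note K = cappedD(1)[OF D(1)] cappedD(1)[OF D(2)]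
    note KS = kG_dsum[OF is_group K]
    note l = retract_dsum_left[OF K] and r = retract_dsum_right[OF K]
    show ?thesis
    proof
      assume t: "Dade_type (hom_mod G (dsum M N) (dsum M N))"
      show "Dade_type (hom_mod G M N) \<and> Dade_type (hom_mod G N M)"
        using Dade_type_retract[OF t kG_hom_mod[OF K] hom_mod_retract[OF K(1) KS K(2) KS l r]]
          Dade_type_retract[OF t kG_hom_mod[OF K(2,1)] hom_mod_retract[OF K(2) KS K(1) KS r l]] by blast
    next
      assume t: "Dade_type (hom_mod G M N) \<and> Dade_type (hom_mod G N M)"
      have "Dade_type (hom_mod G M (dsum M N))" "Dade_type (hom_mod G N (dsum M N))"
        using Dade_type_hom_mod_dsum_right[OF K(1) K cappedD(2)[OF D(1)]] Dade_type_hom_mod_dsum_right[OF K(2) K _ cappedD(2)[OF D(2)]] t by auto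
      then have "Dade_type (dsum (hom_mod G M (dsum M N)) (hom_mod G N (dsum M N)))" by (rule Dade_type_dsum)
      then show "Dade_type (hom_mod G (dsum M N) (dsum M N))"
        using Dade_type_retract[OF _ kG_hom_mod[OF KS KS]] retract_tensor_dsum_left[OF is_group K kG_dual[OF is_group KS]]
        unfolding hom_mod_def by blast
    qed
  qed
  moreover have "Dade_module G p M" if "M \<in> capped" for M :: "('a, 'k) rep"
    using that by (simp add: capped_Dade_def)
  ultimately show ?thesis
    unfolding compat_rel_def compatible_def using kG_dsum[OF is_group] cappedD(1) by (auto simp: Dade_module_iff)
qed

lemma equiv_compat: "equiv capped compat"
proof (rule equivI)
  show "compat \<subseteq> capped \<times> capped" by (auto simp: compat_rel_def)
  show "refl_on capped compat" by (rule refl_onI) (use compat_iff cappedD in auto)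
  show "sym compat" by (rule symI) (use compat_iff in auto)
  show "trans compat"
  proof (rule transI)
    fix L M N :: "('a, 'k) rep" assume "(L, M) \<in> compat" "(M, N) \<in> compat"
    then show "(L, N) \<in> compat"
      unfolding compat_iff using Dade_type_hom_mod_trans[of L M N] Dade_type_hom_mod_trans[of N M L] cappedD by blast
  qed
qed

text \<open>\<open>N \<otimes> N\<^sup>*\<close>, \<open>M \<otimes> N\<^sup>*\<close> and
  \<open>N \<otimes> M\<^sup>*\<close> are all retracts of
  \<open>M \<otimes> M\<^sup>*\<close>.\<close>

lemma retract_in_compat:
  assumes "M \<in> capped" "kG_module G N" "retract G N M" "\<not> Fproj N"
  shows "N \<in> capped" "(M, N) \<in> compat"
proof -
  note K = cappedD(1)[OF assms(1)] and t = cappedD(2)[OF assms(1)] and rM = retract_refl[OF cappedD(1)[OF assms(1)]]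
  show N: "N \<in> capped"
    unfolding capped_Dade_iff using assms Dade_type_retract[OF t kG_hom_mod[OF assms(2,2)] hom_mod_retract[OF assms(2) K assms(2) K assms(3,3)]] by blast
  show "(M, N) \<in> compat"
    unfolding compat_iff using assms(1) N
      Dade_type_retract[OF t kG_hom_mod[OF K assms(2)] hom_mod_retract[OF K K assms(2) K rM assms(3)]]
      Dade_type_retract[OF t kG_hom_mod[OF assms(2) K] hom_mod_retract[OF assms(2) K K K assms(3) rM]] by blast
qed

lemma triv_not_Fproj: "\<not> Fproj (triv_mod 1)"
proof
  assume "Fproj (triv_mod 1)"
  then have "(1\<^sub>m 1 :: 'k mat) * 1\<^sub>m 1 = 0\<^sub>m 1 1"
    by (intro no_triv_throughD[OF Fproj_no_triv_through kG_triv mor_triv mor_triv]) auto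
  then have "(1\<^sub>m 1 :: 'k mat) $$ (0, 0) = 0\<^sub>m 1 1 $$ (0, 0)" by simp
  then show False by simp
qed

text \<open>If \<open>M \<otimes> N\<close> were \<F>-projective, so would be
  \<open>M\<^sup>* \<otimes> M \<otimes> N \<otimes> N\<^sup>*\<close>, which has k as a retract
  because each of its two halves has.\<close>

lemma tensor_capped:
  assumes "M \<in> capped" "N \<in> capped"
  shows "tensor_mod M N \<in> capped"
proof -
  note M = cappedD[OF assms(1)] and N = cappedD[OF assms(2)]
  note t = kG_tensor(1)[OF is_group] and DM = kG_dual[OF is_group M(1)] and DN = kG_dual[OF is_group N(1)]
  have "\<not> Fproj (tensor_mod M N)"
  proof
    assume "Fproj (tensor_mod M N)"
    then have "Fproj (tensor_mod (tensor_mod (dual_mod G M) (tensor_mod M N)) (dual_mod G N))"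
      by (rule Fproj_tensor(1)[OF Fproj_tensor(2)[OF _ DM] DN])
    then have F: "Fproj (tensor_mod (tensor_mod (dual_mod G M) M) (hom_mod G N N))"
      by (simp add: tensor_assoc hom_mod_def)
    have "retract G (tensor_mod (triv_mod 1) (triv_mod 1)) (tensor_mod (tensor_mod (dual_mod G M) M) (hom_mod G N N))"
      by (rule retract_tensor[OF is_group kG_triv kG_triv t[OF DM M(1)] kG_hom_mod[OF N(1,1)] triv_retract_hom_mod(2)[OF M] triv_retract_hom_mod(1)[OF N]])
    then have "retract G (triv_mod 1) (tensor_mod (tensor_mod (dual_mod G M) M) (hom_mod G N N))"
      using retract_cong[OF tensor_triv_left[OF is_group kG_triv] rep_eq_refl] by blast
    then show False using Fproj_retract[OF F kG_triv] triv_not_Fproj by blast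
  qed
  then show ?thesis
    unfolding capped_Dade_iff using t[OF M(1) N(1)] Dade_type_hom_mod_tensor[OF M(1) N(1) M(1) N(1) M(2) N(2)] by blast
qed

lemma tensor_compat:
  assumes "(M, M') \<in> compat" "(N, N') \<in> compat"
  shows "(tensor_mod M N, tensor_mod M' N') \<in> compat"
  using assms tensor_capped Dade_type_hom_mod_tensor[of M N M' N'] Dade_type_hom_mod_tensor[of M' N' M N] cappedD(1)
  unfolding compat_iff by blast

lemma triv_capped: "triv_mod 1 \<in> capped"
proof -
  have "rep_eq G (hom_mod G (triv_mod 1) (triv_mod 1)) (triv_mod 1 :: ('a, 'k) rep)"
    using tensor_cong[OF rep_eq_refl dual_triv[of G 1], of "triv_mod 1 :: ('a, 'k) rep"] tensor_triv_left[OF is_group kG_triv[of G 1]]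
    unfolding hom_mod_def rep_eq_def by auto
  then have "retract G (hom_mod G (triv_mod 1) (triv_mod 1)) (triv_mod 1 :: ('a, 'k) rep)"
    by (rule rep_eq_retract[OF kG_hom_mod[OF kG_triv kG_triv]])
  then show ?thesis
    unfolding capped_Dade_iff using kG_triv triv_not_Fproj Dade_type_retract[OF Dade_type_triv kG_hom_mod[OF kG_triv kG_triv]] by blast
qed

lemma retract_hom_mod_dual:
  assumes "kG_module G M"
  shows "retract G (hom_mod G (dual_mod G M) (dual_mod G M)) (hom_mod G M M)"
proof -
  have "rep_eq G (hom_mod G (dual_mod G M) (dual_mod G M)) (tensor_mod (dual_mod G M) M)"
    unfolding hom_mod_def by (rule tensor_cong[OF rep_eq_refl dual_dual[OF is_group]])
  then show ?thesis
    using retract_cong[OF _ rep_eq_refl] retract_swap[OF is_group kG_dual[OF is_group assms] assms] unfolding hom_mod_def by blast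
qed

lemma dual_capped:
  assumes "M \<in> capped"
  shows "dual_mod G M \<in> capped"
proof -
  note M = cappedD[OF assms] and KD = kG_dual[OF is_group cappedD(1)[OF assms]]
  have "\<not> Fproj (dual_mod G M)"
    using Fproj_tensor(1)[OF _ M(1), of "dual_mod G M"] Fproj_retract[OF _ kG_triv triv_retract_hom_mod(2)[OF M]] triv_not_Fproj by blast
  then show ?thesis
    unfolding capped_Dade_iff using KD Dade_type_retract[OF M(2) kG_hom_mod[OF KD KD] retract_hom_mod_dual[OF M(1)]] by blast
qed

lemma tensor_dual_compat: "M \<in> capped \<Longrightarrow> (tensor_mod (dual_mod G M) M, triv_mod 1) \<in> compat"
  using retract_in_compat(2)[OF tensor_capped[OF dual_capped] kG_triv triv_retract_hom_mod(2)] cappedD triv_not_Fproj by blast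

lemma tensor_triv_compat: "M \<in> capped \<Longrightarrow> (tensor_mod (triv_mod 1) M, M) \<in> compat"
  using retract_in_compat(2)[OF tensor_capped[OF triv_capped]] cappedD
    rep_eq_retract[OF _ rep_eq_sym[OF tensor_triv_left[OF is_group]]] by blast

lemma tensor_comm_compat:
  assumes "M \<in> capped" "N \<in> capped"
  shows "(tensor_mod M N, tensor_mod N M) \<in> compat"
  by (rule retract_in_compat(2)[OF tensor_capped[OF assms] cappedD(1)[OF tensor_capped[OF assms(2,1)]]
      retract_swap[OF is_group cappedD(1)[OF assms(2)] cappedD(1)[OF assms(1)]] cappedD(3)[OF tensor_capped[OF assms(2,1)]]])

section \<open>The group of classes\<close>

definition class_group :: "('a, 'k) rep set \<Rightarrow> (('a, 'k) rep \<times> ('a, 'k) rep) set \<Rightarrow> ('a, 'k) rep set monoid" where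
  "class_group A q = \<lparr>carrier = A // q, monoid.mult = tensor_class q, one = q `` {triv_mod 1}\<rparr>"

text \<open>Stated for a set \<open>A\<close> of capped modules closed under the operations, with
  compatibility restricted to it, so that one proof covers both groups: \<open>A\<close> is the set
  of all capped Dade modules, or that of the strongly capped ones.\<close>

lemma class_group:
  assumes A: "A \<subseteq> capped" "triv_mod 1 \<in> A" "\<And>M N. M \<in> A \<Longrightarrow> N \<in> A \<Longrightarrow> tensor_mod M N \<in> A"
    "\<And>M. M \<in> A \<Longrightarrow> dual_mod G M \<in> A"
    and q: "\<And>M N. (M, N) \<in> q \<longleftrightarrow> M \<in> A \<and> N \<in> A \<and> (M, N) \<in> compat"
  shows "equiv A q" "(\<lambda>M N. q `` {tensor_mod M N}) respects2 q"
    "\<And>M N. M \<in> A \<Longrightarrow> N \<in> A \<Longrightarrow> tensor_class q (q `` {M}) (q `` {N}) = q `` {tensor_mod M N}"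
    "comm_group (class_group A q)"
proof -
  have refl: "(M, M) \<in> compat" if "M \<in> A" for M using that A(1) equiv_compat by (auto simp: equiv_def refl_on_def)
  have sym: "(N, M) \<in> compat" if "(M, N) \<in> compat" for M N using that equiv_compat by (auto simp: equiv_def dest: symD)
  have trans: "(L, N) \<in> compat" if "(L, M) \<in> compat" "(M, N) \<in> compat" for L M N using that equiv_compat by (auto simp: equiv_def dest: transD)
  show eq: "equiv A q"
  proof (rule equivI)
    show "q \<subseteq> A \<times> A" using q by auto
    show "refl_on A q" by (rule refl_onI) (use q refl in auto)
    show "sym q" by (rule symI) (use q sym in blast)
    show "trans q" by (rule transI) (use q trans in blast)
  qed
  have cl: "q `` {M} = q `` {N}" if "M \<in> A" "N \<in> A" "(M, N) \<in> compat" for M N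
    by (rule equiv_class_eq[OF eq]) (use that q in blast)
  show resp: "(\<lambda>M N. q `` {tensor_mod M N}) respects2 q"
  proof (rule congruent2I')
    fix M M' N N' assume "(M, M') \<in> q" "(N, N') \<in> q"
    then show "q `` {tensor_mod M N} = q `` {tensor_mod M' N'}"
      using q tensor_compat A(3) by (intro cl) blast+
  qed
  show tc: "tensor_class q (q `` {M}) (q `` {N}) = q `` {tensor_mod M N}" if "M \<in> A" "N \<in> A" for M N
    unfolding tensor_class_def by (rule UN_equiv_class2[OF eq eq resp that])
  have car: "carrier (class_group A q) = A // q" and mult: "X \<otimes>\<^bsub>class_group A q\<^esub> Y = tensor_class q X Y"
    and one: "\<one>\<^bsub>class_group A q\<^esub> = q `` {triv_mod 1}" for X Y
    by (auto simp: class_group_def)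
  show "comm_group (class_group A q)"
  proof (rule comm_groupI, unfold car mult one)
    fix X Y Z assume X: "X \<in> A // q" and Y: "Y \<in> A // q" and Z: "Z \<in> A // q"
    obtain L M N where L: "X = q `` {L}" "L \<in> A" and M: "Y = q `` {M}" "M \<in> A" and N: "Z = q `` {N}" "N \<in> A"
      using X Y Z by (auto elim!: quotientE)
    show "tensor_class q (tensor_class q X Y) Z = tensor_class q X (tensor_class q Y Z)"
      unfolding L(1) M(1) N(1) by (simp add: tc L(2) M(2) N(2) A(3) tensor_assoc)
  next
    fix X Y assume X: "X \<in> A // q" and Y: "Y \<in> A // q"
    obtain L M where L: "X = q `` {L}" "L \<in> A" and M: "Y = q `` {M}" "M \<in> A"
      using X Y by (auto elim!: quotientE)
    show "tensor_class q X Y \<in> A // q"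
      unfolding L(1) M(1) tc[OF L(2) M(2)] by (rule quotientI[OF A(3)[OF L(2) M(2)]])
    show "tensor_class q X Y = tensor_class q Y X"
      unfolding L(1) M(1) tc[OF L(2) M(2)] tc[OF M(2) L(2)]
      by (rule cl[OF A(3) A(3) tensor_comm_compat]) (use L M A(1) in auto)
  next
    show "q `` {triv_mod 1} \<in> A // q" by (rule quotientI[OF A(2)])
  next
    fix X assume X: "X \<in> A // q"
    obtain L where L: "X = q `` {L}" "L \<in> A" using X by (auto elim!: quotientE)
    then have LD: "L \<in> capped" using A(1) by blast
    show "tensor_class q (q `` {triv_mod 1}) X = X"
      unfolding L(1) tc[OF A(2) L(2)] by (rule cl[OF A(3)[OF A(2) L(2)] L(2) tensor_triv_compat[OF LD]])
    show "\<exists>Y\<in>A // q. tensor_class q Y X = q `` {triv_mod 1}"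
    proof (rule bexI[OF _ quotientI[OF A(4)[OF L(2)]]])
      show "tensor_class q (q `` {dual_mod G L}) X = q `` {triv_mod 1}"
        unfolding L(1) tc[OF A(4)[OF L(2)] L(2)]
        by (rule cl[OF A(3)[OF A(4)[OF L(2)] L(2)] A(2) tensor_dual_compat[OF LD]])
    qed
  qed
qed


section \<open>Caps\<close>

text \<open>If k had multiplicity zero in \<open>C' \<otimes> C\<^sup>*\<close>, then
  \<open>C'\<close> would be \<F>-projective as a retract of
  \<open>C' \<otimes> C\<^sup>* \<otimes> C\<close>. So k splits off, which yields maps
  \<open>?f\<close>, \<open>?g\<close> between \<open>C\<close> and \<open>C'\<close> with tr(g f) =
  1. The composite is not nilpotent, hence invertible, and \<open>C\<close> is a retract of
  \<open>C'\<close>.\<close>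

lemma indecomposable_compat_iso:
  assumes "indecomposable G C" "indecomposable G C'" "(C, C') \<in> compat"
  shows "iso_mod G C C'"
proof -
  have C: "C \<in> capped" "C' \<in> capped" "Dade_type (hom_mod G C' C)" using assms(3) compat_iff by auto
  note K = cappedD(1)[OF C(1)] cappedD(1)[OF C(2)]
  note KX = kG_hom_mod[OF K(2,1)] and KD = kG_dual[OF is_group K(1)] and t = kG_tensor(1)[OF is_group]
  obtain n where n: "triv_upto n (hom_mod G C' C)" using C(3) by (auto simp: Dade_type_def)
  obtain m W where W: "Fproj W" "iso_mod G (hom_mod G C' C) (dsum (triv_mod m) W)"
    by (rule triv_upto_structure[OF n]) blast
  note KW = Fproj_kG[OF W(1)] and KS = kG_dsum[OF is_group kG_triv Fproj_kG[OF W(1)]]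
  have "m \<noteq> 0"
  proof
    assume "m = 0"
    then have "retract G (hom_mod G C' C) W"
      using retract_trans[OF KX KS KW iso_mod_retract(1)[OF KX KS W(2)]] retract_triv_zero_dsum[OF is_group KW] by simp
    then have "Fproj (tensor_mod (hom_mod G C' C) C)" using Fproj_tensor(1)[OF Fproj_retract[OF W(1) KX] K(1)] by blast
    then have F: "Fproj (tensor_mod C' (tensor_mod (dual_mod G C) C))" by (simp add: hom_mod_def tensor_assoc)
    have "retract G (tensor_mod C' (triv_mod 1)) (tensor_mod C' (tensor_mod (dual_mod G C) C))"
      by (rule retract_tensor[OF is_group K(2) kG_triv K(2) t[OF KD K(1)] retract_refl[OF K(2)] triv_retract_hom_mod(2)[OF cappedD[OF C(1)]]])
    then have "retract G C' (tensor_mod C' (tensor_mod (dual_mod G C) C))"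
      using retract_cong[OF tensor_triv_right[OF is_group K(2)] rep_eq_refl] by blast
    then show False using Fproj_retract[OF F K(2)] cappedD(3)[OF C(2)] by blast
  qed
  then have "retract G (triv_mod 1 :: ('a, 'k) rep) (triv_mod m)" by (intro retract_triv_le) simp
  then have "retract G (triv_mod 1) (hom_mod G C' C)"
    using retract_trans[OF kG_triv kG_triv KS _ retract_dsum_left[OF kG_triv KW]]
      retract_trans[OF kG_triv KS KX _ iso_mod_retract(2)[OF KX KS W(2)]] by blast
  then obtain a b where ab: "mor G (triv_mod 1) (hom_mod G C' C) a" "mor G (hom_mod G C' C) (triv_mod 1) b" "b * a = 1\<^sub>m 1"
    by (auto simp: retract_def)
  let ?f = "unvec (deg C') (deg C) a" and ?g = "unrow (deg C') (deg C) b"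
  have f: "mor G C C' ?f" by (rule mor_unvec[OF K(2,1) ab(1)])
  have g: "mor G C' C ?g" by (rule mor_unrow[OF K(2,1) ab(2)])
  have "mat_tr (?g * ?f) = (b * a) $$ (0, 0)"
    by (rule mult_row_col_tr[symmetric]) (use morD(1)[OF ab(1)] morD(1)[OF ab(2)] in auto)
  then have tr: "mat_tr (?g * ?f) = 1" unfolding ab(3) by simp
  have gf: "mor G C C (?g * ?f)" by (rule mor_comp[OF K(1,2,1) f g])
  have "\<not> (\<exists>m. (?g * ?f) ^\<^sub>m m = 0\<^sub>m (deg C) (deg C))"
    using nilpotent_mat_tr[OF morD(1)[OF gf]] tr by auto
  then obtain h where h: "mor G C C h" "h * (?g * ?f) = 1\<^sub>m (deg C)"
    using indecomposable_endomorphism[OF is_group assms(1) gf] by blast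
  have "h * ?g * ?f = 1\<^sub>m (deg C)"
    using h(2) morD(2,3)[OF f] morD(2,3)[OF g] morD(2,3)[OF h(1)] by (simp add: mult_assoc_dim)
  then have "retract G C C'" by (rule retractI[OF f mor_comp[OF K(2,1,1) g h(1)]])
  then show ?thesis by (rule indecomposable_retract_iso[OF is_group assms(1,2)])
qed

text \<open>Over an algebraically closed field every endomorphism of an indecomposable module is singular
  up to a scalar, and composites with singular endomorphisms have trace zero.  So the trace form
  has rank at most one on endomorphisms.\<close>

lemma indecomposable_no_triv_two:
  assumes "indecomposable G (C :: ('a, 'k) rep)"
  shows "\<not> retract G (triv_mod 2) (hom_mod G C C)"
proof
  have K: "kG_module G C" and n: "deg C > 0" using assms by (auto simp: indecomposable_def)
  let ?n = "deg C"
  note KX = kG_hom_mod[OF K K]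
  assume "retract G (triv_mod 2) (hom_mod G C C)"
  then obtain a b where ab: "mor G (triv_mod 2) (hom_mod G C C) a" "mor G (hom_mod G C C) (triv_mod 2) b" "b * a = 1\<^sub>m 2"
    by (auto simp: retract_def)
  note d = morD(2,3)[OF ab(1), unfolded deg_hom_mod triv_simps] morD(2,3)[OF ab(2), unfolded deg_hom_mod triv_simps]
  \<comment> \<open>\<open>c j\<close> is the basis vector \<open>e_j\<close> of k^2. It cuts the
    retraction into maps \<open>f j\<close> and \<open>g i\<close> whose products have the traces of
    an identity matrix of size 2.\<close>
  define c where "c j = (sel_mat 2 1 (\<lambda>_. j) :: 'k mat)" for j
  have dc: "dim_row (c j) = 2" "dim_col (c j) = 1" for j by (auto simp: c_def)
  define f where "f j = unvec ?n ?n (a * c j)" for j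
  define g where "g i = unrow ?n ?n (transpose_mat (c i) * b)" for i
  have f: "mor G C C (f j)" for j
    unfolding f_def by (rule mor_unvec[OF K K mor_comp[OF kG_triv kG_triv KX mor_triv ab(1)]]) (use dc in \<open>auto intro: carrier_matI\<close>)
  have g: "mor G C C (g i)" for i
    unfolding g_def by (rule mor_unrow[OF K K mor_comp[OF KX kG_triv kG_triv ab(2) mor_triv]]) (use dc in \<open>auto intro: carrier_matI\<close>)
  have tr: "mat_tr (g i * f j) = (if i = j then 1 else 0)" if "i < 2" "j < 2" for i j
  proof -
    have "mat_tr (g i * f j) = ((transpose_mat (c i) * b) * (a * c j)) $$ (0, 0)"
      unfolding g_def f_def by (rule mult_row_col_tr[symmetric]) (use d dc in \<open>auto intro!: carrier_matI\<close>)
    also have "(transpose_mat (c i) * b) * (a * c j) = transpose_mat (c i) * ((b * a) * c j)"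
      using d dc by (simp add: mult_assoc_dim)
    also have "(b * a) * c j = c j" unfolding ab(3) using dc by (simp add: one_mult_dim)
    also have "(transpose_mat (c i) * c j) $$ (0, 0) = c j $$ (i, 0)"
      unfolding c_def using that by (subst transpose_sel_mult_index) auto
    also have "\<dots> = (if i = j then 1 else 0)" unfolding c_def using that by auto
    finally show ?thesis .
  qed
  \<comment> \<open>An eigenvalue of \<open>f j\<close>: subtracting it as a scalar makes
    \<open>f j\<close> singular.\<close>
  have "\<exists>l. det (char_matrix (f j) l) = 0" for j
  proof -
    note fj = morD(1)[OF f[of j]]
    have "degree (char_poly (f j)) > 0" using degree_monic_char_poly[OF fj] n by simp
    then obtain l where "poly (char_poly (f j)) l = 0" using alg_closed_imp_poly_has_root by blast
    then show ?thesis using eigenvalue_root_char_poly[OF fj] eigenvalue_det[OF fj] by blast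
  qed
  then obtain l where l: "\<And>j. det (char_matrix (f j) (l j)) = 0" by metis
  have e: "mat_tr (g i * f j) = l j * mat_tr (g i)" for i j
  proof -
    let ?N = "char_matrix (f j) (l j)"
    note fj = morD(1)[OF f[of j]] and gi = morD(1)[OF g[of i]]
    have N: "?N = f j + (- l j) \<cdot>\<^sub>m 1\<^sub>m ?n" unfolding char_matrix_def using fj by simp
    have mN: "mor G C C ?N" unfolding N by (intro mor_add mor_smult mor_one f K)
    have gN: "mor G C C (g i * ?N)" by (rule mor_comp[OF K K K mN g])
    \<comment> \<open>A product with a singular factor is not invertible, so it is nilpotent and has
      trace zero.\<close>
    have "\<not> (\<exists>h. mor G C C h \<and> h * (g i * ?N) = 1\<^sub>m ?n \<and> (g i * ?N) * h = 1\<^sub>m ?n)"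
    proof
      assume "\<exists>h. mor G C C h \<and> h * (g i * ?N) = 1\<^sub>m ?n \<and> (g i * ?N) * h = 1\<^sub>m ?n"
      then obtain h where h: "mor G C C h" "h * (g i * ?N) = 1\<^sub>m ?n" by blast
      have "det (h * (g i * ?N)) = det h * (det (g i) * det ?N)"
        using det_mult[OF morD(1)[OF h(1)] morD(1)[OF gN]] det_mult[OF gi morD(1)[OF mN]] by simp
      then show False unfolding h(2) l by simp
    qed
    then obtain m where "(g i * ?N) ^\<^sub>m m = 0\<^sub>m ?n ?n"
      using indecomposable_endomorphism[OF is_group assms gN] by blast
    then have "mat_tr (g i * ?N) = 0" by (rule nilpotent_mat_tr[OF morD(1)[OF gN]])
    then show ?thesis unfolding N using mat_tr_linear[OF gi fj, of "- l j"] by simp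
  qed
  \<comment> \<open>By the first equation the trace of \<open>g 0\<close> is nonzero, so the second
    gives \<open>l 1 = 0\<close>, against the third.\<close>
  have "l 0 * mat_tr (g 0) = 1" "l 1 * mat_tr (g 0) = 0" "l 1 * mat_tr (g 1) = 1"
    using tr[of 0 0] tr[of 0 1] tr[of 1 1] e by simp_all
  then show False by auto
qed

lemma indecomposable_triv_upto_one:
  assumes "indecomposable G C" "C \<in> capped"
  shows "triv_upto 1 (hom_mod G C C)"
proof -
  note K = cappedD(1)[OF assms(2)] and KX = kG_hom_mod[OF cappedD(1)[OF assms(2)] cappedD(1)[OF assms(2)]]
  obtain n where n: "triv_upto n (hom_mod G C C)" using cappedD(2)[OF assms(2)] by (auto simp: Dade_type_def)
  obtain m W where W: "Fproj W" "iso_mod G (hom_mod G C C) (dsum (triv_mod m) W)"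
    by (rule triv_upto_structure[OF n]) blast
  note KW = Fproj_kG[OF W(1)] and KS = kG_dsum[OF is_group kG_triv Fproj_kG[OF W(1)]]
  have "m \<le> 1"
  proof (rule ccontr)
    assume "\<not> m \<le> 1"
    then have "retract G (triv_mod 2 :: ('a, 'k) rep) (triv_mod m)" by (intro retract_triv_le) simp
    then have "retract G (triv_mod 2) (hom_mod G C C)"
      using retract_trans[OF kG_triv kG_triv KS _ retract_dsum_left[OF kG_triv KW]]
        retract_trans[OF kG_triv KS KX _ iso_mod_retract(2)[OF KX KS W(2)]] by blast
    then show False using indecomposable_no_triv_two[OF assms(1)] by blast
  qed
  then have "retract G (dsum (triv_mod m) W) (dsum (triv_mod 1) W)"
    by (intro retract_dsum is_group kG_triv KW retract_triv_le retract_refl)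
  then have "retract G (hom_mod G C C) (dsum (triv_mod 1) W)"
    using retract_trans[OF KX KS kG_dsum[OF is_group kG_triv KW] iso_mod_retract(1)[OF KX KS W(2)]] by blast
  then show ?thesis unfolding triv_upto_def using KX W(1) by blast
qed

text \<open>\<open>triv_upto 1\<close> allows at most one copy of k, and being capped supplies one.
  Conversely, the copy of k in End(M) prevents a strongly capped \<open>M\<close> from being
  \<F>-projective.\<close>

lemma strongly_capped_iff: "M \<in> strongly_capped G p \<longleftrightarrow> M \<in> capped \<and> triv_upto 1 (hom_mod G M M)"
proof
  assume "M \<in> strongly_capped G p"
  then obtain W where KM: "kG_module G M" and pE: "p_permutation G (End_mod G M)" and F: "Fproj W"
    and iso: "iso_mod G (End_mod G M) (dsum (triv_mod 1) W)"
    by (auto simp: strongly_capped_def endo_p_permutation_def V_projective_iff)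
  have re: "rep_eq G (hom_mod G M M) (End_mod G M)" using rep_eq_sym[OF End_rep_eq[OF is_group KM]] by (simp add: hom_mod_def)
  note KH = kG_hom_mod[OF KM KM] and KW = Fproj_kG[OF F]
  have KE: "kG_module G (End_mod G M)" by (rule p_perm_kG[OF pE])
  have KS: "kG_module G (dsum (triv_mod 1) W)" by (rule kG_dsum[OF is_group kG_triv KW])
  have "triv_upto 1 (End_mod G M)" unfolding triv_upto_def using KE F iso_mod_retract(1)[OF KE KS iso] by blast
  then have s: "triv_upto 1 (hom_mod G M M)" by (rule triv_upto_retract[OF _ KH rep_eq_retract[OF KH re]])
  have "Dade_type (hom_mod G M M)" unfolding Dade_type_def using s p_perm_retract[OF pE KH rep_eq_retract[OF KH re]] by blast
  moreover have "\<not> Fproj M"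
  proof
    assume "Fproj M"
    then have "Fproj (hom_mod G M M)" unfolding hom_mod_def by (rule Fproj_tensor(1)[OF _ kG_dual[OF is_group KM]])
    then have "Fproj (End_mod G M)" by (rule Fproj_retract[OF _ KE rep_eq_retract[OF KE rep_eq_sym[OF re]]])
    moreover have "retract G (triv_mod 1) (End_mod G M)"
      using retract_trans[OF kG_triv KS KE retract_dsum_left[OF kG_triv KW] iso_mod_retract(2)[OF KE KS iso]] .
    ultimately show False using Fproj_retract[OF _ kG_triv] triv_not_Fproj by blast
  qed
  ultimately show "M \<in> capped \<and> triv_upto 1 (hom_mod G M M)" using s KM by (simp add: capped_Dade_iff)
next
  assume M: "M \<in> capped \<and> triv_upto 1 (hom_mod G M M)"
  then have D: "M \<in> capped" and s: "triv_upto 1 (hom_mod G M M)" by auto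
  note M = cappedD[OF D]
  have re: "rep_eq G (End_mod G M) (hom_mod G M M)" using End_rep_eq[OF is_group M(1)] by (simp add: hom_mod_def)
  note KH = kG_hom_mod[OF M(1,1)]
  have KE: "kG_module G (End_mod G M)" by (rule rep_eq_kG_module[OF is_group rep_eq_sym[OF re] KH])
  note rE = rep_eq_retract[OF KE re] and rH = rep_eq_retract[OF KH rep_eq_sym[OF re]]
  have sE: "triv_upto 1 (End_mod G M)" by (rule triv_upto_retract[OF s KE rE])
  obtain m W where W: "m \<le> 1" "Fproj W" "iso_mod G (End_mod G M) (dsum (triv_mod m) W)"
    and le: "\<And>l. retract G (triv_mod l) (End_mod G M) \<Longrightarrow> l \<le> m"
    by (rule triv_upto_structure[OF sE]) blast
  have "1 \<le> m" by (rule le[OF retract_trans[OF kG_triv KH KE triv_retract_hom_mod(1)[OF M] rH]])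
  then have "m = 1" using W(1) by simp
  moreover have "p_permutation G (End_mod G M)"
    by (rule p_perm_retract[OF _ KE rE]) (use M(2) in \<open>simp add: Dade_type_def\<close>)
  ultimately show "M \<in> strongly_capped G p"
    unfolding strongly_capped_def endo_p_permutation_def V_projective_iff using M(1) W(2,3) by blast
qed

text \<open>\<open>cap\<close> chooses among the components with vertex \<open>S\<close>. What is
  used of the choice is that it is an indecomposable retract and not \<F>-projective.\<close>

lemma cap_props:
  assumes "M \<in> capped"
  shows "indecomposable G (cap G S M)" "(M, cap G S M) \<in> compat"
proof -
  have "\<exists>C. component G C M \<and> vertex G S C" using assms by (simp add: capped_Dade_def)
  then have c: "component G (cap G S M) M \<and> vertex G S (cap G S M)" unfolding cap_def by (rule someI_ex)
  then show i: "indecomposable G (cap G S M)" by (simp add: component_def)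
  show "(M, cap G S M) \<in> compat"
    by (rule retract_in_compat(2)[OF assms _ component_retract])
      (use c i vertex_sylow_iff[OF i] cappedD(1)[OF assms] in \<open>auto simp: indecomposable_def\<close>)
qed

text \<open>Each module is compatible with its cap, so compatibility of modules is that of their
  caps, and for indecomposable modules this is isomorphism. Thus \<open>cap_rel\<close> is the
  restriction of compatibility.\<close>

lemma cap_rel_iff:
  "(M, N) \<in> cap_rel G p S \<longleftrightarrow> M \<in> strongly_capped G p \<and> N \<in> strongly_capped G p \<and> (M, N) \<in> compat"
proof -
  have sym: "(N, M) \<in> compat" if "(M, N) \<in> compat" for M N using that equiv_compat by (auto simp: equiv_def dest: symD)
  have trans: "(L, N) \<in> compat" if "(L, M) \<in> compat" "(M, N) \<in> compat" for L M N using that equiv_compat by (auto simp: equiv_def dest: transD)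
  have "iso_mod G (cap G S M) (cap G S N) \<longleftrightarrow> (M, N) \<in> compat"
    if "M \<in> strongly_capped G p" "N \<in> strongly_capped G p"
  proof -
    have D: "M \<in> capped" "N \<in> capped" using that strongly_capped_iff by auto
    note cM = cap_props[OF D(1)] and cN = cap_props[OF D(2)]
    have C: "cap G S M \<in> capped" "cap G S N \<in> capped" using cM(2) cN(2) compat_iff by auto
    show ?thesis
    proof
      assume "iso_mod G (cap G S M) (cap G S N)"
      then have "(cap G S M, cap G S N) \<in> compat"
        using retract_in_compat(2)[OF C(1) cappedD(1)[OF C(2)] _ cappedD(3)[OF C(2)]] iso_mod_retract(2)[OF cappedD(1)[OF C(1)] cappedD(1)[OF C(2)]] by blast
      then show "(M, N) \<in> compat" using trans[OF trans[OF cM(2)] sym[OF cN(2)]] by blast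
    next
      assume "(M, N) \<in> compat"
      then have "(cap G S M, cap G S N) \<in> compat" using trans[OF trans[OF sym[OF cM(2)]] cN(2)] by blast
      then show "iso_mod G (cap G S M) (cap G S N)" by (rule indecomposable_compat_iso[OF cM(1) cN(1)])
    qed
  qed
  then show ?thesis unfolding cap_rel_def by blast
qed

theorem Dade_groups:
  shows "equiv capped compat" "(\<lambda>M N. compat `` {tensor_mod M N}) respects2 compat"
    "\<And>M N. M \<in> capped \<Longrightarrow> N \<in> capped \<Longrightarrow> tensor_class compat (compat `` {M}) (compat `` {N}) = compat `` {tensor_mod M N}"
    "comm_group (Dade_group G p S :: ('a, 'k) rep set monoid)"
    "comm_group (Lassueur_Dade_group G p S :: ('a, 'k) rep set monoid)"
    "(Dade_group G p S :: ('a, 'k) rep set monoid) \<cong> (Lassueur_Dade_group G p S :: ('a, 'k) rep set monoid)"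
proof -
  let ?SC = "strongly_capped G p :: ('a, 'k) rep set" and ?q = "cap_rel G p S :: (('a, 'k) rep \<times> ('a, 'k) rep) set"
  have SD: "?SC \<subseteq> capped" using strongly_capped_iff by blast
  have compat_capped_iff: "(M, N) \<in> compat \<longleftrightarrow> M \<in> capped \<and> N \<in> capped \<and> (M, N) \<in> compat" for M N using compat_iff by blast
  have D: "equiv capped compat" "(\<lambda>M N. compat `` {tensor_mod M N}) respects2 compat"
    "\<And>M N. M \<in> capped \<Longrightarrow> N \<in> capped \<Longrightarrow> tensor_class compat (compat `` {M}) (compat `` {N}) = compat `` {tensor_mod M N}"
    "comm_group (class_group capped compat)"
    by (rule class_group[OF subset_refl triv_capped tensor_capped dual_capped compat_capped_iff]; assumption)+
  have triv: "triv_mod 1 \<in> ?SC"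
  proof -
    have "rep_eq G (hom_mod G (triv_mod 1) (triv_mod 1)) (triv_mod 1 :: ('a, 'k) rep)"
      using tensor_cong[OF rep_eq_refl dual_triv[of G 1], of "triv_mod 1 :: ('a, 'k) rep"] tensor_triv_left[OF is_group kG_triv[of G 1]]
      unfolding hom_mod_def rep_eq_def by auto
    then show ?thesis
      using strongly_capped_iff triv_capped triv_upto_retract[OF triv_upto_triv[of 1] kG_hom_mod[OF kG_triv kG_triv]] rep_eq_retract[OF kG_hom_mod[OF kG_triv kG_triv]] by blast
  qed
  have tens: "tensor_mod M N \<in> ?SC" if "M \<in> ?SC" "N \<in> ?SC" for M N
  proof -
    have MN: "M \<in> capped" "N \<in> capped" "triv_upto 1 (hom_mod G M M)" "triv_upto 1 (hom_mod G N N)" using that strongly_capped_iff by auto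
    note K = cappedD(1)[OF MN(1)] cappedD(1)[OF MN(2)] and KT = cappedD(1)[OF tensor_capped[OF MN(1,2)]]
    have "triv_upto (1 * 1) (tensor_mod (hom_mod G M M) (hom_mod G N N))" by (rule triv_upto_tensor[OF MN(3,4)])
    then have "triv_upto 1 (hom_mod G (tensor_mod M N) (tensor_mod M N))"
      using triv_upto_retract[OF _ kG_hom_mod[OF KT KT] retract_hom_mod_tensor[OF K K]] by simp
    then show ?thesis using strongly_capped_iff tensor_capped[OF MN(1,2)] by blast
  qed
  have dual: "dual_mod G M \<in> ?SC" if "M \<in> ?SC" for M
  proof -
    have M: "M \<in> capped" "triv_upto 1 (hom_mod G M M)" using that strongly_capped_iff by auto
    note KD = cappedD(1)[OF dual_capped[OF M(1)]]
    show ?thesis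
      using strongly_capped_iff dual_capped[OF M(1)] triv_upto_retract[OF M(2) kG_hom_mod[OF KD KD] retract_hom_mod_dual[OF cappedD(1)[OF M(1)]]] by blast
  qed
  have L: "equiv ?SC ?q"
    "\<And>M N. M \<in> ?SC \<Longrightarrow> N \<in> ?SC \<Longrightarrow> tensor_class ?q (?q `` {M}) (?q `` {N}) = ?q `` {tensor_mod M N}"
    "comm_group (class_group ?SC ?q)"
    by (rule class_group(1,3,4)[OF SD triv tens dual cap_rel_iff]; assumption)+
  have DG: "Dade_group G p S = class_group capped compat" by (simp add: Dade_group_def class_group_def)
  have LG: "Lassueur_Dade_group G p S = class_group ?SC ?q" by (simp add: Lassueur_Dade_group_def class_group_def)
  show "equiv capped compat" by (rule D(1))
  show "(\<lambda>M N. compat `` {tensor_mod M N}) respects2 compat" by (rule D(2))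
  show "\<And>M N. M \<in> capped \<Longrightarrow> N \<in> capped \<Longrightarrow> tensor_class compat (compat `` {M}) (compat `` {N}) = compat `` {tensor_mod M N}" by (rule D(3))
  show "comm_group (Dade_group G p S :: ('a, 'k) rep set monoid)" unfolding DG by (rule D(4))
  show "comm_group (Lassueur_Dade_group G p S :: ('a, 'k) rep set monoid)" unfolding LG by (rule L(3))
  \<comment> \<open>Enlarging a class of strongly capped modules gives the compatibility class of
    any of its members.\<close>
  have im: "compat `` (?q `` {M}) = compat `` {M}" if "M \<in> ?SC" for M
  proof -
    have "(M, M) \<in> ?q" using L(1) that by (auto simp: equiv_def refl_on_def)
    moreover have "(M, N) \<in> compat" if "(M, L) \<in> ?q" "(L, N) \<in> compat" for L N
      using that cap_rel_iff D(1) by (auto simp: equiv_def dest: transD)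
    ultimately show ?thesis by blast
  qed
  have car: "carrier (class_group A q) = A // q" and mult: "X \<otimes>\<^bsub>class_group A q\<^esub> Y = tensor_class q X Y"
    for A q X Y by (auto simp: class_group_def)
  \<comment> \<open>The isomorphism is built from Lassueur's group to the Dade group, where
    enlarging a class needs no choice of representatives; it is inverted at the end.\<close>
  have "(\<lambda>X. compat `` X) \<in> iso (class_group ?SC ?q) (class_group capped compat)"
    unfolding iso_def mem_Collect_eq
  proof (intro conjI homI)
    fix X assume "X \<in> carrier (class_group ?SC ?q)"
    then obtain M where M: "M \<in> ?SC" "X = ?q `` {M}" unfolding car by (auto elim!: quotientE)
    then show "compat `` X \<in> carrier (class_group capped compat)" unfolding car M(2) im[OF M(1)] using SD by (intro quotientI) blast
  next
    fix X Y assume "X \<in> carrier (class_group ?SC ?q)" "Y \<in> carrier (class_group ?SC ?q)"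
    then obtain M N where M: "M \<in> ?SC" "X = ?q `` {M}" and N: "N \<in> ?SC" "Y = ?q `` {N}"
      unfolding car by (auto elim!: quotientE)
    have "M \<in> capped" "N \<in> capped" using M(1) N(1) SD by auto
    then show "compat `` (X \<otimes>\<^bsub>class_group ?SC ?q\<^esub> Y) = compat `` X \<otimes>\<^bsub>class_group capped compat\<^esub> compat `` Y"
      unfolding mult M(2) N(2) L(2)[OF M(1) N(1)] im[OF M(1)] im[OF N(1)] im[OF tens[OF M(1) N(1)]]
      by (rule D(3)[symmetric])
  next
    show "bij_betw (\<lambda>X. compat `` X) (carrier (class_group ?SC ?q)) (carrier (class_group capped compat))"
      unfolding bij_betw_def car
    proof (rule conjI, rule inj_onI, rule_tac [2] subset_antisym, rule_tac [2] subsetI, rule_tac [3] subsetI)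
      fix X Y assume "X \<in> ?SC // ?q" "Y \<in> ?SC // ?q" and e: "compat `` X = compat `` Y"
      then obtain M N where M: "M \<in> ?SC" "X = ?q `` {M}" and N: "N \<in> ?SC" "Y = ?q `` {N}"
        by (auto elim!: quotientE)
      have "(M, N) \<in> compat"
        using e M(1) N(1) SD eq_equiv_class_iff[OF D(1), of M N] unfolding M(2) N(2) im[OF M(1)] im[OF N(1)] by blast
      then have "(M, N) \<in> ?q" using cap_rel_iff M(1) N(1) by blast
      then show "X = Y" unfolding M(2) N(2) by (rule equiv_class_eq[OF L(1)])
    next
      fix Y assume "Y \<in> (\<lambda>X. compat `` X) ` (?SC // ?q)"
      then obtain M where "M \<in> ?SC" "Y = compat `` (?q `` {M})" by (auto elim!: quotientE)
      then show "Y \<in> capped // compat" using im[of M] SD by (auto intro!: quotientI)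
    next
      fix Y assume "Y \<in> capped // compat"
      then obtain M where M: "M \<in> capped" "Y = compat `` {M}" by (auto elim!: quotientE)
      note c = cap_props[OF M(1)]
      have CD: "cap G S M \<in> capped" using c(2) compat_iff by blast
      \<comment> \<open>The cap is indecomposable and capped, so k occurs only once in its
        endomorphisms: it is a strongly capped member of the class.\<close>
      have SC: "cap G S M \<in> ?SC" using strongly_capped_iff CD indecomposable_triv_upto_one[OF c(1) CD] by blast
      have "Y = compat `` (?q `` {cap G S M})"
        unfolding im[OF SC] M(2) by (rule equiv_class_eq[OF D(1) c(2)])
      then show "Y \<in> (\<lambda>X. compat `` X) ` (?SC // ?q)" using quotientI[OF SC] by blast
    qed
  qed
  then have "class_group ?SC ?q \<cong> class_group capped compat" by (rule is_isoI)
  then show "(Dade_group G p S :: ('a, 'k) rep set monoid) \<cong> (Lassueur_Dade_group G p S :: ('a, 'k) rep set monoid)"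
    unfolding DG LG using group.iso_sym comm_group.axioms(2)[OF L(3)] by blast
qed

end

theorem theorem1p2:
  fixes G :: "('g, 'b) monoid_scheme" and p :: nat and S :: "'g set"
    and D :: "('g, 'k::alg_closed_field) rep set" and r :: "(('g, 'k) rep \<times> ('g, 'k) rep) set"
    and DG LG :: "('g, 'k) rep set monoid"
  defines "D \<equiv> capped_Dade G p S" and "r \<equiv> compat_rel G p S"
    and "DG \<equiv> Dade_group G p S" and "LG \<equiv> Lassueur_Dade_group G p S"
  assumes "group G" and "finite (carrier G)"
    and "prime p" and "CHAR('k) = p"
    and "sylow_subgroup G p S"
  shows "equiv D r
    \<and> (\<forall>M\<in>D. \<forall>N\<in>D. tensor_mod M N \<in> D)
    \<and> (\<lambda>M N. r `` {tensor_mod M N}) respects2 r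
    \<and> (\<forall>M\<in>D. \<forall>N\<in>D. r `` {M} \<otimes>\<^bsub>DG\<^esub> r `` {N} = r `` {tensor_mod M N})
    \<and> comm_group DG
    \<and> comm_group LG
    \<and> DG \<cong> LG"
proof -
  interpret sylow_rep G p S "TYPE('k)"
    using assms(5-9) by (intro sylow_rep.intro sylow_rep_axioms.intro)
  have "X \<otimes>\<^bsub>DG\<^esub> Y = tensor_class r X Y" for X Y
    by (simp add: DG_def Dade_group_def r_def)
  then show ?thesis
    using Dade_groups tensor_capped unfolding D_def r_def DG_def LG_def by simp
qed

end
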